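(* The monoid variety $\mathbf P_2^1$ generated by the monoid $P_2^1=\langle a,b,1\mid a^2=ab=a,\ b^2a=b^2\rangle=\{a,b,ba,b^2,1\}$ is hereditary finitely based.
   Context: Monoids are algebras of type $\langle 2,0\rangle$; varieties are varieties of monoids. $P_2^1$ is the monoid with identity element $1$ given by generators $a,b$ and the indicated relations; it has exactly the five elements listed. A variety is finitely based if it can be defined by a finite set of identities; it is hereditary finitely based if all its subvarieties are finitely based. *)

theory Defs
  imports "HOL-Algebra.Group"
begin

section \<open>Identities and varieties of monoids\<close>

text \<open>
  Modulo the monoid axioms, every term of type $\langle 2,0\rangle$ is a (possibly empty) word over
  the countable set of variables \<open>nat\<close>; an identity is therefore a pair of such words.
\<close>

type_synonym identity = "nat list \<times> nat list"

definition word_value :: "('a, 'm) monoid_scheme \<Rightarrow> ('v \<Rightarrow> 'a) \<Rightarrow> 'v list \<Rightarrow> 'a" where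
  "word_value G \<phi> w = foldr (\<lambda>x y. \<phi> x \<otimes>\<^bsub>G\<^esub> y) w \<one>\<^bsub>G\<^esub>"

definition satisfies :: "('a, 'm) monoid_scheme \<Rightarrow> identity \<Rightarrow> bool" where
  "satisfies G e \<longleftrightarrow>
     (\<forall>\<phi>. range \<phi> \<subseteq> carrier G \<longrightarrow> word_value G \<phi> (fst e) = word_value G \<phi> (snd e))"

text \<open>
  A class of monoids is represented by its members whose carrier is a set of elements of a type
  \<open>'a\<close>. If \<open>'a\<close> is infinite, no information is lost for varieties: the free object on countably many
  generators of a variety is countable, so it has a copy in \<open>'a\<close>, and it determines all
  identities of the variety.
\<close>

definition models :: "identity set \<Rightarrow> 'a monoid set" where
  "models \<Sigma> = {G. monoid G \<and> (\<forall>e\<in>\<Sigma>. satisfies G e)}"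

definition variety :: "'a monoid set \<Rightarrow> bool" where
  "variety V \<longleftrightarrow> (\<exists>\<Sigma>. V = models \<Sigma>)"

text \<open>
  The smallest variety containing a given monoid. As the monoid need not have its carrier in
  \<open>'a\<close>, containment is up to isomorphism.
\<close>

definition variety_generated_by :: "('b, 'm) monoid_scheme \<Rightarrow> 'a monoid set" where
  "variety_generated_by M = \<Inter>{V. variety V \<and> (\<exists>N\<in>V. M \<cong> N)}"

definition finitely_based :: "'a monoid set \<Rightarrow> bool" where
  "finitely_based V \<longleftrightarrow> (\<exists>\<Sigma>. finite \<Sigma> \<and> V = models \<Sigma>)"

definition hereditary_finitely_based :: "'a monoid set \<Rightarrow> bool" where
  "hereditary_finitely_based V \<longleftrightarrow> (\<forall>W. variety W \<and> W \<subseteq> V \<longrightarrow> finitely_based W)"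


section \<open>Monoid presentations\<close>

inductive pres_eq :: "('g list \<times> 'g list) set \<Rightarrow> 'g list \<Rightarrow> 'g list \<Rightarrow> bool"
  for R :: "('g list \<times> 'g list) set" where
  refl: "pres_eq R u u"
| sym: "pres_eq R u v \<Longrightarrow> pres_eq R v u"
| trans: "pres_eq R u v \<Longrightarrow> pres_eq R v w \<Longrightarrow> pres_eq R u w"
| rel: "(u, v) \<in> R \<Longrightarrow> pres_eq R (p @ u @ q) (p @ v @ q)"

definition pres_class :: "('g list \<times> 'g list) set \<Rightarrow> 'g list \<Rightarrow> 'g list set" where
  "pres_class R u = {v. pres_eq R u v}"

definition presented_monoid :: "('g list \<times> 'g list) set \<Rightarrow> 'g list set monoid" where
  "presented_monoid R =
     \<lparr>carrier = range (pres_class R),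
      mult = (\<lambda>X Y. \<Union>u\<in>X. \<Union>v\<in>Y. pres_class R (u @ v)),
      one = pres_class R []\<rparr>"

lemma pres_eq_append:
  assumes "pres_eq R u u'" and "pres_eq R v v'"
  shows "pres_eq R (u @ v) (u' @ v')"
proof -
  have l: "pres_eq R (p @ x @ q) (p @ y @ q)" if "pres_eq R x y" for x y p q
    using that
  proof (induction)
    case (rel x y r s)
    show ?case using pres_eq.rel[OF rel, of "p @ r" "s @ q"] by simp
  next
    case (trans x y z)
    from trans.IH show ?case by (rule pres_eq.trans)
  qed (rule pres_eq.refl, rule pres_eq.sym)
  have "pres_eq R (u @ v) (u' @ v)" and "pres_eq R (u' @ v) (u' @ v')"
    using l[OF assms(1), of "[]" v] l[OF assms(2), of u' "[]"] by simp_all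
  then show ?thesis by (rule pres_eq.trans)
qed

lemma pres_class_eq_iff: "pres_class R u = pres_class R v \<longleftrightarrow> pres_eq R u v"
proof
  assume "pres_class R u = pres_class R v"
  then have "v \<in> pres_class R u"
    using pres_eq.refl[of R v] by (simp add: pres_class_def)
  then show "pres_eq R u v"
    by (simp add: pres_class_def)
next
  assume uv: "pres_eq R u v"
  then have "pres_eq R u w \<longleftrightarrow> pres_eq R v w" for w
    using pres_eq.trans[OF uv, of w] pres_eq.trans[OF pres_eq.sym[OF uv], of w] by blast
  then show "pres_class R u = pres_class R v"
    by (simp add: pres_class_def)
qed

lemma presented_monoid_mult:
  "pres_class R u \<otimes>\<^bsub>presented_monoid R\<^esub> pres_class R v = pres_class R (u @ v)"
proof -
  have "pres_class R (u' @ v') = pres_class R (u @ v)"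
    if "u' \<in> pres_class R u" "v' \<in> pres_class R v" for u' v'
  proof -
    have "pres_eq R (u @ v) (u' @ v')"
      using that by (intro pres_eq_append) (simp_all add: pres_class_def)
    then show ?thesis
      by (simp add: pres_class_eq_iff pres_eq.sym)
  qed
  moreover have "w \<in> pres_class R w" for w
    by (simp add: pres_class_def pres_eq.refl)
  ultimately have "(\<Union>x\<in>pres_class R u. \<Union>y\<in>pres_class R v. pres_class R (x @ y)) =
      pres_class R (u @ v)"
    by blast
  then show ?thesis
    by (simp add: presented_monoid_def)
qed

lemma monoid_presented_monoid: "monoid (presented_monoid R)"
proof -
  have c: "carrier (presented_monoid R) = range (pres_class R)"
    and o: "\<one>\<^bsub>presented_monoid R\<^esub> = pres_class R []"
    by (simp_all add: presented_monoid_def)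
  show ?thesis
    by (rule monoidI) (auto simp: c o presented_monoid_mult)
qed


section \<open>The monoid $P_2^1$\<close>

datatype gen = gen_a | gen_b

definition P21_relations :: "(gen list \<times> gen list) set" where
  "P21_relations =
     {([gen_a, gen_a], [gen_a]),
      ([gen_a, gen_b], [gen_a]),
      ([gen_b, gen_b, gen_a], [gen_b, gen_b])}"

definition P21 :: "gen list set monoid" where
  "P21 = presented_monoid P21_relations"

fun P21_nf :: "gen list \<Rightarrow> gen list" where
  "P21_nf [] = []"
| "P21_nf (gen_a # w) = [gen_a]"
| "P21_nf (gen_b # w) =
     (if P21_nf w = [] then [gen_b]
      else if P21_nf w = [gen_a] then [gen_b, gen_a]
      else [gen_b, gen_b])"

lemma P21_eq_iff:
  "pres_eq P21_relations u v \<longleftrightarrow> P21_nf u = P21_nf v"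
  (is "pres_eq ?R u v \<longleftrightarrow> _")
proof
  have l: "P21_nf (p @ x) = P21_nf (p @ y)" if "P21_nf x = P21_nf y" for p x y
  proof (induction p)
    case (Cons g p)
    then show ?case by (cases g) auto
  qed (use that in auto)
  show "P21_nf u = P21_nf v" if "pres_eq ?R u v"
    using that
  proof induction
    case (rel x y p q)
    then have "P21_nf (x @ q) = P21_nf (y @ q)" by (auto simp: P21_relations_def)
    then show ?case by (rule l)
  qed auto
next
  have aw: "pres_eq ?R (gen_a # w) [gen_a]" for w
  proof (induction w)
    case (Cons g w)
    have "([gen_a, g], [gen_a]) \<in> ?R" by (cases g) (auto simp: P21_relations_def)
    from pres_eq.rel[OF this, of "[]" w] have "pres_eq ?R (gen_a # g # w) (gen_a # w)"
      by simp
    then show ?case using Cons.IH by (rule pres_eq.trans)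
  qed (rule pres_eq.refl)
  have bb: "pres_eq ?R [gen_b, gen_b, gen_a] [gen_b, gen_b]"
    using pres_eq.rel[of "[gen_b, gen_b, gen_a]" "[gen_b, gen_b]" ?R "[]" "[]"] by (simp add: P21_relations_def)
  have bbab: "pres_eq ?R [gen_b, gen_b, gen_a, gen_b] [gen_b, gen_b, gen_a]"
    using pres_eq.rel[of "[gen_a, gen_b]" "[gen_a]" ?R "[gen_b, gen_b]" "[]"] by (simp add: P21_relations_def)
  have "pres_eq ?R [gen_b, gen_b, gen_a, gen_b] [gen_b, gen_b, gen_b]"
    using pres_eq.rel[of "[gen_b, gen_b, gen_a]" "[gen_b, gen_b]" ?R "[]" "[gen_b]"] by (simp add: P21_relations_def)
  then have bbb: "pres_eq ?R [gen_b, gen_b, gen_b] [gen_b, gen_b]"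
    by (rule pres_eq.trans[OF pres_eq.sym pres_eq.trans[OF bbab bb]])
  have nf: "pres_eq ?R w (P21_nf w)" for w
  proof (induction w rule: P21_nf.induct)
    case (3 w)
    have nf_cases: "P21_nf w \<in> {[], [gen_a], [gen_b], [gen_b, gen_a], [gen_b, gen_b]}"
      by (induction w rule: P21_nf.induct) auto
    have "pres_eq ?R (gen_b # w) (gen_b # P21_nf w)"
      using pres_eq_append[OF pres_eq.refl[of ?R "[gen_b]"] 3(1)] by simp
    moreover have "pres_eq ?R (gen_b # P21_nf w) (P21_nf (gen_b # w))"
      using nf_cases bb bbb by (auto intro: pres_eq.refl)
    ultimately show ?case by (rule pres_eq.trans)
  qed (auto intro: pres_eq.refl aw)
  show "pres_eq ?R u v" if "P21_nf u = P21_nf v"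
    using pres_eq.trans[OF nf[of u]] pres_eq.sym[OF nf[of v]] that by simp
qed

text \<open>The listed five elements are exactly the elements of the presented monoid.\<close>

lemma P21_elements:
  defines "cls \<equiv> pres_class P21_relations"
  shows "carrier P21 = {cls [gen_a], cls [gen_b], cls [gen_b, gen_a], cls [gen_b, gen_b], cls []}"
    and "card (carrier P21) = 5"
proof -
  have cls: "cls u = cls v \<longleftrightarrow> P21_nf u = P21_nf v" for u v
    unfolding cls_def by (simp add: pres_class_eq_iff P21_eq_iff)
  have nf_cases: "P21_nf w \<in> {[], [gen_a], [gen_b], [gen_b, gen_a], [gen_b, gen_b]}" for w
    by (induction w rule: P21_nf.induct) auto
  have "cls w \<in> {cls [gen_a], cls [gen_b], cls [gen_b, gen_a], cls [gen_b, gen_b], cls []}" for w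
    using nf_cases[of w] by (auto simp: cls)
  then have "range cls = {cls [gen_a], cls [gen_b], cls [gen_b, gen_a], cls [gen_b, gen_b], cls []}"
    by blast
  moreover have "carrier P21 = range cls"
    by (simp add: P21_def presented_monoid_def cls_def)
  ultimately show c: "carrier P21 = {cls [gen_a], cls [gen_b], cls [gen_b, gen_a], cls [gen_b, gen_b], cls []}"
    by simp
  show "card (carrier P21) = 5"
    unfolding c by (simp add: cls)
qed

lemma monoid_P21: "monoid P21"
  unfolding P21_def by (rule monoid_presented_monoid)

end

(*
  Two words have the same value in P_2^1 under all assignments iff for all letters x, y the number of
  occurrences of x before the first y agrees up to 2; the axioms xyxzx = xyxz and xzytxy = xzytyx
  suffice to derive this, so only first and second occurrences matter and adjacent second
  occurrences commute. Let T be the equational theory of a subvariety and u = v an identity of T.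
  Bubble sort transforms u into v by interchanging adjacent occurrences. Assign to a letter its
  depth, the length of a shortest path to a letter occurring once, where y succeeds x if y first
  occurs between the first two occurrences of x. Deleting all letters except those involved in an
  interchange and those on such shortest paths turns u = v into one of a few parametrized laws, and
  conversely the law implies the interchange in the original word, since a longer word is an
  instance of the law up to third occurrences. The least depth l of a letter whose first occurrence
  is ever moved bounds the parameters of all laws but one (K_law), for which the least parameter that
  occurs in T suffices. Hence T is generated by its identities in boundedly many letters.
*)
theory Submission
  imports Defs "HOL-Library.Extended_Nat" "HOL-Library.Multiset"
begin

section \<open>Words and first occurrences\<close>

text \<open>The obstacle is that depths are unbounded, so the laws read off from identities form
  infinite families. Two facts cut these down. A letter of depth greater than \<open>l\<close> can
  have its second occurrence drawn back to its first one by \<open>R_law\<close> or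
  \<open>R_inf\<close> (\<open>double\<close>); once doubled it has no successors, so it behaves
  like a letter of infinite depth. Hence, among the letters whose first occurrence moves, only those
  of depth exactly \<open>l\<close> contribute a parameter. Secondly, a tail of length
  \<open>m\<close> begins with tails of all smaller lengths, so \<open>K_law k\<close> implies
  \<open>K_law m\<close> for k \<le> m in any equational theory, and the least member of the family
  suffices even if \<open>l\<close> is infinite and the parameter has no bound. Letters of depth
  less than \<open>l\<close> keep their place in both words; this is why a shortest path through
  them looks the same in \<open>u\<close> and in \<open>v\<close>, and why deletion leaves two words
  of known shape.\<close>

text \<open>
  \<open>before u x y\<close> counts, up to 2, the occurrences of \<open>x\<close> before the first occurrence of \<open>y\<close>. If \<open>y\<close> does
  not occur in \<open>u\<close>, all of \<open>u\<close> is taken, so \<open>before u x\<close> also records whether \<open>x\<close> occurs never, once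
  or at least twice. The identities of $P_2^1$ are exactly those preserving \<open>before\<close>.
\<close>

definition before :: "nat list \<Rightarrow> nat \<Rightarrow> nat \<Rightarrow> nat" where
  "before u x y = min 2 (count_list (takeWhile (\<lambda>z. z \<noteq> y) u) x)"

definition same :: "nat list \<Rightarrow> nat list \<Rightarrow> bool" where
  "same u v \<longleftrightarrow> (\<forall>x y. before u x y = before v x y)"

definition short :: "nat list \<Rightarrow> bool" where
  "short u \<longleftrightarrow> (\<forall>x. count_list u x \<le> 2)"

definition substitute ::
  "(nat \<Rightarrow> nat list) \<Rightarrow> nat list \<Rightarrow> nat list" where
  "substitute \<sigma> w = concat (map \<sigma> w)"

lemma before_Nil [simp]: "before [] x y = 0"
  by (simp add: before_def)

lemma before_Cons:
  "before (a # u) x y = (if a = y then 0 else min 2 ((if a = x then 1 else 0) + before u x y))"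
  by (auto simp: before_def min_def)

lemma before_le2: "before u x y \<le> 2"
  by (simp add: before_def)

lemma min_before [simp]: "min 2 (before u x y) = before u x y"
  by (simp add: before_def)

lemma before_append:
  "before (g @ w) x y = (if y \<in> set g then before g x y else min 2 (count_list g x + before w x y))"
  by (induction g) (auto simp: before_Cons)

lemma in_set_iff_count: "x \<in> set u \<longleftrightarrow> min 2 (count_list u x) \<noteq> 0"
  by (cases "count_list u x") (auto simp: count_list_0_iff, metis count_list_0_iff nat.distinct(1))

lemma before_self [simp]: "before u y y = 0"
  by (induction u) (auto simp: before_Cons)

lemma before_notin: "y \<notin> set u \<Longrightarrow> before u x y = min 2 (count_list u x)"
  using before_append[of u "[]" x y] by simp

lemma before_le_count: "before u x y \<le> count_list u x"
  by (induction u) (auto simp: before_Cons)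

lemma before_asym: "1 \<le> before u a b \<Longrightarrow> before u b a = 0"
  by (induction u) (auto simp: before_Cons split: if_splits)

text \<open>The prefix up to the first \<open>b\<close> lies inside the prefix up to the first
  \<open>c\<close>.\<close>

lemma before_mono: "1 \<le> before u b c \<Longrightarrow> before u a b \<le> before u a c"
  by (induction u) (auto simp: before_Cons split: if_splits)

lemma before_total:
  "before u b c = 0 \<Longrightarrow> b \<in> set u \<Longrightarrow> b \<noteq> c \<Longrightarrow> 1 \<le> before u c b"
  by (induction u) (auto simp: before_Cons split: if_splits)

lemma before_filter:
  "before (filter (\<lambda>x. x \<in> L) u) a b =
     (if a \<notin> L then 0 else if b \<in> L then before u a b else min 2 (count_list u a))"
  by (induction u) (auto simp: before_Cons)

section \<open>Words that agree in all values of \<open>before\<close>\<close>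

lemma same_refl [simp]: "same u u"
  and same_sym: "same u v \<Longrightarrow> same v u"
  and same_trans: "same u v \<Longrightarrow> same v w \<Longrightarrow> same u w"
  by (simp_all add: same_def)

lemma same_count:
  assumes "same u v"
  shows "min 2 (count_list u x) = min 2 (count_list v x)"
proof -
  obtain y where y: "y \<notin> set u \<union> set v"
    using ex_new_if_finite[of "set u \<union> set v"] infinite_UNIV_nat by auto
  then show ?thesis
    using assms before_notin[of y u x] before_notin[of y v x] by (simp add: same_def)
qed

lemma same_set: "same u v \<Longrightarrow> set u = set v"
  using same_count[of u v] by (intro Set.set_eqI) (simp only: in_set_iff_count)

text \<open>What follows a prefix sees it only through its letters and their multiplicities up to 2.
  After a law has rewritten \<open>h\<close> to \<open>h'\<close>, this puts the original rest of
  the word back.\<close>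

lemma same_append:
  assumes "same (h @ w) (h @ w')" "\<And>x. min 2 (count_list h x) = min 2 (count_list h' x)"
  shows "same (h' @ w) (h' @ w')"
proof -
  have s: "set h = set h'"
    using assms(2) by (intro Set.set_eqI) (simp only: in_set_iff_count)
  have c: "min 2 (a + b) = min 2 (min 2 a + b)" for a b :: nat
    by auto
  show ?thesis
    using assms(1) unfolding same_def before_append s
    by (metis (no_types, lifting) assms(2) c)
qed

lemma same_insert_one: "2 \<le> count_list g x \<Longrightarrow> same (g @ x # w) (g @ w)"
  unfolding same_def before_append before_Cons by (auto intro: count_notin)

text \<open>Third occurrences are invisible to \<open>before\<close>; inserting them is what turns a
  word into an instance of a law.\<close>

lemma same_insert:
  "(\<And>x. x \<in> set a \<Longrightarrow> 2 \<le> count_list g x) \<Longrightarrow> same (g @ a @ w) (g @ w)"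
proof (induction a)
  case (Cons x a)
  have "same (g @ x # (a @ w)) (g @ a @ w)"
    by (rule same_insert_one) (simp add: Cons.prems)
  with Cons show ?case by (auto intro: same_trans)
qed simp

text \<open>Neither occurrence is a first one, so no prefix that ends at a first occurrence
  separates them.\<close>

lemma same_swap:
  "c \<in> set h \<Longrightarrow> d \<in> set h \<Longrightarrow> same (h @ c # d # w) (h @ d # c # w)"
proof -
  assume "c \<in> set h" "d \<in> set h"
  then have "same (h @ [c, d]) (h @ [d, c])"
    by (auto simp: same_def before_append before_Cons)
  moreover have "min 2 (count_list (h @ [c,d]) x) = min 2 (count_list (h @ [d,c]) x)" for x
    by simp
  ultimately have "before ((h @ [c,d]) @ w) x y = before ((h @ [d,c]) @ w) x y" for x y
    unfolding before_append[of _ w] by (simp add: same_def)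
  then show ?thesis by (simp add: same_def)
qed

lemma split_count2:
  assumes "2 \<le> count_list g x"
  obtains a b c where "g = a @ x # b @ x # c" "x \<notin> set a" "x \<notin> set b"
proof -
  have "x \<in> set g" using assms by (metis count_list_0_iff not_numeral_le_zero)
  then obtain a g' where g: "g = a @ x # g'" "x \<notin> set a"
    by (meson split_list_first)
  then have "x \<in> set g'" using assms
    by (metis (no_types, lifting) Nat.add_0_right One_nat_def Suc_1 Suc_n_not_le_n add.commute count_list.simps(2)
        count_list_0_iff count_list_append plus_1_eq_Suc)
  then obtain b c where "g' = b @ x # c" "x \<notin> set b"
    by (meson split_list_first)
  with g that show thesis by blast
qed

section \<open>Equational theories containing the identities of $P_2^1$\<close>

text \<open>These are the fully invariant congruences of the free monoid over
  \<open>nat\<close>.\<close>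

locale equational_theory =
  fixes eq :: "nat list \<Rightarrow> nat list \<Rightarrow> bool" (infix "\<approx>" 50)
  assumes refl [simp, intro]: "u \<approx> u"
    and sym: "u \<approx> v \<Longrightarrow> v \<approx> u"
    and trans: "u \<approx> v \<Longrightarrow> v \<approx> w \<Longrightarrow> u \<approx> w"
    and cong: "u \<approx> u' \<Longrightarrow> v \<approx> v' \<Longrightarrow> u @ v \<approx> u' @ v'"
    and subst: "u \<approx> v \<Longrightarrow> substitute \<sigma> u \<approx> substitute \<sigma> v"
begin

lemma ctx: "u \<approx> v \<Longrightarrow> p @ u @ q \<approx> p @ v @ q"
  by (simp add: cong)

text \<open>Deleting letters means substituting the empty word for them.\<close>

lemma restrict:
  "u \<approx> v \<Longrightarrow> filter (\<lambda>x. x \<in> L) u \<approx> filter (\<lambda>x. x \<in> L) v"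
proof -
  have "substitute (\<lambda>x. if x \<in> L then [x] else []) u = filter (\<lambda>x. x \<in> L) u"
    for u
    by (induction u) (auto simp: substitute_def)
  then show "u \<approx> v \<Longrightarrow> ?thesis"
    using subst[of u v "\<lambda>x. if x \<in> L then [x] else []"] by simp
qed

end

section \<open>Completeness of the two axioms with respect to \<open>same\<close>\<close>

locale P_theory = equational_theory +
  assumes P1: "[0,1,0,2,0] \<approx> [0,1,0,2]"
    and P2: "[0,2,1,3,0,1] \<approx> [0,2,1,3,1,0]"
begin

lemma P1_inst: "x # a @ x # b @ [x] \<approx> x # a @ x # b"
  using subst[OF P1, of "\<lambda>n. if n = 0 then [x] else if n = 1 then a else b"]
  by (simp add: substitute_def)

lemma P2_inst: "x # a @ y # b @ [x, y] \<approx> x # a @ y # b @ [y, x]"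
  using subst[OF P2, of
    "\<lambda>n. if n = 0 then [x] else if n = 1 then [y] else if n = 2 then a else b"]
  by (simp add: substitute_def)

lemma insert_third:
  assumes "2 \<le> count_list g x"
  shows "g @ x # w \<approx> g @ w"
proof -
  from assms obtain a b c where "g = a @ x # b @ x # c"
    by (rule split_count2)
  then show ?thesis
    using ctx[OF P1_inst[of x b c], of a w] by simp
qed

text \<open>\<open>P2\<close> fixes which of the two letters occurs first; the other order is the
  same law read from right to left.\<close>

lemma swap_seconds:
  assumes "c \<in> set h" "d \<in> set h"
  shows "h @ c # d # w \<approx> h @ d # c # w"
proof (cases "c = d")
  case False
  obtain a b where h: "h = a @ c # b" using assms(1) by (meson split_list)
  consider "d \<in> set a" | "d \<in> set b" using assms(2) False h by auto
  then show ?thesis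
  proof cases
    case 1
    then obtain a1 a2 where "a = a1 @ d # a2" by (meson split_list)
    with h show ?thesis using sym[OF ctx[OF P2_inst[of d a2 c b], of a1 w]] by simp
  next
    case 2
    then obtain b1 b2 where "b = b1 @ d # b2" by (meson split_list)
    with h show ?thesis using ctx[OF P2_inst[of c b1 d b2], of a w] by simp
  qed
qed simp

text \<open>Whether an occurrence is a third one depends only on what stands to its left, hence
  induction on the last letter.\<close>

lemma shorten: "\<exists>u'. u \<approx> u' \<and> same u u' \<and> short u'"
proof (induction u rule: rev_induct)
  case Nil
  then show ?case by (intro exI[of _ "[]"]) (simp add: short_def)
next
  case (snoc x u)
  then obtain u' where u': "u \<approx> u'" "same u u'" "short u'" by blast
  have e: "u @ [x] \<approx> u' @ [x]" using cong[OF u'(1)] by simp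
  have s: "same (u @ [x]) (u' @ [x])"
  proof -
    have "min 2 (count_list u y + k) = min 2 (count_list u' y + k)" for y k
      using same_count[OF u'(2), of y] by (auto simp: min_def split: if_splits)
    then show ?thesis
      using u'(2) same_set[OF u'(2)] by (simp add: same_def before_append)
  qed
  show ?case
  proof (cases "2 \<le> count_list u' x")
    case True
    from insert_third[OF this, of "[]"] same_insert_one[OF this, of "[]"] e s u'
    show ?thesis by (metis append_Nil2 trans same_trans)
  next
    case False
    then have "short (u' @ [x])" using u'(3) by (auto simp: short_def)
    with e s show ?thesis by blast
  qed
qed

text \<open>
  When adjacent occurrences of \<open>d\<close>
    and \<open>c\<close> have to be interchanged, at most one of them is a second
  occurrence, unless both are (third alternative); the inequalities on \<open>before\<close> say that the two
  occurrences are in the opposite order in \<open>v\<close>.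
\<close>

lemma bubble_sort:
  assumes swap:
    "\<And>h d c w. \<lbrakk>Q (h @ d # c # w); mset (h @ d # c # w) = mset v; d \<noteq> c;
       c \<notin> set h \<and> before v d c < before (h @ d # c # w) d c \<or>
       count_list h c = 1 \<and> d \<notin> set h \<and> before (h @ d # c # w) c d < before v c d \<or>
       c \<in> set h \<and> d \<in> set h\<rbrakk> \<Longrightarrow> h @ d # c # w \<approx> h @ c # d # w \<and> Q (h @ c # d # w)"
    and "short v" "Q u" "mset u = mset v"
  shows "u \<approx> v"
proof -
  \<comment> \<open>\<open>c\<close> is the letter that follows the common prefix \<open>p\<close>
    in \<open>v\<close>; it is drawn to the left over \<open>a\<close>, one letter at a
    time.\<close>
  have pull: "\<exists>s'. p @ a @ c # s \<approx> p @ c # s' \<and> Q (p @ c # s') \<and> mset s' = mset t"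
    if "v = p @ c # t" "c \<notin> set a" "Q (p @ a @ c # s)" "mset (a @ s) = mset t" for p a c s t
    using that(2-4)
  proof (induction a arbitrary: s rule: rev_induct)
    case Nil
    then show ?case by auto
  next
    case (snoc d a)
    have "mset v = mset (p @ a @ d # c # s)"
      using snoc.prems(3) that(1) by simp
    then have cnt: "count_list v x = count_list (p @ a @ d # c # s) x" for x
      by (metis count_mset)
    have le: "count_list v x \<le> 2" for x using assms(2) by (simp add: short_def)
    have dc: "d \<noteq> c" using snoc.prems by auto
    have "(p @ a) @ d # c # s \<approx> (p @ a) @ c # d # s \<and> Q ((p @ a) @ c # d # s)"
    proof (rule swap)
      show "Q ((p @ a) @ d # c # s)" using snoc.prems by simp
      show "mset ((p @ a) @ d # c # s) = mset v" using snoc.prems that(1) by simp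
      show "d \<noteq> c" by (rule dc)
      have "d \<in> set t"
        using snoc.prems(3) by (metis in_set_conv_decomp set_append set_mset_mset Un_iff)
      consider "c \<notin> set p" | "c \<in> set p" "d \<notin> set (p @ a)" | "c \<in> set p"
        "d \<in> set (p @ a)"
        by blast
      then show "c \<notin> set (p @ a) \<and> before v d c < before ((p @ a) @ d # c # s) d c \<or>
         count_list (p @ a) c = 1 \<and> d \<notin> set (p @ a) \<and> before ((p @ a) @ d # c # s) c d < before v c d \<or>
         c \<in> set (p @ a) \<and> d \<in> set (p @ a)"
      proof cases
        case 1
        \<comment> \<open>The occurrences of \<open>d\<close> in \<open>a\<close> and the one next
          to \<open>c\<close> precede the first \<open>c\<close> in the current word but not in
          \<open>v\<close>. Shortness of \<open>v\<close> ensures that the cap 2 does not hide this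
          difference.\<close>
        have "count_list p d + count_list a d + 1 \<le> 2"
          using cnt[of d] le[of d] dc by simp
        with 1 show ?thesis using snoc.prems(1) dc
          by (simp add: before_append before_Cons that(1))
      next
        case 2
        have "count_list a c = 0" using snoc.prems(1) by (simp add: count_list_0_iff)
        moreover have "count_list p c \<noteq> 0" using 2 by (simp add: count_list_0_iff)
        moreover have "count_list p c + count_list a c + 1 \<le> 2"
          using cnt[of c] le[of c] dc by simp
        ultimately have "count_list p c = 1" "count_list a c = 0" by simp_all
        with 2 dc show ?thesis
          by (simp add: before_append before_Cons that(1))
      qed simp
    qed
    moreover obtain s' where "p @ a @ c # d # s \<approx> p @ c # s'" "Q (p @ c # s')"
      "mset s' = mset t"
      using snoc.IH[of "d # s"] snoc.prems calculation by auto
    ultimately show ?case using trans by auto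
  qed
  have "p @ s \<approx> p @ t" if "v = p @ t" "Q (p @ s)" "mset s = mset t" for p s t
    using that
  proof (induction t arbitrary: p s)
    case (Cons c t)
    then have "c \<in> set s" by (metis list.set_intros(1) set_mset_mset)
    then obtain a s1 where s: "s = a @ c # s1" "c \<notin> set a" by (meson split_list_first)
    have "mset (a @ s1) = mset t" using Cons.prems(3) s by simp
    then obtain s' where s': "p @ s \<approx> p @ c # s'" "Q (p @ c # s')" "mset s' = mset t"
      using pull[OF Cons.prems(1) s(2)] Cons.prems(2) s by auto
    moreover have "(p @ [c]) @ s' \<approx> (p @ [c]) @ t"
      using Cons.IH[of "p @ [c]" s'] s' Cons.prems(1) by simp
    ultimately show ?case using trans by simp
  qed simp
  from this[of "[]" v u] assms show ?thesis by simp
qed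

lemma short_same_mset:
  "short u \<Longrightarrow> short v \<Longrightarrow> (\<And>x. min 2 (count_list u x) = min 2 (count_list v x)) \<Longrightarrow> mset u = mset v"
  by (rule multiset_eqI) (simp add: count_mset short_def min_absorb2)

text \<open>Between words related by \<open>same\<close>, the first two alternatives of
  \<open>bubble_sort\<close> cannot arise, which leaves swaps of repeated letters.\<close>

theorem same_imp_eq:
  assumes "same u v"
  shows "u \<approx> v"
proof -
  obtain u' v' where u': "u \<approx> u'" "same u u'" "short u'" and v': "v \<approx> v'"
    "same v v'" "short v'"
    using shorten by meson
  have "same u' v'" using u' v' assms by (meson same_sym same_trans)
  have "u' \<approx> v'"
  proof (rule bubble_sort[where Q = "\<lambda>u. same u v'"])
    fix h d c w
    assume a: "same (h @ d # c # w) v'"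
       "c \<notin> set h \<and> before v' d c < before (h @ d # c # w) d c \<or>
       count_list h c = 1 \<and> d \<notin> set h \<and> before (h @ d # c # w) c d < before v' c d \<or>
       c \<in> set h \<and> d \<in> set h"
    then have "c \<in> set h" "d \<in> set h" by (auto simp: same_def)
    then show "h @ d # c # w \<approx> h @ c # d # w \<and> same (h @ c # d # w) v'"
      using swap_seconds same_swap a(1) same_trans by blast
  next
    show "mset u' = mset v'"
      by (rule short_same_mset) (use u' v' \<open>same u' v'\<close> same_count in auto)
  qed (use \<open>same u' v'\<close> v' in auto)
  with u' v' show ?thesis by (meson sym trans)
qed

end

section \<open>Depth\<close>

text \<open>
  Draw an edge from \<open>x\<close> to \<open>y\<close>
    if \<open>y\<close> first occurs between the first two occurrences of \<open>x\<close>. The depth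
  of a letter is the length of a shortest path to a letter that occurs only once; \<open>depth_ge n u x\<close> says
  that it is at least \<open>n\<close>.
\<close>

primrec depth_ge :: "nat \<Rightarrow> nat list \<Rightarrow> nat \<Rightarrow> bool" where
  "depth_ge 0 u x \<longleftrightarrow> True"
| "depth_ge (Suc n) u x \<longleftrightarrow> 2 \<le> count_list u x \<and> (\<forall>y\<in>set u. before u x y = 1 \<longrightarrow> depth_ge n u y)"

text \<open>The extended parameter allows one treatment of finite and infinite depth in all later
  interchanges.\<close>

definition depth_at_least ::
  "enat \<Rightarrow> nat list \<Rightarrow> nat \<Rightarrow> bool" where
  "depth_at_least l u x \<longleftrightarrow> (\<forall>n. enat n \<le> l \<longrightarrow> depth_ge n u x)"

lemma depth_ge_SucD: "depth_ge (Suc n) u x \<Longrightarrow> depth_ge n u x"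
proof (induction n arbitrary: x)
  case (Suc n)
  then show ?case
    by (auto simp del: depth_ge.simps simp: depth_ge.simps(2)[of "Suc n"] depth_ge.simps(2)[of n])
qed simp

lemma depth_ge_le: "m \<le> n \<Longrightarrow> depth_ge n u x \<Longrightarrow> depth_ge m u x"
  by (induction n) (auto simp del: depth_ge.simps simp: le_Suc_eq dest: depth_ge_SucD)

lemma depth_at_least_enat [simp]: "depth_at_least (enat n) u x \<longleftrightarrow> depth_ge n u x"
  by (auto simp: depth_at_least_def intro: depth_ge_le)

text \<open>As \<open>eSuc\<close> fixes infinity, this includes the fact that successors of a
  letter of infinite depth have infinite depth.\<close>

lemma depth_at_least_eSuc:
  "depth_at_least (eSuc l) u x \<longleftrightarrow> 2 \<le> count_list u x \<and> (\<forall>y\<in>set u. before u x y = 1 \<longrightarrow> depth_at_least l u y)"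
proof (cases l)
  case (enat n)
  then show ?thesis by (simp add: eSuc_enat)
next
  case infinity
  have "(\<forall>n. depth_ge n u x) \<longleftrightarrow> (\<forall>n. depth_ge (Suc n) u x)"
    by (metis depth_ge_SucD)
  with infinity show ?thesis by (auto simp: depth_at_least_def)
qed

text \<open>Depth depends only on what can be reached from the letter; \<open>W\<close> is closed
  under edges and the two words agree on it.\<close>

lemma depth_ge_cong:
  assumes "set u = set u'" "c \<in> W"
    and "\<And>c d. c \<in> W \<Longrightarrow> d \<in> set u \<Longrightarrow> before u c d = 1 \<Longrightarrow> d \<in> W"
    and "\<And>c d. c \<in> W \<Longrightarrow> d \<in> set u \<Longrightarrow> before u c d = before u' c d"
    and "\<And>c. c \<in> W \<Longrightarrow> min 2 (count_list u c) = min 2 (count_list u' c)"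
  shows "depth_ge n u c \<longleftrightarrow> depth_ge n u' c"
  using assms(2)
proof (induction n arbitrary: c)
  case (Suc n)
  have "2 \<le> count_list u c \<longleftrightarrow> 2 \<le> count_list u' c"
    using assms(5)[OF Suc.prems] by linarith
  then show ?case
    using Suc assms(1,3,4) by auto
qed simp

lemma depth_at_least_cong:
  assumes "set u = set u'" "c \<in> W"
    and "\<And>c d. c \<in> W \<Longrightarrow> d \<in> set u \<Longrightarrow> before u c d = 1 \<Longrightarrow> d \<in> W"
    and "\<And>c d. c \<in> W \<Longrightarrow> d \<in> set u \<Longrightarrow> before u c d = before u' c d"
    and "\<And>c. c \<in> W \<Longrightarrow> min 2 (count_list u c) = min 2 (count_list u' c)"
  shows "depth_at_least l u c \<longleftrightarrow> depth_at_least l u' c"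
  using depth_ge_cong[OF assms] by (simp add: depth_at_least_def)

lemma depth_at_least_same:
  "same u v \<Longrightarrow> depth_at_least l u x \<longleftrightarrow> depth_at_least l v x"
  by (rule depth_at_least_cong[where W = UNIV]) (auto simp: same_set same_count same_def)

lemma depth_ge_same:
  "same u v \<Longrightarrow> depth_ge l u x \<longleftrightarrow> depth_ge l v x"
  using depth_at_least_same[of u v "enat l"] by simp

text \<open>
  If \<open>b, c\<^sub>1, \<dots>, c\<^sub>n\<close> is a shortest path from \<open>b\<close> to a letter occurring once, then deleting all other
  letters leaves \<open>b\<close> followed
    by \<open>c\<^sub>1 b c\<^sub>2 c\<^sub>1 \<dots> c\<^sub>n c\<^bsub>n-1\<^esub>\<close>, that is \<open>tail [b] [[c\<^sub>1], \<dots>, [c\<^sub>n]]\<close>. In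
  \<open>chain\<close> a further open letter \<open>s\<close> is closed together with the last of the letters \<open>Cs\<close>.
\<close>

fun tail :: "'a list \<Rightarrow> 'a list list \<Rightarrow> 'a list" where
  "tail A [] = []"
| "tail A (B # Bs) = B @ A @ tail B Bs"

fun chain ::
  "'a list \<Rightarrow> 'a list \<Rightarrow> 'a list list \<Rightarrow> 'a list list \<Rightarrow> 'a list" where
  "chain S A [] Bs = tail (A @ S) Bs"
| "chain S A (C # Cs) Bs = C @ A @ chain S C Cs Bs"

lemma substitute_append [simp]:
  "substitute \<sigma> (u @ v) = substitute \<sigma> u @ substitute \<sigma> v"
  and substitute_Cons [simp]: "substitute \<sigma> (x # v) = \<sigma> x @ substitute \<sigma> v"
  and substitute_Nil [simp]: "substitute \<sigma> [] = []"
  by (simp_all add: substitute_def)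

lemma substitute_tail [simp]:
  "substitute \<sigma> (tail A Bs) = tail (substitute \<sigma> A) (map (substitute \<sigma>) Bs)"
  by (induction A Bs rule: tail.induct) auto

lemma substitute_chain [simp]:
  "substitute \<sigma> (chain S A Cs Bs) = chain (substitute \<sigma> S) (substitute \<sigma> A) (map (substitute \<sigma>) Cs) (map (substitute \<sigma>) Bs)"
  by (induction S A Cs Bs rule: chain.induct) auto

abbreviation letters :: "'a list \<Rightarrow> 'a list list" where
  "letters bs \<equiv> map (\<lambda>b. [b]) bs"

lemma ex_substitution:
  assumes "distinct ls" "length ls = length Ws"
  shows "\<exists>\<sigma> :: nat \<Rightarrow> 'b. map \<sigma> ls = Ws"
  using assms(2,1)
proof (induction ls Ws rule: list_induct2)
  case (Cons l ls W Ws)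
  then obtain \<sigma> where "map \<sigma> ls = Ws" by auto
  then show ?case
    using Cons.prems by (intro exI[of _ "\<sigma>(l := W)"]) auto
qed simp

text \<open>
  The witness \<open>w1\<close> is the shortest prefix of \<open>w\<close> after which all letters of \<open>A\<close> have occurred
  twice.
\<close>

lemma close:
  assumes "set A \<subseteq> set h"
    and "\<And>a. a \<in> set A \<Longrightarrow> 2 \<le> count_list h a \<or>
      2 \<le> count_list (h @ w) a \<and> (\<forall>y\<in>set (h @ w). before (h @ w) a y = 1 \<longrightarrow> P y)"
  obtains w1 w2 where "w = w1 @ w2"
    "\<And>a. a \<in> set A \<Longrightarrow> 2 \<le> count_list (h @ w1) a"
    "\<And>b. b \<in> set w1 \<Longrightarrow> 2 \<le> count_list (h @ w1) b \<or> P b"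
proof -
  define C where
    "C k \<longleftrightarrow> (\<forall>a\<in>set A. 2 \<le> count_list (h @ take k w) a)" for k
  have "C (length w)" using assms(2) by (fastforce simp: C_def)
  define k where "k = (LEAST k. C k)"
  have k: "C k" unfolding k_def by (rule LeastI) fact
  have min: "\<not> C i" if "i < k" for i using not_less_Least that unfolding k_def by blast
  show thesis
  proof (rule that)
    show "w = take k w @ drop k w" by simp
    show "2 \<le> count_list (h @ take k w) a" if "a \<in> set A" for a
      using k that by (simp add: C_def)
    fix b assume b: "b \<in> set (take k w)"
    show "2 \<le> count_list (h @ take k w) b \<or> P b"
    proof (cases "b \<in> set h")
      case True
      then have "count_list h b \<noteq> 0" "count_list (take k w) b \<noteq> 0"
        using b by (auto simp: count_list_0_iff)
      then show ?thesis by simp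
    next
      case False
      obtain p q where pq: "take k w = p @ b # q" "b \<notin> set p"
        using b by (meson split_list_first)
      have "w = p @ b # (q @ drop k w)"
        using pq by (metis append_take_drop_id append.assoc append_Cons)
      then obtain r where w: "w = p @ b # r" ..
      have "length p < k" using arg_cong[OF pq(1), of length] by simp
      moreover have "take (length p) w = p" by (simp add: w)
      \<comment> \<open>By minimality of \<open>k\<close>, some \<open>a\<close> is still open just
        before the first \<open>b\<close>, which makes \<open>b\<close> a successor of
        \<open>a\<close>.\<close>
      ultimately obtain a where a: "a \<in> set A" "count_list (h @ p) a < 2"
        using min[of "length p"] unfolding C_def by (auto simp: not_le)
      have "count_list h a \<noteq> 0" using a(1) assms(1) by (auto simp: count_list_0_iff)
      with a(2) have "count_list (h @ p) a = 1" "count_list h a < 2" by auto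
      moreover from this have "before (h @ w) a b = 1"
        using False pq(2) by (simp add: w before_append before_Cons)
      moreover have "b \<in> set (h @ w)" by (simp add: w)
      ultimately show ?thesis using assms(2)[OF a(1)] by auto
    qed
  qed
qed

text \<open>
  Conversely,
    if all letters of \<open>A\<close> have depth at least \<open>n\<close>, the rest of the word starts with a
  substitution instance of a tail of length \<open>n\<close>, because third occurrences can be inserted freely.
\<close>

lemma sim_tail:
  assumes "set A \<subseteq> set h"
    "\<And>a. a \<in> set A \<Longrightarrow> 2 \<le> count_list h a \<or> depth_ge n (h @ w) a"
  shows "\<exists>Bs w'. length Bs = n \<and> same (h @ w) (h @ tail A Bs @ w')"
  using assms
proof (induction n arbitrary: A h w)
  case 0
  then show ?case by (intro exI[of _ "[]"] exI[of _ w]) simp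
next
  case (Suc n)
  obtain w1 w2 where w: "w = w1 @ w2"
    "\<And>a. a \<in> set A \<Longrightarrow> 2 \<le> count_list (h @ w1) a"
    "\<And>b. b \<in> set w1 \<Longrightarrow> 2 \<le> count_list (h @ w1) b \<or> depth_ge n (h @ w) b"
    by (rule close[OF Suc.prems(1), of w "depth_ge n (h @ w)"]) (use Suc.prems(2) in auto)
  obtain Bs w' where "length Bs = n" "same ((h @ w1) @ w2) ((h @ w1) @ tail w1 Bs @ w')"
    using Suc.IH[of w1 "h @ w1" w2] w by auto
  moreover have "same ((h @ w1) @ A @ (tail w1 Bs @ w')) ((h @ w1) @ tail w1 Bs @ w')"
    by (rule same_insert) (rule w(2))
  ultimately have "same (h @ w) (h @ tail A (w1 # Bs) @ w')" "length (w1 # Bs) = Suc n"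
    using w(1) by (auto intro: same_trans same_sym)
  then show ?case by blast
qed

text \<open>Each block split off costs the letters of \<open>A\<close> one unit of depth. After
  \<open>j\<close> blocks the current block has depth at least \<open>m\<close>, like
  \<open>S\<close>, and \<open>sim_tail\<close> treats both together.\<close>

lemma sim_chain:
  assumes "set A \<subseteq> set h"
    "\<And>a. a \<in> set A \<Longrightarrow> 2 \<le> count_list h a \<or> depth_ge (j + m) (h @ w) a"
    and "set S \<subseteq> set h"
      "\<And>a. a \<in> set S \<Longrightarrow> 2 \<le> count_list h a \<or> depth_ge m (h @ w) a"
  shows "\<exists>Cs Bs w'. length Cs = j \<and> length Bs = m \<and> same (h @ w) (h @ chain S A Cs Bs @ w')"
  using assms
proof (induction j arbitrary: A h w)
  case 0
  have "\<exists>Bs w'. length Bs = m \<and> same (h @ w) (h @ tail (A @ S) Bs @ w')"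
    by (rule sim_tail) (use 0 in auto)
  then show ?case by (metis chain.simps(1) list.size(3))
next
  case (Suc j)
  obtain w1 w2 where w: "w = w1 @ w2"
    "\<And>a. a \<in> set A \<Longrightarrow> 2 \<le> count_list (h @ w1) a"
    "\<And>b. b \<in> set w1 \<Longrightarrow> 2 \<le> count_list (h @ w1) b \<or> depth_ge (j + m) (h @ w) b"
    by (rule close[OF Suc.prems(1), of w "depth_ge (j + m) (h @ w)"]) (use Suc.prems(2) in auto)
  have "\<exists>Cs Bs w'. length Cs = j \<and> length Bs = m \<and> same ((h @ w1) @ w2) ((h @ w1) @ chain S w1 Cs Bs @ w')"
  proof (rule Suc.IH)
    fix a assume "a \<in> set S"
    with Suc.prems(4)[of a] w(1) show
      "2 \<le> count_list (h @ w1) a \<or> depth_ge m ((h @ w1) @ w2) a" by auto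
  qed (use w Suc.prems(3) in auto)
  then obtain Cs Bs w' where "length Cs = j" "length Bs = m"
      "same ((h @ w1) @ w2) ((h @ w1) @ chain S w1 Cs Bs @ w')" by blast
  moreover have "same ((h @ w1) @ A @ (chain S w1 Cs Bs @ w')) ((h @ w1) @ chain S w1 Cs Bs @ w')"
    by (rule same_insert) (rule w(2))
  ultimately have "same (h @ w) (h @ chain S A (w1 # Cs) Bs @ w')" "length (w1 # Cs) = Suc j"
    "length Bs = m"
    using w(1) by (auto intro: same_trans same_sym)
  then show ?case by blast
qed

text \<open>With \<open>D\<close> closed under successors no depth is lost from block to block, so
  one prefix closes everything: a letter that first occurs in it does so while a letter of
  \<open>D\<close> is open, and therefore belongs to \<open>D\<close>.\<close>

lemma close_inf:
  assumes "\<And>a. D a \<Longrightarrow> 2 \<le> count_list (h @ w) a"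
    and "\<And>a y. D a \<Longrightarrow> y \<in> set (h @ w) \<Longrightarrow> before (h @ w) a y = 1 \<Longrightarrow> D y"
  obtains w1 w2 where "w = w1 @ w2"
    "\<And>a. a \<in> set (h @ w1) \<Longrightarrow> D a \<Longrightarrow> 2 \<le> count_list (h @ w1) a"
    "\<And>b. b \<in> set w1 \<Longrightarrow> 2 \<le> count_list (h @ w1) b"
proof -
  define C where
    "C k \<longleftrightarrow> (\<forall>a\<in>set (h @ take k w). D a \<longrightarrow> 2 \<le> count_list (h @ take k w) a)" for k
  have "C (length w)" using assms(1) by (simp add: C_def)
  define k where "k = (LEAST k. C k)"
  have k: "C k" unfolding k_def by (rule LeastI) fact
  have min: "\<not> C i" if "i < k" for i using not_less_Least that unfolding k_def by blast
  show thesis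
  proof (rule that)
    show "w = take k w @ drop k w" by simp
    show fin: "2 \<le> count_list (h @ take k w) a" if "a \<in> set (h @ take k w)" "D a" for a
      using k that by (simp add: C_def)
    fix b assume b: "b \<in> set (take k w)"
    show "2 \<le> count_list (h @ take k w) b"
    proof (cases "b \<in> set h")
      case True
      then have "count_list h b \<noteq> 0" "count_list (take k w) b \<noteq> 0"
        using b by (auto simp: count_list_0_iff)
      then show ?thesis by simp
    next
      case False
      obtain p q where pq: "take k w = p @ b # q" "b \<notin> set p"
        using b by (meson split_list_first)
      have "w = p @ b # (q @ drop k w)"
        using pq by (metis append_take_drop_id append.assoc append_Cons)
      then obtain r where w: "w = p @ b # r" ..
      have "length p < k" using arg_cong[OF pq(1), of length] by simp
      moreover have "take (length p) w = p" by (simp add: w)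
      ultimately obtain a where a: "a \<in> set (h @ p)" "D a" "count_list (h @ p) a < 2"
        using min[of "length p"] unfolding C_def by (auto simp: not_le)
      have "count_list (h @ p) a \<noteq> 0" using a(1) by (auto simp: count_list_0_iff)
      with a(3) have "count_list (h @ p) a = 1" by auto
      moreover from this have "before (h @ w) a b = 1"
        using False pq(2) by (simp add: w before_append before_Cons)
      moreover have "b \<in> set (h @ w)" by (simp add: w)
      ultimately have "D b" using assms(2) a(2) by blast
      then show ?thesis using fin b by simp
    qed
  qed
qed

section \<open>The laws that govern interchanges\<close>

text \<open>
  \<open>R_law T n\<close> moves the second occurrence of \<open>X\<close> over a block of letters of depth at least \<open>n\<close> that
  follows the first one; \<open>R_inf\<close> is the version for letters of infinite depth.
\<close>

definition R_law where
  "R_law T n \<longleftrightarrow> (\<forall>X A Bs. length Bs = n \<longrightarrow> T (X @ X @ A @ tail A Bs) (X @ A @ X @ tail A Bs))"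

definition R_inf where
  "R_inf T \<longleftrightarrow> (\<forall>X A. T (X @ X @ A @ A) (X @ A @ X @ A))"

definition R_any where
  "R_any T l \<longleftrightarrow> (case l of enat n \<Rightarrow> R_law T n | \<infinity> \<Rightarrow> R_inf T)"

lemma same_perm:
  "mset B = mset B' \<Longrightarrow> set B \<subseteq> set h \<Longrightarrow> same (h @ B @ w) (h @ B' @ w)"
proof -
  assume a: "mset B = mset B'" "set B \<subseteq> set h"
  have "set B = set B'" using a(1) by (metis set_mset_mset)
  moreover have "count_list B x = count_list B' x" for x using a(1) by (metis count_mset)
  ultimately show ?thesis using a(2) by (auto simp: same_def before_append)
qed

section \<open>Moving a second occurrence across deep letters\<close>

context P_theory
begin

lemma same_eq_trans: "same u v \<Longrightarrow> v \<approx> w \<Longrightarrow> u \<approx> w"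
  and eq_same_trans: "u \<approx> v \<Longrightarrow> same v w \<Longrightarrow> u \<approx> w"
  using same_imp_eq trans by blast+

text \<open>By \<open>sim_tail\<close> the rest \<open>w\<close> may be replaced by one that begins
  with \<open>tail A Bs\<close>; the law applies, and \<open>same_append\<close> restores
  \<open>w\<close> behind the new prefix.\<close>

lemma clear_fin:
  assumes "R_law (\<approx>) n"
    and "\<And>a. a \<in> set A \<Longrightarrow> 2 \<le> count_list (g @ x # A) a \<or> depth_ge n (g @ x # A @ x # w) a"
  shows "g @ x # A @ x # w \<approx> g @ x # x # A @ w"
proof -
  define h where "h = g @ x # A @ [x]"
  have hw: "h @ w = g @ x # A @ x # w" by (simp add: h_def)
  have "\<exists>Bs w'. length Bs = n \<and> same (h @ w) (h @ tail A Bs @ w')"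
  proof (rule sim_tail)
    fix a assume "a \<in> set A"
    with assms(2)[OF this] show "2 \<le> count_list h a \<or> depth_ge n (h @ w) a"
      unfolding hw by (auto simp: h_def)
  qed (auto simp: h_def)
  then obtain Bs w' where B: "length Bs = n" "same (h @ w) (h @ tail A Bs @ w')" by blast
  have 1: "[x] @ [x] @ A @ tail A Bs \<approx> [x] @ A @ [x] @ tail A Bs"
    using assms(1) B(1) unfolding R_law_def by blast
  have 2: "same ((g @ x # x # A) @ w) ((g @ x # x # A) @ tail A Bs @ w')"
    by (rule same_append[OF B(2)]) (simp add: h_def)
  have "h @ tail A Bs @ w' \<approx> (g @ x # x # A) @ tail A Bs @ w'"
    using sym[OF ctx[OF 1, of g w']] by (simp add: h_def)
  then have "h @ w \<approx> (g @ x # x # A) @ w"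
    using B(2) 2 same_eq_trans eq_same_trans same_sym by blast
  then show ?thesis by (simp add: h_def)
qed

text \<open>
  \<open>AV\<close> may be repeated because all its letters are closed, so \<open>R_inf\<close> applies to \<open>A V A V\<close>.
\<close>

lemma clear_closed:
  assumes "R_inf (\<approx>)"
    "\<And>a. a \<in> set A \<union> set V \<Longrightarrow> 2 \<le> count_list (g @ A @ V) a"
  shows "g @ A @ V @ w \<approx> g @ A @ A @ V @ w"
proof -
  have 1: "same ((g @ A @ V) @ (A @ V) @ w) ((g @ A @ V) @ w)"
    by (rule same_insert) (use assms(2) in auto)
  have 2: "same ((g @ A @ A @ V) @ V @ w) ((g @ A @ A @ V) @ w)"
  proof (rule same_insert)
    fix a assume "a \<in> set V"
    with assms(2)[of a] show "2 \<le> count_list (g @ A @ A @ V) a" by simp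
  qed
  have 3: "A @ A @ V @ V \<approx> A @ V @ A @ V"
    using assms(1) unfolding R_inf_def by blast
  have "g @ A @ V @ w \<approx> g @ (A @ V @ A @ V) @ w"
    using 1 by (simp add: same_imp_eq same_sym)
  moreover have "\<dots> \<approx> g @ (A @ A @ V @ V) @ w"
    using ctx[OF 3] sym by blast
  moreover have "\<dots> \<approx> g @ A @ A @ V @ w"
    using 2 by (simp add: same_imp_eq)
  ultimately show ?thesis using trans by blast
qed

text \<open>\<open>R_inf\<close> needs two copies of \<open>A\<close>. A prefix \<open>W\<close> of
  \<open>w\<close> closes all letters concerned, so \<open>clear_closed\<close> can duplicate
  \<open>A\<close>; the new copy consists of repeated letters and may pass \<open>x\<close>; after
  \<open>R_inf\<close> the copy is removed again.\<close>

lemma clear_inf: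
  assumes "R_inf (\<approx>)"
    and "\<And>a. a \<in> set A \<Longrightarrow> 2 \<le> count_list (g @ x # A) a \<or> depth_at_least \<infinity> (g @ x # A @ x # w) a"
  shows "g @ x # A @ x # w \<approx> g @ x # x # A @ w"
proof -
  define h where "h = g @ x # A @ [x]"
  define D where "D = depth_at_least \<infinity> (h @ w)"
  have hw: "h @ w = g @ x # A @ x # w" by (simp add: h_def)
  have D: "D a \<longleftrightarrow> 2 \<le> count_list (h @ w) a \<and> (\<forall>y\<in>set (h @ w). before (h @ w) a y = 1 \<longrightarrow> D y)" for a
    unfolding D_def using depth_at_least_eSuc[of \<infinity> "h @ w" a] by simp
  obtain W w2 where W: "w = W @ w2"
    "\<And>a. a \<in> set (h @ W) \<Longrightarrow> D a \<Longrightarrow> 2 \<le> count_list (h @ W) a"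
    "\<And>b. b \<in> set W \<Longrightarrow> 2 \<le> count_list (h @ W) b"
    by (rule close_inf[of D h w]) (use D[THEN iffD1] in blast)+
  have A: "2 \<le> count_list (h @ W) a" if "a \<in> set A" for a
    using assms(2)[OF that] W(2)[of a] that unfolding D_def hw[symmetric]
    by (auto simp: h_def)
  have x: "2 \<le> count_list (h @ W) x" by (simp add: h_def)
  have 1: "(g @ [x]) @ A @ (x # W) @ w2 \<approx> (g @ [x]) @ A @ A @ (x # W) @ w2"
  proof (rule clear_closed[OF assms(1)])
    fix a assume "a \<in> set A \<union> set (x # W)"
    then have "2 \<le> count_list (h @ W) a" using A x W(3) by auto
    then show "2 \<le> count_list ((g @ [x]) @ A @ (x # W)) a" by (simp add: h_def split: if_splits)
  qed
  have 2: "same ((g @ x # A) @ (A @ [x]) @ W @ w2) ((g @ x # A) @ (x # A) @ W @ w2)"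
    by (rule same_perm) auto
  have 3: "[x] @ [x] @ A @ A \<approx> [x] @ A @ [x] @ A" using assms(1) unfolding R_inf_def
    by blast
  have 4: "(g @ [x, x]) @ A @ W @ w2 \<approx> (g @ [x, x]) @ A @ A @ W @ w2"
  proof (rule clear_closed[OF assms(1)])
    fix a assume "a \<in> set A \<union> set W"
    then have "2 \<le> count_list (h @ W) a" using A W(3) by auto
    then show "2 \<le> count_list ((g @ [x, x]) @ A @ W) a" by (simp add: h_def split: if_splits)
  qed
  have "g @ x # A @ x # w \<approx> g @ x # A @ A @ x # W @ w2" using 1 W(1) by simp
  moreover have "\<dots> \<approx> g @ x # A @ x # A @ W @ w2" using 2 by (simp add: same_imp_eq)
  moreover have "\<dots> \<approx> g @ x # x # A @ A @ W @ w2"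
    using sym[OF ctx[OF 3, of g "W @ w2"]] by simp
  moreover have "\<dots> \<approx> g @ x # x # A @ w" using sym[OF 4] W(1) by simp
  ultimately show ?thesis using trans by blast
qed

lemma clear:
  assumes "R_any (\<approx>) l"
    and "\<And>a. a \<in> set A \<Longrightarrow> 2 \<le> count_list (g @ x # A) a \<or> depth_at_least l (g @ x # A @ x # w) a"
  shows "g @ x # A @ x # w \<approx> g @ x # x # A @ w"
  using assms clear_fin[of _ A g x w] clear_inf[of A g x w]
  by (cases l) (auto simp: R_any_def)

text \<open>A letter between the first two occurrences of \<open>x\<close> either has occurred in
  \<open>g\<close>, and is closed, or is a successor of \<open>x\<close>, of depth at least
  \<open>l\<close>; so \<open>clear\<close> applies. The \<open>x\<close> that left its place is put
  back as a third occurrence.\<close>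

lemma double:
  assumes "R_any (\<approx>) l" "depth_at_least (eSuc l) (g @ x # w) x" "x \<notin> set g"
  shows "g @ x # w \<approx> g @ x # x # w"
proof -
  have "2 \<le> count_list (g @ x # w) x" using assms(2) depth_at_least_eSuc by blast
  then have "count_list w x \<noteq> 0" using assms(3) by (auto simp: count_notin)
  then have "x \<in> set w" by (simp add: count_list_0_iff)
  then obtain A w' where w: "w = A @ x # w'" "x \<notin> set A" by (meson split_list_first)
  have "g @ x # A @ x # w' \<approx> g @ x # x # A @ w'"
  proof (rule clear[OF assms(1)])
    fix a assume a: "a \<in> set A"
    show "2 \<le> count_list (g @ x # A) a \<or> depth_at_least l (g @ x # A @ x # w') a"
    proof (cases "a \<in> set g")
      case True
      then have "count_list g a \<noteq> 0" "count_list A a \<noteq> 0" using a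
        by (simp_all add: count_list_0_iff)
      then show ?thesis by auto
    next
      case False
      obtain p q where "A = p @ a # q" "a \<notin> set p" using a by (meson split_list_first)
      then have "before (g @ x # A @ x # w') x a = 1" using False w(2) assms(3)
        by (auto simp: before_append before_Cons count_notin)
      then show ?thesis using assms(2) a unfolding w(1) depth_at_least_eSuc by auto
    qed
  qed
  moreover have "same ((g @ x # x # A) @ x # w') ((g @ x # x # A) @ w')"
    by (rule same_insert_one) simp
  ultimately show ?thesis using w(1) eq_same_trans same_sym by fastforce
qed

end

text \<open>
  \<open>K_law\<close>
    and \<open>L_law\<close> interchange a second occurrence of \<open>X\<close> with a first occurrence of \<open>Z\<close> when the
  interval of \<open>X\<close> contains \<open>S\<close>, of depth \<open>m\<close>; here \<open>Z\<close> has infinite depth in \<open>K_law\<close> and depth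
  \<open>j + m\<close> in \<open>L_law\<close>. The laws \<open>M_law\<close>, \<open>M_inf\<close>
    and \<open>N_law\<close> interchange first occurrences.
\<close>

definition K_law where
  "K_law T m \<longleftrightarrow> (\<forall>X S Z Bs. length Bs = m \<longrightarrow>
     T (X @ S @ X @ Z @ Z @ tail S Bs) (X @ S @ Z @ X @ Z @ tail S Bs))"

definition L_law where
  "L_law T m j \<longleftrightarrow> (\<forall>X S Z Cs Bs. length Cs = j \<longrightarrow> length Bs = m \<longrightarrow>
     T (X @ S @ X @ Z @ chain S Z Cs Bs) (X @ S @ Z @ X @ chain S Z Cs Bs))"

definition M_law where
  "M_law T l \<longleftrightarrow> (\<forall>X Y Bs. length Bs = l \<longrightarrow> T (X @ X @ Y @ tail Y Bs) (Y @ X @ X @ tail Y Bs))"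

definition M_inf where
  "M_inf T \<longleftrightarrow> (\<forall>X Y. T (X @ X @ Y @ Y) (Y @ Y @ X @ X))"

definition N_law where
  "N_law T n \<longleftrightarrow> (\<forall>X Y S Bs. length Bs = n \<longrightarrow>
     T (X @ Y @ S @ X @ Y @ tail S Bs) (Y @ X @ S @ X @ Y @ tail S Bs))"

definition commutative_law where
  "commutative_law T \<longleftrightarrow> (\<forall>X Y. T (X @ Y) (Y @ X))"

section \<open>Laws from their instances on distinct letters\<close>

context equational_theory
begin

text \<open>The instance on distinct letters yields all others by substitution. It is a single
  identity, which can be put into a finite basis.\<close>

lemma R_lawI:
  assumes "distinct (x # z # bs)"
    "[x,x,z] @ tail [z] (letters bs) \<approx> [x,z,x] @ tail [z] (letters bs)"
  shows "R_law (\<approx>) (length bs)"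
  unfolding R_law_def
proof (intro allI impI)
  fix X A :: "nat list" and Bs :: "nat list list" assume "length Bs = length bs"
  then obtain \<sigma> where "map \<sigma> (x # z # bs) = X # A # Bs"
    using ex_substitution[OF assms(1), of "X # A # Bs"] by auto
  then show "X @ X @ A @ tail A Bs \<approx> X @ A @ X @ tail A Bs"
    using subst[OF assms(2), of \<sigma>] by (auto simp: comp_def)
qed

lemma R_infI:
  assumes "x \<noteq> z" "[x,x,z,z] \<approx> [x,z,x,z]"
  shows "R_inf (\<approx>)"
  unfolding R_inf_def
proof (intro allI)
  fix X A
  show "X @ X @ A @ A \<approx> X @ A @ X @ A"
    using subst[OF assms(2), of "\<lambda>y. if y = x then X else A"] assms(1) by auto
qed

lemma K_lawI:
  assumes "distinct (x # s # z # bs)"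
    "[x,s,x,z,z] @ tail [s] (letters bs) \<approx> [x,s,z,x,z] @ tail [s] (letters bs)"
  shows "K_law (\<approx>) (length bs)"
  unfolding K_law_def
proof (intro allI impI)
  fix X S Z :: "nat list" and Bs :: "nat list list" assume "length Bs = length bs"
  then obtain \<sigma> where "map \<sigma> (x # s # z # bs) = X # S # Z # Bs"
    using ex_substitution[OF assms(1), of "X # S # Z # Bs"] by auto
  then show "X @ S @ X @ Z @ Z @ tail S Bs \<approx> X @ S @ Z @ X @ Z @ tail S Bs"
    using subst[OF assms(2), of \<sigma>] by (auto simp: comp_def)
qed

lemma L_lawI:
  assumes "distinct (x # s # z # cs @ bs)"
    "[x,s,x,z] @ chain [s] [z] (letters cs) (letters bs) \<approx> [x,s,z,x] @ chain [s] [z] (letters cs) (letters bs)"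
  shows "L_law (\<approx>) (length bs) (length cs)"
  unfolding L_law_def
proof (intro allI impI)
  fix X S Z :: "nat list" and Cs Bs :: "nat list list" assume l: "length Cs = length cs"
    "length Bs = length bs"
  then obtain \<sigma> where "map \<sigma> (x # s # z # cs @ bs) = X # S # Z # Cs @ Bs"
    using ex_substitution[OF assms(1), of "X # S # Z # Cs @ Bs"] by auto
  with l show "X @ S @ X @ Z @ chain S Z Cs Bs \<approx> X @ S @ Z @ X @ chain S Z Cs Bs"
    using subst[OF assms(2), of \<sigma>] by (auto simp: comp_def)
qed

lemma M_lawI:
  assumes "distinct (x # y # bs)"
    "[x,x,y] @ tail [y] (letters bs) \<approx> [y,x,x] @ tail [y] (letters bs)"
  shows "M_law (\<approx>) (length bs)"
  unfolding M_law_def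
proof (intro allI impI)
  fix X Y :: "nat list" and Bs :: "nat list list" assume "length Bs = length bs"
  then obtain \<sigma> where "map \<sigma> (x # y # bs) = X # Y # Bs"
    using ex_substitution[OF assms(1), of "X # Y # Bs"] by auto
  then show "X @ X @ Y @ tail Y Bs \<approx> Y @ X @ X @ tail Y Bs"
    using subst[OF assms(2), of \<sigma>] by (auto simp: comp_def)
qed

lemma M_infI:
  assumes "x \<noteq> z" "[x,x,z,z] \<approx> [z,z,x,x]"
  shows "M_inf (\<approx>)"
  unfolding M_inf_def
proof (intro allI)
  fix X A
  show "X @ X @ A @ A \<approx> A @ A @ X @ X"
    using subst[OF assms(2), of "\<lambda>y. if y = x then X else A"] assms(1) by auto
qed

lemma N_lawI:
  assumes "distinct (x # y # s # bs)"
    "[x,y,s,x,y] @ tail [s] (letters bs) \<approx> [y,x,s,x,y] @ tail [s] (letters bs)"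
  shows "N_law (\<approx>) (length bs)"
  unfolding N_law_def
proof (intro allI impI)
  fix X Y S :: "nat list" and Bs :: "nat list list" assume "length Bs = length bs"
  then obtain \<sigma> where "map \<sigma> (x # y # s # bs) = X # Y # S # Bs"
    using ex_substitution[OF assms(1), of "X # Y # S # Bs"] by auto
  then show "X @ Y @ S @ X @ Y @ tail S Bs \<approx> Y @ X @ S @ X @ Y @ tail S Bs"
    using subst[OF assms(2), of \<sigma>] by (auto simp: comp_def)
qed

lemma commutative_lawI:
  assumes "x \<noteq> z" "[x,z] \<approx> [z,x]"
  shows "commutative_law (\<approx>)"
  unfolding commutative_law_def
proof (intro allI)
  fix X A
  show "X @ A \<approx> A @ X"
    using subst[OF assms(2), of "\<lambda>y. if y = x then X else A"] assms(1) by auto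
qed

end

section \<open>How an interchange affects depth\<close>

lemma before_prefix_zero:
  "d \<in> set g \<Longrightarrow> c \<notin> set g \<Longrightarrow> before (g @ w) c d = 0"
  using before_le_count[of g c d] by (simp add: before_append count_notin)

text \<open>The swap affects only whether \<open>x\<close> is closed before \<open>z\<close>. Edges
  lead to later letters, so no path from a letter outside \<open>g\<close> meets
  \<open>x\<close>.\<close>

lemma depth_at_least_cross:
  assumes "x \<in> set g" "c \<notin> set g"
  shows "depth_at_least l (g @ q @ x # z # w) c \<longleftrightarrow> depth_at_least l (g @ q @ z # x # w) c"
proof (rule depth_at_least_cong[where W = "- set g"])
  fix c d assume c: "c \<in> - set g"
  then have "c \<noteq> x" using assms(1) by auto
  then show "before (g @ q @ x # z # w) c d = before (g @ q @ z # x # w) c d"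
    using assms(1) by (auto simp: before_append before_Cons)
  show "d \<in> - set g" if "before (g @ q @ x # z # w) c d = 1"
    using that c before_prefix_zero[of d g c] by auto
qed (use assms(2) in auto)

text \<open>Doubling \<open>z\<close> deletes the edges that leave \<open>z\<close> and changes no
  other, so depths can only grow.\<close>

lemma depth_ge_double:
  assumes "z \<notin> set g"
  shows "depth_ge m (g @ z # w) c \<Longrightarrow> depth_ge m (g @ z # z # w) c"
proof (induction m arbitrary: c)
  case (Suc m)
  have e: "before (g @ z # z # w) c d = (if c = z \<and> d \<notin> set g \<and> d \<noteq> z then 2 else before (g @ z # w) c d)" for d
    using assms by (auto simp: before_append before_Cons count_notin)
  then show ?case using Suc by (auto split: if_splits)
qed simp

lemma depth_at_least_double:
  "z \<notin> set g \<Longrightarrow> depth_at_least m (g @ z # w) c \<Longrightarrow> depth_at_least m (g @ z # z # w) c"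
  using depth_ge_double by (simp add: depth_at_least_def)

text \<open>The interchange replaces the edge from \<open>x\<close> to \<open>y\<close> by one from
  \<open>y\<close> to \<open>x\<close> and keeps all others. The new edge does no harm to
  \<open>y\<close> up to one more than the depth of \<open>x\<close>.\<close>

lemma
  assumes "x \<notin> set g" "y \<notin> set g" "x \<noteq> y"
  shows depth_at_least_exchange1:
    "depth_at_least k (g @ x # y # w) x \<Longrightarrow> depth_at_least k (g @ y # x # w) x"
    and depth_at_least_exchange2:
      "depth_at_least k (g @ x # y # w) y \<Longrightarrow> depth_at_least k (g @ x # y # w) x \<Longrightarrow> depth_at_least k (g @ y # x # w) y"
    and depth_at_least_exchange3:
      "depth_at_least (eSuc k) (g @ x # y # w) y \<Longrightarrow> depth_at_least k (g @ x # y # w) x \<Longrightarrow>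
       depth_at_least (eSuc k) (g @ y # x # w) y"
proof -
  let ?U = "g @ x # y # w" and ?V = "g @ y # x # w"
  have W: "depth_ge n ?U c \<longleftrightarrow> depth_ge n ?V c"
    if "c \<notin> set (g @ [x, y])" for c n
  proof (rule depth_ge_cong[where W = "- set (g @ [x, y])"])
    fix c d assume c: "c \<in> - set (g @ [x, y])"
    then show "before ?U c d = before ?V c d"
      by (auto simp: before_append before_Cons)
    show "d \<in> - set (g @ [x, y])" if "before ?U c d = 1"
      using that c before_prefix_zero[of d "g @ [x, y]" c w] by auto
  qed (use that in auto)
  have cnt: "count_list ?U c = count_list ?V c" for c by simp
  have notin: "d \<notin> set g" if "before ?V c d = 1" "c = x \<or> c = y" for c d
    using that before_prefix_zero[of d g c] assms by fastforce
  have 1: "depth_ge n ?V x" if "depth_ge n ?U x" for n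
  proof (cases n)
    case (Suc m)
    have "depth_ge m ?V d" if "d \<in> set ?V" "before ?V x d = 1" for d
    proof -
      have "d \<noteq> y" "d \<noteq> x" using that(2) assms
        by (auto simp: before_append before_Cons count_notin)
      moreover from this have "before ?U x d = 1" using that(2) assms
        by (auto simp: before_append before_Cons count_notin split: if_splits)
      ultimately show ?thesis
        using \<open>depth_ge n ?U x\<close> W[of d m] notin[OF that(2)] that(1) Suc by auto
    qed
    then show ?thesis using that cnt[of x] Suc by simp
  qed simp
  have 2: "depth_ge (Suc n) ?V y" if "depth_ge (Suc n) ?U y" "depth_ge n ?U x" for n
  proof -
    have "depth_ge n ?V d" if d: "d \<in> set ?V" "before ?V y d = 1" for d
    proof (cases "d = x")
      case True then show ?thesis using 1 \<open>depth_ge n ?U x\<close> by simp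
    next
      case False
      have "d \<noteq> y" using d(2) by auto
      moreover from this False have "before ?U y d = 1"
        using d(2) assms by (auto simp: before_append before_Cons count_notin split: if_splits)
      ultimately show ?thesis
        using \<open>depth_ge (Suc n) ?U y\<close> W[of d n] notin[OF d(2)] d(1) False by auto
    qed
    then show ?thesis using that(1) cnt[of y] by simp
  qed
  show "depth_at_least k ?U x \<Longrightarrow> depth_at_least k ?V x" using 1
    by (simp add: depth_at_least_def)
  show "depth_at_least k ?U y \<Longrightarrow> depth_at_least k ?U x \<Longrightarrow> depth_at_least k ?V y"
    unfolding depth_at_least_def
  proof (intro allI impI)
    fix n assume a: "\<forall>n. enat n \<le> k \<longrightarrow> depth_ge n ?U y"
      "\<forall>n. enat n \<le> k \<longrightarrow> depth_ge n ?U x" "enat n \<le> k"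
    show "depth_ge n ?V y"
    proof (cases n)
      case (Suc m)
      then have "depth_ge n ?U y" "depth_ge m ?U x" using a depth_ge_SucD by blast+
      then show ?thesis using 2 Suc by blast
    qed simp
  qed
  show "depth_at_least (eSuc k) ?U y \<Longrightarrow> depth_at_least k ?U x \<Longrightarrow> depth_at_least (eSuc k) ?V y"
    unfolding depth_at_least_def
  proof (intro allI impI)
    fix n assume a: "\<forall>n. enat n \<le> eSuc k \<longrightarrow> depth_ge n ?U y"
      "\<forall>n. enat n \<le> k \<longrightarrow> depth_ge n ?U x" "enat n \<le> eSuc k"
    show "depth_ge n ?V y"
    proof (cases n)
      case (Suc m)
      then have "enat m \<le> k" using a(3) by (metis eSuc_enat eSuc_ile_mono)
      then have "depth_ge n ?U y" "depth_ge m ?U x" using a by blast+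
      then show ?thesis using 2 Suc by blast
    qed simp
  qed
qed

section \<open>Carrying out interchanges by the laws\<close>

context P_theory
begin

text \<open>Both words reduce to the one in which the second \<open>x\<close> stands next to the
  first.\<close>

lemma cross_free:
  assumes "R_any (\<approx>) l"
    and "\<And>a. a \<in> set q \<Longrightarrow> 2 \<le> count_list (g @ x # q) a \<or> depth_at_least l (g @ x # q @ x # z # w) a"
    and "depth_at_least l (g @ x # q @ x # z # w) z" "z \<notin> set (g @ [x])"
  shows "g @ x # q @ x # z # w \<approx> g @ x # q @ z # x # w"
proof -
  have 1: "g @ x # q @ x # (z # w) \<approx> g @ x # x # q @ z # w"
    by (rule clear[OF assms(1,2)])
  have "g @ x # (q @ [z]) @ x # w \<approx> g @ x # x # (q @ [z]) @ w"
  proof (rule clear[OF assms(1)])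
    fix a assume a: "a \<in> set (q @ [z])"
    show "2 \<le> count_list (g @ x # q @ [z]) a \<or> depth_at_least l (g @ x # (q @ [z]) @ x # w) a"
    proof (cases "2 \<le> count_list (g @ x # q) a")
      case False
      then have d: "depth_at_least l (g @ x # q @ x # z # w) a" using a assms(2,3) by auto
      have "a \<notin> set (g @ [x])"
      proof (cases "a = z")
        case False
        then have "a \<in> set q" using a by auto
        then have "count_list q a \<noteq> 0" by (simp add: count_list_0_iff)
        then have "count_list (g @ [x]) a = 0" using \<open>\<not> 2 \<le> _\<close>
          by (auto split: if_splits)
        then show ?thesis unfolding count_list_0_iff .
      qed (use assms(4) in simp)
      then show ?thesis using depth_at_least_cross[of x "g @ [x]" a l q z w] d by simp
    qed auto
  qed
  then have 2: "g @ x # q @ z # x # w \<approx> g @ x # x # q @ z # w" by simp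
  show ?thesis by (rule trans[OF 1 sym[OF 2]])
qed

text \<open>\<open>K_law\<close> asks for a doubled \<open>Z\<close>; the depth of \<open>z\<close>
  allows it to be doubled before the interchange and the doubling to be undone afterwards.\<close>

lemma cross_K:
  assumes "R_any (\<approx>) l" "K_law (\<approx>) m"
    and "\<And>a. a \<in> set q \<Longrightarrow> 2 \<le> count_list (g @ x # q) a \<or> depth_ge m (g @ x # q @ x # z # w) a"
    and "depth_at_least (eSuc l) (g @ x # q @ x # z # w) z" "z \<notin> set (g @ x # q)"
  shows "g @ x # q @ x # z # w \<approx> g @ x # q @ z # x # w"
proof -
  define h where "h = g @ x # q @ [x, z, z]"
  have 1: "g @ x # q @ x # z # w \<approx> h @ w"
    using double[OF assms(1), of "g @ x # q @ [x]" z w] assms(4,5) by (simp add: h_def)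
  have "\<exists>Bs w'. length Bs = m \<and> same (h @ w) (h @ tail q Bs @ w')"
  proof (rule sim_tail)
    fix a assume "a \<in> set q"
    with assms(3)[OF this] show "2 \<le> count_list h a \<or> depth_ge m (h @ w) a"
      using depth_ge_double[of z "g @ x # q @ [x]" m w a] assms(5) by (auto simp: h_def)
  qed (auto simp: h_def)
  then obtain Bs w' where B: "length Bs = m" "same (h @ w) (h @ tail q Bs @ w')" by blast
  define h' where "h' = g @ x # q @ [z, x, z]"
  have "[x] @ q @ [x] @ [z] @ [z] @ tail q Bs \<approx> [x] @ q @ [z] @ [x] @ [z] @ tail q Bs"
    using assms(2) B(1) unfolding K_law_def by blast
  from ctx[OF this, of g w'] have 2: "h @ tail q Bs @ w' \<approx> h' @ tail q Bs @ w'"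
    by (simp add: h_def h'_def)
  have 3: "same (h' @ w) (h' @ tail q Bs @ w')"
    by (rule same_append[OF B(2)]) (simp add: h_def h'_def)
  have 4: "h' @ w \<approx> (g @ x # q) @ z # z # x # w"
    using swap_seconds[of x "g @ x # q @ [z]" z w] by (simp add: h'_def)
  have 5: "(g @ x # q) @ z # (x # w) \<approx> (g @ x # q) @ z # z # (x # w)"
    by (rule double[OF assms(1)]) (use assms(4,5) depth_at_least_cross[of x "g @ [x]" z
      "eSuc l" q z w] in auto)
  have "h @ w \<approx> h' @ w" using 2 3 B(2) same_eq_trans eq_same_trans same_sym by blast
  from trans[OF 1 trans[OF this trans[OF 4 sym[OF 5]]]] show ?thesis by simp
qed

text \<open>Here \<open>z\<close> may be too shallow to be doubled. The chain keeps \<open>q\<close>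
  open until the blocks that start with \<open>z\<close> have come down to depth
  \<open>m\<close>.\<close>

lemma cross_L:
  assumes "L_law (\<approx>) m j"
    and "\<And>a. a \<in> set q \<Longrightarrow> 2 \<le> count_list (g @ x # q) a \<or> depth_ge m (g @ x # q @ x # z # w) a"
    and "depth_ge (j + m) (g @ x # q @ x # z # w) z"
  shows "g @ x # q @ x # z # w \<approx> g @ x # q @ z # x # w"
proof -
  define h where "h = g @ x # q @ [x, z]"
  have "\<exists>Cs Bs w'. length Cs = j \<and> length Bs = m \<and> same (h @ w) (h @ chain q [z] Cs Bs @ w')"
  proof (rule sim_chain)
    fix a assume "a \<in> set q"
    with assms(2)[OF this] show "2 \<le> count_list h a \<or> depth_ge m (h @ w) a"
      by (auto simp: h_def)
  qed (use assms(3) in \<open>auto simp: h_def\<close>)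
  then obtain Cs Bs w' where B: "length Cs = j" "length Bs = m"
      "same (h @ w) (h @ chain q [z] Cs Bs @ w')" by blast
  define h' where "h' = g @ x # q @ [z, x]"
  have "[x] @ q @ [x] @ [z] @ chain q [z] Cs Bs \<approx> [x] @ q @ [z] @ [x] @ chain q [z] Cs Bs"
    using assms(1) B(1,2) unfolding L_law_def by blast
  from ctx[OF this, of g w'] have 2:
    "h @ chain q [z] Cs Bs @ w' \<approx> h' @ chain q [z] Cs Bs @ w'"
    by (simp add: h_def h'_def)
  have 3: "same (h' @ w) (h' @ chain q [z] Cs Bs @ w')"
    by (rule same_append[OF B(3)]) (simp add: h_def h'_def)
  have "h @ w \<approx> h' @ w" using 2 3 B(3) same_eq_trans eq_same_trans same_sym by blast
  then show ?thesis by (simp add: h_def h'_def)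
qed

lemma exchange_inf:
  assumes "R_any (\<approx>) l" "M_inf (\<approx>)" "x \<notin> set g" "y \<notin> set g"
    "x \<noteq> y"
    and "depth_at_least (eSuc l) (g @ x # y # w) x" "depth_at_least (eSuc l) (g @ x # y # w) y"
  shows "g @ x # y # w \<approx> g @ y # x # w"
proof -
  have 1: "g @ x # (y # w) \<approx> g @ x # x # y # w"
    by (rule double[OF assms(1,6,3)])
  have 2: "(g @ [x, x]) @ y # w \<approx> (g @ [x, x]) @ y # y # w"
    by (rule double[OF assms(1)]) (use assms depth_at_least_double[OF assms(3), of "eSuc l"
      "y # w" y] in auto)
  have "[x] @ [x] @ [y] @ [y] \<approx> [y] @ [y] @ [x] @ [x]" using assms(2) unfolding M_inf_def
    by blast
  from ctx[OF this, of g w] have 3: "g @ x # x # y # y # w \<approx> g @ y # y # x # x # w" by simp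
  have x: "depth_at_least (eSuc l) (g @ y # x # w) x"
    by (rule depth_at_least_exchange1[OF assms(3-6)])
  have y: "depth_at_least (eSuc l) (g @ y # x # w) y"
    by (rule depth_at_least_exchange2[OF assms(3-5) assms(7,6)])
  have 4: "g @ y # (x # w) \<approx> g @ y # y # x # w"
    by (rule double[OF assms(1) y assms(4)])
  have 5: "(g @ [y, y]) @ x # w \<approx> (g @ [y, y]) @ x # x # w"
    by (rule double[OF assms(1)]) (use assms x depth_at_least_double[OF assms(4), of "eSuc l"
      "x # w" x] in auto)
  have 6: "g @ y # y # x # x # w \<approx> g @ y # y # x # w" using sym[OF 5] by simp
  have 7: "g @ x # x # y # w \<approx> g @ x # x # y # y # w" using 2 by simp
  from trans[OF 1 trans[OF 7 trans[OF 3 trans[OF 6 sym[OF 4]]]]] show ?thesis .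
qed

text \<open>Only \<open>x\<close> is known to be deep enough for doubling; \<open>y\<close> supplies
  the tail of length \<open>l\<close>.\<close>

lemma exchange_M:
  assumes "R_any (\<approx>) (enat l)" "M_law (\<approx>) l" "x \<notin> set g" "y \<notin> set g"
    "x \<noteq> y"
    and "depth_at_least (eSuc (enat l)) (g @ x # y # w) x" "depth_ge l (g @ x # y # w) y"
  shows "g @ x # y # w \<approx> g @ y # x # w"
proof -
  define h where "h = g @ [x, x, y]"
  have 1: "g @ x # (y # w) \<approx> h @ w"
    using double[OF assms(1,6,3)] by (simp add: h_def)
  have "\<exists>Bs w'. length Bs = l \<and> same (h @ w) (h @ tail [y] Bs @ w')"
    by (rule sim_tail) (use depth_ge_double[OF assms(3,7)] in \<open>auto simp: h_def\<close>)
  then obtain Bs w' where B: "length Bs = l" "same (h @ w) (h @ tail [y] Bs @ w')" by blast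
  define h' where "h' = g @ [y, x, x]"
  have "[x] @ [x] @ [y] @ tail [y] Bs \<approx> [y] @ [x] @ [x] @ tail [y] Bs"
    using assms(2) B(1) unfolding M_law_def by blast
  from ctx[OF this, of g w'] have 2: "h @ tail [y] Bs @ w' \<approx> h' @ tail [y] Bs @ w'"
    by (simp add: h_def h'_def)
  have 3: "same (h' @ w) (h' @ tail [y] Bs @ w')"
    by (rule same_append[OF B(2)]) (simp add: h_def h'_def)
  have 4: "h @ w \<approx> h' @ w" using 2 3 B(2) same_eq_trans eq_same_trans same_sym by blast
  have x: "depth_at_least (eSuc (enat l)) (g @ y # x # w) x"
    by (rule depth_at_least_exchange1[OF assms(3-6)])
  have 5: "(g @ [y]) @ x # w \<approx> (g @ [y]) @ x # x # w"
    by (rule double[OF assms(1)]) (use assms x in auto)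
  have 6: "h' @ w \<approx> g @ y # x # w" using sym[OF 5] by (simp add: h'_def)
  from trans[OF 1 trans[OF 4 6]] show ?thesis .
qed

text \<open>
  No law with letters between the second occurrences of \<open>x\<close>
    and \<open>y\<close> is needed: the word is an
  instance of \<open>N_law\<close> with \<open>S = a x b\<close>, the displayed \<open>X\<close> after \<open>S\<close> being a third occurrence.
\<close>

lemma exchange_N_aux:
  assumes "N_law (\<approx>) n" "x \<notin> set g" "y \<notin> set g" "x \<noteq> y"
    "x \<notin> set a" "y \<notin> set a" "y \<notin> set b"
    and "depth_ge (Suc n) (g @ x # y # a @ x # b @ y # c) x"
      "depth_ge (Suc n) (g @ x # y # a @ x # b @ y # c) y"
  shows "g @ x # y # a @ x # b @ y # c \<approx> g @ y # x # a @ x # b @ y # c"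
proof -
  let ?U = "g @ x # y # a @ x # b @ y # c"
  define h where "h = g @ x # y # a @ x # b @ [x, y]"
  have U: "same (h @ c) ?U"
    using same_insert_one[of "g @ x # y # a @ x # b" x "y # c"] by (simp add: h_def)
  have edge_x:
    "\<And>d. d \<in> set ?U \<Longrightarrow> before ?U x d = 1 \<Longrightarrow> depth_ge n ?U d"
    and edge_y:
      "\<And>d. d \<in> set ?U \<Longrightarrow> before ?U y d = 1 \<Longrightarrow> depth_ge n ?U d"
    using assms(8,9) unfolding depth_ge.simps by blast+
  have "\<exists>Bs w'. length Bs = n \<and> same (h @ c) (h @ tail (a @ x # b) Bs @ w')"
  proof (rule sim_tail)
    fix d assume d: "d \<in> set (a @ x # b)"
    show "2 \<le> count_list h d \<or> depth_ge n (h @ c) d"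
    proof (cases "2 \<le> count_list h d")
      case False
      then have dx: "d \<noteq> x" by (auto simp: h_def split: if_splits)
      have dU: "d \<in> set ?U" using d by auto
      have dy: "d \<noteq> y" using d assms(4,6,7) by auto
      have "count_list (a @ x # b) d \<noteq> 0" using d unfolding count_list_0_iff by blast
      then have "count_list g d = 0" using False dx dy by (auto simp: h_def)
      then have depth_ge: "d \<notin> set g" unfolding count_list_0_iff .
      have "depth_ge n ?U d"
      proof (cases "d \<in> set a")
        case True
        then obtain a1 a2 where "a = a1 @ d # a2" "d \<notin> set a1" by (meson split_list_first)
        then have "before ?U x d = 1" using depth_ge dx dy assms(2-7)
          by (auto simp: before_append before_Cons count_notin)
        then show ?thesis using edge_x dU by blast
      next
        case False
        then have "d \<in> set b" using d dx by auto
        then obtain a1 a2 where "b = a1 @ d # a2" "d \<notin> set a1" by (meson split_list_first)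
        then have "before ?U y d = 1" using depth_ge dx dy assms(2-7) False
          by (auto simp: before_append before_Cons count_notin)
        then show ?thesis using edge_y dU by blast
      qed
      then show ?thesis using depth_ge_same[OF U] by simp
    qed simp
  qed (auto simp: h_def)
  then obtain Bs w' where B: "length Bs = n" "same (h @ c) (h @ tail (a @ x # b) Bs @ w')" by blast
  define h' where "h' = g @ y # x # a @ x # b @ [x, y]"
  have "[x] @ [y] @ (a @ x # b) @ [x] @ [y] @ tail (a @ x # b) Bs \<approx>
     [y] @ [x] @ (a @ x # b) @ [x] @ [y] @ tail (a @ x # b) Bs"
    using assms(1) B(1) unfolding N_law_def by blast
  from ctx[OF this, of g w']
  have 2: "h @ tail (a @ x # b) Bs @ w' \<approx> h' @ tail (a @ x # b) Bs @ w'"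
    by (simp add: h_def h'_def)
  have 3: "same (h' @ c) (h' @ tail (a @ x # b) Bs @ w')"
    by (rule same_append[OF B(2)]) (simp add: h_def h'_def)
  have V: "same (h' @ c) (g @ y # x # a @ x # b @ y # c)"
    using same_insert_one[of "g @ y # x # a @ x # b" x "y # c"] by (simp add: h'_def)
  show ?thesis using 2 3 V U B(2) same_eq_trans eq_same_trans same_sym by blast
qed

text \<open>\<open>exchange_N_aux\<close> wants \<open>x\<close> to be closed before
  \<open>y\<close>. Otherwise it is applied to the interchanged word, where the two depths have not
  dropped.\<close>

lemma exchange_N:
  assumes "N_law (\<approx>) n" "x \<notin> set g" "y \<notin> set g" "x \<noteq> y"
    and "depth_ge (Suc n) (g @ x # y # w) x" "depth_ge (Suc n) (g @ x # y # w) y"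
  shows "g @ x # y # w \<approx> g @ y # x # w"
proof -
  have "2 \<le> count_list (g @ x # y # w) x" "2 \<le> count_list (g @ x # y # w) y"
    using assms(5,6) by simp_all
  then have "count_list w x \<noteq> 0" "count_list w y \<noteq> 0" using assms(2-4)
    by (auto simp: count_notin)
  then have xy: "x \<in> set w" "y \<in> set w" by (simp_all add: count_list_0_iff)
  obtain a w1 where w: "w = a @ x # w1" "x \<notin> set a" using xy(1) by (meson split_list_first)
  show ?thesis
  proof (cases "y \<in> set a")
    case False
    then have "y \<in> set w1" using xy w assms(4) by auto
    then obtain b c where "w1 = b @ y # c" "y \<notin> set b" by (meson split_list_first)
    with exchange_N_aux[OF assms(1-4) w(2) False] assms(5,6) w(1) show ?thesis by simp
  next
    case True
    then obtain a1 a2 where a: "a = a1 @ y # a2" "y \<notin> set a1" by (meson split_list_first)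
    have "depth_ge (Suc n) (g @ y # x # w) x" "depth_ge (Suc n) (g @ y # x # w) y"
      using depth_at_least_exchange1[OF assms(2-4), of
        "enat (Suc n)" w] depth_at_least_exchange2[OF assms(2-4), of "enat (Suc n)" w]
        assms(5,6) by (simp_all only: depth_at_least_enat)
    then have "g @ y # x # w \<approx> g @ x # y # w"
      using exchange_N_aux[OF assms(1,3,2) assms(4)[symmetric] a(2), of a2 w1] w a by simp
    then show ?thesis by (rule sym)
  qed
qed

end

section \<open>Extracting laws from an identity\<close>

text \<open>The value 2 excludes shortcuts: \<open>b\<close> is closed before every later letter of
  the path except the next. The conditions describe \<open>tail [b] (letters bs)\<close> in terms of
  \<open>before\<close>.\<close>

fun path :: "nat list \<Rightarrow> nat \<Rightarrow> nat list \<Rightarrow> bool" where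
  "path u b [] \<longleftrightarrow> count_list u b = 1"
| "path u b (c # cs) \<longleftrightarrow> 2 \<le> count_list u b \<and> c \<in> set u \<and> before u b c = 1 \<and>
     (\<forall>d\<in>set cs. before u b d = 2) \<and> path u c cs"

text \<open>The analogue of \<open>path\<close> for \<open>chain\<close>: \<open>s\<close> stays
  open along \<open>cs\<close> and closes together with the last letter of \<open>z # cs\<close>,
  behind the first letter of \<open>bs\<close>; if \<open>bs\<close> is empty, both occur only
  once.\<close>

fun cpath ::
  "nat list \<Rightarrow> nat \<Rightarrow> nat \<Rightarrow> nat list \<Rightarrow> nat list \<Rightarrow> bool" where
  "cpath u s z [] [] \<longleftrightarrow> count_list u z = 1 \<and> count_list u s = 1"
| "cpath u s z [] (p # ps) \<longleftrightarrow> 2 \<le> count_list u z \<and> 2 \<le> count_list u s \<and> p \<in> set u \<and>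
     before u z p = 1 \<and> before u s p = 1 \<and> (\<forall>d\<in>set ps. before u z d = 2 \<and> before u s d = 2) \<and> path u p ps"
| "cpath u s z (c # cs) bs \<longleftrightarrow> 2 \<le> count_list u z \<and> c \<in> set u \<and> before u z c = 1 \<and> before u s c = 1 \<and>
     (\<forall>d\<in>set cs \<union> set bs. before u z d = 2) \<and> cpath u s c cs bs"

definition agree :: "nat list \<Rightarrow> nat list \<Rightarrow> bool" where
  "agree u C \<longleftrightarrow> (\<forall>a\<in>set C. min 2 (count_list u a) = min 2 (count_list C a) \<and>
     (\<forall>d\<in>set C. before u a d = before C a d))"

lemma agree_filter: "agree u C \<Longrightarrow> same (filter (\<lambda>a. a \<in> set C) u) C"
proof -
  assume a: "agree u C"
  have "before C x y = 0" if "x \<notin> set C" for x y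
    using that before_le_count[of C x y] by (simp add: count_notin)
  then show ?thesis
    using a by (auto simp: same_def before_filter agree_def before_notin)
qed

text \<open>In the induction \<open>b\<close> is the only open letter of \<open>pre\<close>; every
  other letter of \<open>pre\<close> has all its occurrences, up to 2, before the letters still to
  come. One step appends the next letter of the path and closes \<open>b\<close>.\<close>

lemma agree_tail:
  assumes "b \<in> set pre" "count_list pre b = 1" "distinct bs" "set bs \<inter> set pre = {}"
    "path u b bs"
    and "\<And>a d. a \<in> set pre \<Longrightarrow> d \<in> set pre \<Longrightarrow> before u a d = before pre a d"
    and "\<And>a d. a \<in> set pre \<Longrightarrow> a \<noteq> b \<Longrightarrow> d \<in> set bs \<Longrightarrow> before u a d = min 2 (count_list pre a)"
    and "\<And>a. a \<in> set pre \<Longrightarrow> a \<noteq> b \<Longrightarrow> min 2 (count_list u a) = min 2 (count_list pre a)"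
  shows "agree u (pre @ tail [b] (letters bs))"
  using assms
proof (induction bs arbitrary: b pre)
  case Nil
  then have "min 2 (count_list u a) = min 2 (count_list pre a)" if "a \<in> set pre" for a
    using that by (cases "a = b") auto
  with Nil show ?case by (simp add: agree_def)
next
  case (Cons c cs)
  have cpre: "c \<notin> set pre" and cb: "c \<noteq> b" using Cons.prems(1,4) by auto
  have "agree u ((pre @ [c, b]) @ tail [c] (letters cs))"
  proof (rule Cons.IH)
    show "count_list (pre @ [c, b]) c = 1" using cpre cb by (simp add: count_notin)
    show "set cs \<inter> set (pre @ [c, b]) = {}" using Cons.prems(1,3,4) by auto
    show "before u a d = before (pre @ [c, b]) a d"
      if ad: "a \<in> set (pre @ [c, b])" "d \<in> set (pre @ [c, b])" for a d
    proof (cases "d = c")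
      case True
      then show ?thesis using ad(1) Cons.prems(1,2,5) Cons.prems(7)[of a c] cpre cb
        by (cases "a = b") (auto simp: before_append before_Cons)
    next
      case False
      then have d: "d \<in> set pre" using ad(2) Cons.prems(1) by auto
      show ?thesis
      proof (cases "a = c")
        case True
        have "1 \<le> before u d c"
        proof (cases "d = b")
          case False
          then have "before u d c = min 2 (count_list pre d)" using Cons.prems(7)[OF d] by simp
          moreover have "count_list pre d \<noteq> 0" using d unfolding count_list_0_iff by blast
          ultimately show ?thesis by simp
        qed (use Cons.prems(5) in simp)
        then show ?thesis
          using True d cpre before_asym[of u d c] before_prefix_zero[of d pre c "[c,b]"] by simp
      next
        case False
        then have "a \<in> set pre" using ad(1) Cons.prems(1) by auto
        then show ?thesis using Cons.prems(6) d by (simp add: before_append)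
      qed
    qed
    show "before u a d = min 2 (count_list (pre @ [c, b]) a)"
      if "a \<in> set (pre @ [c, b])" "a \<noteq> c" "d \<in> set cs" for a d
      using that Cons.prems(1,2,5) Cons.prems(7)[of a d] by (cases "a = b") auto
    show "min 2 (count_list u a) = min 2 (count_list (pre @ [c, b]) a)"
      if "a \<in> set (pre @ [c, b])" "a \<noteq> c" for a
      using that Cons.prems(1,2,5) Cons.prems(8)[of a] by (cases "a = b") auto
  qed (use Cons.prems in auto)
  then show ?case by simp
qed

text \<open>The invariant of \<open>agree_tail\<close> with two open letters, \<open>z\<close> and
  \<open>s\<close>. Once \<open>cs\<close> is used up, both are closed behind the first letter of
  \<open>bs\<close>, if any, and \<open>agree_tail\<close> takes over.\<close>

lemma agree_chain:
  assumes "z \<in> set pre" "count_list pre z = 1" "s \<in> set pre" "count_list pre s = 1"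
    "s \<noteq> z"
    and "distinct (cs @ bs)" "set (cs @ bs) \<inter> set pre = {}" "cpath u s z cs bs"
    and "\<And>a d. a \<in> set pre \<Longrightarrow> d \<in> set pre \<Longrightarrow> before u a d = before pre a d"
    and "\<And>a d. a \<in> set pre \<Longrightarrow> a \<noteq> z \<Longrightarrow> a \<noteq> s \<Longrightarrow> d \<in> set (cs @ bs) \<Longrightarrow> before u a d = min 2 (count_list pre a)"
    and "\<And>a. a \<in> set pre \<Longrightarrow> a \<noteq> z \<Longrightarrow> a \<noteq> s \<Longrightarrow> min 2 (count_list u a) = min 2 (count_list pre a)"
  shows "agree u (pre @ chain [s] [z] (letters cs) (letters bs))"
  using assms
proof (induction cs arbitrary: z pre)
  case Nil
  show ?case
  proof (cases bs)
    case Nil': Nil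
    have "min 2 (count_list u a) = min 2 (count_list pre a)" if "a \<in> set pre" for a
      using that Nil Nil' by (cases "a = z"; cases "a = s") auto
    with Nil Nil' show ?thesis by (simp add: agree_def)
  next
    case (Cons p ps)
    have p: "p \<notin> set pre" "p \<noteq> z" "p \<noteq> s" using Nil.prems(1,3,7) Cons by auto
    have "agree u ((pre @ [p, z, s]) @ tail [p] (letters ps))"
    proof (rule agree_tail)
      show "count_list (pre @ [p, z, s]) p = 1" using p by (simp add: count_notin)
      show "set ps \<inter> set (pre @ [p, z, s]) = {}" using Nil.prems(1,3,6,7) Cons by auto
      show "before u a d = before (pre @ [p, z, s]) a d"
        if ad: "a \<in> set (pre @ [p, z, s])" "d \<in> set (pre @ [p, z, s])" for a d
      proof (cases "d = p")
        case True
        then show ?thesis using ad(1) Nil.prems(1-4,8) Nil.prems(10)[of a p] p Cons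
          by (cases "a = z"; cases "a = s") (auto simp: before_append before_Cons)
      next
        case False
        then have d: "d \<in> set pre" using ad(2) Nil.prems(1,3) by auto
        show ?thesis
        proof (cases "a = p")
          case True
          have "1 \<le> before u d p"
          proof (cases "d = z \<or> d = s")
            case False
            then have "before u d p = min 2 (count_list pre d)" using Nil.prems(10)[OF d, of p] Cons
              by simp
            moreover have "count_list pre d \<noteq> 0" using d unfolding count_list_0_iff by blast
            ultimately show ?thesis by simp
          qed (use Nil.prems(8) Cons in auto)
          then show ?thesis
            using True d p before_asym[of u d p] before_prefix_zero[of d pre p "[p,z,s]"] by simp
        next
          case False
          then have "a \<in> set pre" using ad(1) Nil.prems(1,3) by auto
          then show ?thesis using Nil.prems(9) d by (simp add: before_append)
        qed
      qed
      show "before u a d = min 2 (count_list (pre @ [p, z, s]) a)"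
        if "a \<in> set (pre @ [p, z, s])" "a \<noteq> p" "d \<in> set ps" for a d
        using that Nil.prems(1-5,8) Nil.prems(10)[of a d] Cons
          by (cases "a = z"; cases "a = s") auto
      show "min 2 (count_list u a) = min 2 (count_list (pre @ [p, z, s]) a)"
        if "a \<in> set (pre @ [p, z, s])" "a \<noteq> p" for a
        using that Nil.prems(1-5,8) Nil.prems(11)[of a] Cons by (cases "a = z"; cases "a = s") auto
    qed (use Nil.prems Cons in auto)
    then show ?thesis using Cons by simp
  qed
next
  case (Cons c cs)
  have c: "c \<notin> set pre" "c \<noteq> z" "c \<noteq> s" using Cons.prems(1,3,7) by auto
  have "agree u ((pre @ [c, z]) @ chain [s] [c] (letters cs) (letters bs))"
  proof (rule Cons.IH)
    show "count_list (pre @ [c, z]) c = 1" using c by (simp add: count_notin)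
    show "count_list (pre @ [c, z]) s = 1" using c Cons.prems(4,5) by simp
    show "set (cs @ bs) \<inter> set (pre @ [c, z]) = {}" using Cons.prems(1,6,7) by auto
    show "before u a d = before (pre @ [c, z]) a d"
      if ad: "a \<in> set (pre @ [c, z])" "d \<in> set (pre @ [c, z])" for a d
    proof (cases "d = c")
      case True
      then show ?thesis using ad(1) Cons.prems(1-4,8) Cons.prems(10)[of a c] c
        by (cases "a = z"; cases "a = s") (auto simp: before_append before_Cons)
    next
      case False
      then have d: "d \<in> set pre" using ad(2) Cons.prems(1) by auto
      show ?thesis
      proof (cases "a = c")
        case True
        have "1 \<le> before u d c"
        proof (cases "d = z \<or> d = s")
          case False
          then have "before u d c = min 2 (count_list pre d)" using Cons.prems(10)[OF d, of c]
            by simp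
          moreover have "count_list pre d \<noteq> 0" using d unfolding count_list_0_iff by blast
          ultimately show ?thesis by simp
        qed (use Cons.prems(8) in auto)
        then show ?thesis
          using True d c before_asym[of u d c] before_prefix_zero[of d pre c "[c,z]"] by simp
      next
        case False
        then have "a \<in> set pre" using ad(1) Cons.prems(1) by auto
        then show ?thesis using Cons.prems(9) d by (simp add: before_append)
      qed
    qed
    show "before u a d = min 2 (count_list (pre @ [c, z]) a)"
      if "a \<in> set (pre @ [c, z])" "a \<noteq> c" "a \<noteq> s" "d \<in> set (cs @ bs)" for a d
      using that Cons.prems(1,2,5,8) Cons.prems(10)[of a d] by (cases "a = z") auto
    show "min 2 (count_list u a) = min 2 (count_list (pre @ [c, z]) a)"
      if "a \<in> set (pre @ [c, z])" "a \<noteq> c" "a \<noteq> s" for a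
      using that Cons.prems(1,2,5,8) Cons.prems(11)[of a] by (cases "a = z") auto
  qed (use Cons.prems c in auto)
  then show ?case by simp
qed

lemma not_depth_ge_cases:
  assumes "\<not> depth_ge n u b"
  obtains k where "k < n" "depth_ge k u b" "\<not> depth_ge (Suc k) u b"
proof -
  define j where "j = (LEAST j. \<not> depth_ge j u b)"
  have j: "\<not> depth_ge j u b" "\<And>i. i < j \<Longrightarrow> depth_ge i u b" "j \<le> n"
    unfolding j_def
      using LeastI[of "\<lambda>j. \<not> depth_ge j u b", OF assms] Least_le[of
        "\<lambda>j. \<not> depth_ge j u b", OF assms]
      not_less_Least[of _ "\<lambda>j. \<not> depth_ge j u b"] by blast+
  then obtain k where "j = Suc k" by (cases j) auto
  with j show thesis by (intro that[of k]) auto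
qed

text \<open>Follow an edge that lowers the depth by one. No shortcut exists, since successors of
  \<open>b\<close> have depth at least n - 1 while the path letters after the first have smaller
  depth.\<close>

lemma ex_path:
  assumes "depth_ge n u b" "\<not> depth_ge (Suc n) u b" "b \<in> set u"
  shows "\<exists>bs. length bs = n \<and> distinct (b # bs) \<and> path u b bs \<and>
    (\<forall>d\<in>set bs. d \<in> set u \<and> \<not> depth_ge n u d \<and> 1 \<le> before u b d)"
  using assms
proof (induction n arbitrary: b)
  case 0
  then have "count_list u b < 2" by auto
  moreover have "count_list u b \<noteq> 0" using 0 unfolding count_list_0_iff by blast
  ultimately show ?case by (intro exI[of _ "[]"]) auto
next
  case (Suc n)
  have b: "2 \<le> count_list u b"
    "\<And>y. y \<in> set u \<Longrightarrow> before u b y = 1 \<Longrightarrow> depth_ge n u y"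
    using Suc.prems(1) by auto
  obtain c where c: "c \<in> set u" "before u b c = 1" "\<not> depth_ge (Suc n) u c"
    using Suc.prems(2) b(1) by (auto simp only: depth_ge.simps)
  obtain cs where cs: "length cs = n" "distinct (c # cs)" "path u c cs"
    "\<And>d. d \<in> set cs \<Longrightarrow> d \<in> set u \<and> \<not> depth_ge n u d \<and> 1 \<le> before u c d"
    using Suc.IH[OF b(2)[OF c(1,2)] c(3,1)] by blast
  have d2: "before u b d = 2" if "d \<in> set cs" for d
  proof -
    have "1 \<le> before u b d" using before_mono[of u c d b] cs(4)[OF that] c(2) by simp
    moreover have "before u b d \<noteq> 1" using b(2) cs(4)[OF that] by blast
    ultimately show ?thesis using before_le2[of u b d] by linarith
  qed
  have "\<not> depth_ge (Suc n) u d" if "d \<in> set cs" for d using cs(4)[OF that] depth_ge_SucD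
    by blast
  moreover have "b \<notin> set (c # cs)" using d2 c(2)
    by (metis before_self set_ConsD zero_neq_numeral zero_neq_one)
  ultimately show ?case using cs d2 c b(1)
    by (intro exI[of _ "c # cs"]) auto
qed

text \<open>If \<open>b\<close> is already closed at \<open>p1\<close>, then \<open>p2\<close>
  precedes \<open>p1\<close>, so that \<open>a\<close>, open at \<open>p1\<close>, is open at
  \<open>p2\<close> as well.\<close>

lemma common_edge:
  assumes "1 \<le> before u a b" "before u a p1 = 1" "1 \<le> before u b p1" "before u b p2 = 1"
    "p1 \<in> set u" "p2 \<in> set u"
  shows "\<exists>p\<in>{p1, p2}. before u a p = 1 \<and> before u b p = 1"
proof (cases "before u b p1 = 1")
  case False
  then have 2: "2 \<le> before u b p1" using assms(3) by linarith
  then have "p1 \<noteq> p2" using assms(4) by auto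
  have "before u p1 p2 = 0"
    using before_mono[of u p1 p2 b] 2 assms(4) by (cases "before u p1 p2") auto
  then have "1 \<le> before u p2 p1" using before_total assms(5) \<open>p1 \<noteq> p2\<close>
    by blast
  then have "before u a p2 \<le> 1" using before_mono[of u p2 p1 a] assms(2) by simp
  moreover have "1 \<le> before u a p2" using before_mono[of u b p2 a] assms(1,4) by simp
  ultimately show ?thesis using assms(4) by auto
qed (use assms in auto)

lemma before_before:
  assumes "1 < before u z d" "before u z c = 1" "d \<in> set u"
  shows "1 \<le> before u c d"
proof -
  have "d \<noteq> c" using assms by auto
  have "before u d c = 0"
    using before_mono[of u d c z] assms by (cases "before u d c") auto
  then show ?thesis using before_total assms(3) \<open>d \<noteq> c\<close> by blast
qed

text \<open>As in \<open>ex_path\<close>, but \<open>s\<close> must still be open at each letter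
  \<open>c\<close> of \<open>cs\<close>. For positive \<open>m\<close> it is, since a successor
  \<open>p1\<close> of \<open>s\<close> of depth less than \<open>m\<close> comes later:
  \<open>p1\<close> is too shallow to be a successor of \<open>z\<close>, so \<open>z\<close> is
  closed before \<open>p1\<close>, while \<open>c\<close> lies in the interval of \<open>z\<close>.
  At the end \<open>common_edge\<close> finds one letter that serves both \<open>z\<close> and
  \<open>s\<close>.\<close>

lemma ex_cpath:
  assumes "depth_ge (j + m) u z" "\<not> depth_ge (Suc (j + m)) u z" "z \<in> set u"
    and "depth_ge m u s" "\<not> depth_ge (Suc m) u s" "s \<in> set u" "before u s z = 1"
    and "\<And>d. d \<in> set u \<Longrightarrow> \<not> depth_ge m u d \<Longrightarrow> 1 \<le> before u s d \<Longrightarrow> 1 \<le> before u z d"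
  shows "\<exists>cs bs. length cs = j \<and> length bs = m \<and> cpath u s z cs bs \<and> distinct (z # cs @ bs) \<and>
     (\<forall>d\<in>set (cs @ bs). d \<in> set u \<and> \<not> depth_ge (j + m) u d \<and> 1 \<le> before u z d)"
  using assms
proof (induction j arbitrary: z)
  case 0
  show ?case
  proof (cases m)
    case m: 0
    have "count_list u z = 1" "count_list u s = 1"
      using ex_path[of 0 u z] ex_path[of 0 u s] 0 m by auto
    then show ?thesis using m by (intro exI[of _ "[]"]) auto
  next
    case (Suc m')
    have s: "2 \<le> count_list u s"
      "\<And>y. y \<in> set u \<Longrightarrow> before u s y = 1 \<Longrightarrow> depth_ge m' u y"
      and z: "2 \<le> count_list u z"
        "\<And>y. y \<in> set u \<Longrightarrow> before u z y = 1 \<Longrightarrow> depth_ge m' u y"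
      using 0(1,4) Suc by auto
    obtain p1 where p1: "p1 \<in> set u" "before u s p1 = 1" "\<not> depth_ge m u p1"
      using 0(5) s(1) by (auto simp only: depth_ge.simps)
    obtain p2 where p2: "p2 \<in> set u" "before u z p2 = 1" "\<not> depth_ge m u p2"
      using 0(2) z(1) by (auto simp only: depth_ge.simps add_0)
    have "1 \<le> before u z p1" using 0(8) p1 by simp
    then obtain p where p: "p \<in> set u" "before u s p = 1" "before u z p = 1"
      "\<not> depth_ge m u p"
      using common_edge[of u s z p1 p2] 0(7) p1 p2 by auto
    obtain ps where ps: "length ps = m'" "distinct (p # ps)" "path u p ps"
      "\<And>d. d \<in> set ps \<Longrightarrow> d \<in> set u \<and> \<not> depth_ge m' u d \<and> 1 \<le> before u p d"
      using ex_path[OF s(2)[OF p(1,2)] _ p(1)] p(4) Suc by blast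
    have d2: "before u z d = 2 \<and> before u s d = 2" if "d \<in> set ps" for d
    proof -
      have "1 \<le> before u z d" "1 \<le> before u s d"
        using before_mono[of u p d] ps(4)[OF that] p(2,3) by (metis)+
      moreover have "before u z d \<noteq> 1" "before u s d \<noteq> 1"
        using s(2) z(2) ps(4)[OF that] by blast+
      ultimately show ?thesis using before_le2[of u z d] before_le2[of u s d] by linarith
    qed
    have "\<not> depth_ge m u d" if "d \<in> set ps" for d using ps(4)[OF that] depth_ge_SucD Suc
      by blast
    moreover have "z \<notin> set (p # ps)" using d2 p(3)
      by (metis before_self set_ConsD zero_neq_numeral zero_neq_one)
    ultimately show ?thesis using ps d2 p s(1) z(1) Suc
      by (intro exI[of _ "[]"] exI[of _ "p # ps"]) auto
  qed
next
  case (Suc j)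
  have z: "2 \<le> count_list u z"
    "\<And>y. y \<in> set u \<Longrightarrow> before u z y = 1 \<Longrightarrow> depth_ge (j + m) u y"
    using Suc.prems(1) by auto
  obtain c where c: "c \<in> set u" "before u z c = 1" "\<not> depth_ge (Suc (j + m)) u c"
    using Suc.prems(2) z(1) by (auto simp only: depth_ge.simps add_Suc)
  have far: "1 \<le> before u c d"
    if d: "d \<in> set u" "\<not> depth_ge m u d" "1 \<le> before u s d" for d
  proof -
    have "1 \<le> before u z d" using Suc.prems(8) d by blast
    moreover have "before u z d \<noteq> 1" using z(2)[of d] d depth_ge_le[of m "j + m"] by auto
    ultimately show ?thesis using before_before[of u z d c] c(2) d(1) by simp
  qed
  have "1 \<le> before u s c" using before_mono[of u z c s] c(2) Suc.prems(7) by simp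
  moreover have "before u s c \<le> 1"
  proof (cases m)
    case 0
    then have "count_list u s = 1" using ex_path[of 0 u s] Suc.prems(5,6) by auto
    then show ?thesis using before_le_count[of u s c] by simp
  next
    case (Suc m')
    then have "2 \<le> count_list u s" using \<open>depth_ge m u s\<close> by simp
    then obtain p1 where p1: "p1 \<in> set u" "before u s p1 = 1" "\<not> depth_ge m u p1"
      using \<open>\<not> depth_ge (Suc m) u s\<close> by (auto simp only: depth_ge.simps)
    then show ?thesis using far[of p1] before_mono[of u c p1 s] by simp
  qed
  ultimately have sc: "before u s c = 1" by simp
  obtain cs bs where cs: "length cs = j" "length bs = m" "cpath u s c cs bs"
    "distinct (c # cs @ bs)"
    "\<And>d. d \<in> set (cs @ bs) \<Longrightarrow> d \<in> set u \<and> \<not> depth_ge (j + m) u d \<and> 1 \<le> before u c d"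
    using Suc.IH[OF z(2)[OF c(1,2)] c(3,1) Suc.prems(4,5,6) sc far] by blast
  have d2: "before u z d = 2" if "d \<in> set (cs @ bs)" for d
  proof -
    have "1 \<le> before u z d" using before_mono[of u c d z] cs(5)[OF that] c(2) by simp
    moreover have "before u z d \<noteq> 1" using z(2) cs(5)[OF that] by blast
    ultimately show ?thesis using before_le2[of u z d] by linarith
  qed
  have "\<not> depth_ge (Suc j + m) u d" if "d \<in> set (cs @ bs)" for d
    using cs(5)[OF that] depth_ge_SucD by (metis add_Suc)
  moreover have "z \<notin> set (c # cs @ bs)" using d2 c(2)
    by (metis before_self set_ConsD zero_neq_numeral zero_neq_one)
  ultimately show ?case using cs d2 c sc z(1) \<open>\<not> depth_ge (Suc (j + m)) u c\<close>
    by (intro exI[of _ "c # cs"] exI[of _ bs]) auto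
qed

text \<open>
  The first occurrence of a stable letter has the same position relative to all first and second
  occurrences in both words.
\<close>

definition stable :: "nat list \<Rightarrow> nat list \<Rightarrow> nat \<Rightarrow> bool" where
  "stable u v b \<longleftrightarrow> (\<forall>x. before u x b = before v x b)"

text \<open>The multiplicities up to 2, without positions. An identity that violates this forces x =
  1 or x = xx, cases treated at the end.\<close>

definition similar :: "nat list \<Rightarrow> nat list \<Rightarrow> bool" where
  "similar u v \<longleftrightarrow> (\<forall>x. min 2 (count_list u x) = min 2 (count_list v x))"

lemma similar_set: "similar u v \<Longrightarrow> set u = set v"
  unfolding similar_def by (intro Set.set_eqI) (simp only: in_set_iff_count)

lemma similar_count: 
  assumes "similar u v" 
  shows "2 \<le> count_list u x \<longleftrightarrow> 2 \<le> count_list v x"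
    "count_list u x = 1 \<longleftrightarrow> count_list v x = 1"
  using assms unfolding similar_def by (auto simp: min_def split: if_splits dest: spec[of _ x])

lemma path_stable:
  "similar u v \<Longrightarrow> \<forall>d\<in>set bs. stable u v d \<Longrightarrow> path u b bs \<Longrightarrow> path v b bs"
  by (induction bs arbitrary: b)
    (auto simp: similar_count[of u v] similar_set[of u v] stable_def simp del: One_nat_def)

lemma cpath_stable:
  "similar u v \<Longrightarrow> \<forall>d\<in>set (cs @ bs). stable u v d \<Longrightarrow> cpath u s z cs bs \<Longrightarrow> cpath v s z cs bs"
proof (induction cs arbitrary: z)
  case Nil
  then show ?case using path_stable[of u v]
    by (cases bs) (auto simp: similar_count[of u v] similar_set[of u v] stable_def simp del: One_nat_def)
next
  case (Cons c cs)
  then show ?case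
    by (auto simp: similar_count[of u v] similar_set[of u v] stable_def simp del: One_nat_def)
qed

lemma path_Cons:
  "x \<notin> set (b # bs) \<Longrightarrow> path u b bs \<Longrightarrow> path (x # u) b bs"
  by (induction bs arbitrary: b) (auto simp: before_Cons)

lemma similar_pos:
  "similar u v \<Longrightarrow> 1 \<le> count_list u x \<Longrightarrow> 1 \<le> count_list v x"
  unfolding similar_def by (auto simp: min_def split: if_splits dest: spec[of _ x])

lemma stableD: "stable u v d \<Longrightarrow> before v a d = before u a d"
  by (simp add: stable_def)

lemma not_stableE:
  assumes "\<not> stable u v b" "similar u v"
  obtains x where "before u x b \<noteq> before v x b" "x \<noteq> b" "b \<in> set u"
proof -
  obtain x where x: "before u x b \<noteq> before v x b" using assms(1) by (auto simp: stable_def)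
  have "b \<in> set u"
  proof (rule ccontr)
    assume "b \<notin> set u"
    then have "before u x b = before v x b"
      using assms(2) similar_set[OF assms(2)] by (simp add: before_notin similar_def)
    with x show False ..
  qed
  moreover have "x \<noteq> b" using x by auto
  ultimately show thesis using that x by blast
qed

text \<open>The digit in the names of these lemmas is \<open>before u x z\<close>, the only value in
  which the two sides of the law differ.\<close>

lemma agree_K2:
  assumes "path u s bs" "distinct (x # s # z # bs)" "before u x s = 1" "before u s z = 1"
    "before u x z = 2"
    and "\<And>d. d \<in> set bs \<Longrightarrow> before u x d = 2 \<and> before u z d = 2"
      "2 \<le> count_list u x" "2 \<le> count_list u z"
  shows "agree u ([x,s,x,z,z] @ tail [s] (letters bs))"
proof (rule agree_tail)
  have "before u s x = 0" "before u z s = 0" "before u z x = 0" using assms(3-5) before_asym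
    by simp_all
  then show "before u a d = before [x,s,x,z,z] a d"
    if "a \<in> set [x,s,x,z,z]" "d \<in> set [x,s,x,z,z]" for a d
    using that assms(2-5) by (auto simp: before_Cons)
qed (use assms in auto)

lemma agree_K1:
  assumes "path u s bs" "distinct (x # s # z # bs)" "before u x s = 1" "before u s z = 1"
    "before u x z = 1"
    and "\<And>d. d \<in> set bs \<Longrightarrow> before u x d = 2 \<and> before u z d = 2"
      "2 \<le> count_list u x" "2 \<le> count_list u z"
  shows "agree u ([x,s,z,x,z] @ tail [s] (letters bs))"
proof (rule agree_tail)
  have "before u s x = 0" "before u z s = 0" "before u z x = 0" using assms(3-5) before_asym
    by simp_all
  then show "before u a d = before [x,s,z,x,z] a d"
    if "a \<in> set [x,s,z,x,z]" "d \<in> set [x,s,z,x,z]" for a d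
    using that assms(2-5) by (auto simp: before_Cons)
qed (use assms in auto)

lemma agree_L2:
  assumes "cpath u s z cs bs" "distinct (x # s # z # cs @ bs)" "before u x s = 1" "before u s z = 1"
    "before u x z = 2"
    and "\<And>d. d \<in> set (cs @ bs) \<Longrightarrow> before u x d = 2" "2 \<le> count_list u x"
  shows "agree u ([x,s,x,z] @ chain [s] [z] (letters cs) (letters bs))"
proof (rule agree_chain)
  have "before u s x = 0" "before u z s = 0" "before u z x = 0" using assms(3-5) before_asym
    by simp_all
  then show "before u a d = before [x,s,x,z] a d"
    if "a \<in> set [x,s,x,z]" "d \<in> set [x,s,x,z]" for a d
    using that assms(2-5) by (auto simp: before_Cons)
qed (use assms in auto)

lemma agree_L1:
  assumes "cpath u s z cs bs" "distinct (x # s # z # cs @ bs)" "before u x s = 1" "before u s z = 1"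
    "before u x z = 1"
    and "\<And>d. d \<in> set (cs @ bs) \<Longrightarrow> before u x d = 2" "2 \<le> count_list u x"
  shows "agree u ([x,s,z,x] @ chain [s] [z] (letters cs) (letters bs))"
proof (rule agree_chain)
  have "before u s x = 0" "before u z s = 0" "before u z x = 0" using assms(3-5) before_asym
    by simp_all
  then show "before u a d = before [x,s,z,x] a d"
    if "a \<in> set [x,s,z,x]" "d \<in> set [x,s,z,x]" for a d
    using that assms(2-5) by (auto simp: before_Cons)
qed (use assms in auto)

lemma agree_N:
  assumes "path u s bs" "distinct (x # y # s # bs)" "before u x s = 1" "before u y s = 1"
    "before u x y = 1"
    and "\<And>d. d \<in> set bs \<Longrightarrow> before u x d = 2 \<and> before u y d = 2"
      "2 \<le> count_list u x" "2 \<le> count_list u y"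
  shows "agree u ([x,y,s,x,y] @ tail [s] (letters bs))"
proof (rule agree_tail)
  have "before u s x = 0" "before u s y = 0" "before u y x = 0" using assms(3-5) before_asym
    by simp_all
  then show "before u a d = before [x,y,s,x,y] a d"
    if "a \<in> set [x,y,s,x,y]" "d \<in> set [x,y,s,x,y]" for a d
    using that assms(2-5) by (auto simp: before_Cons)
qed (use assms in auto)

text \<open>\<open>s\<close> and a successor of \<open>s\<close> of depth less than \<open>m\<close>
  are stable, with \<open>z\<close> between them (for \<open>m\<close> = 0, \<open>s\<close> occurs
  once). So \<open>s\<close> is open at \<open>z\<close> in both words, and the only difference left
  is whether \<open>x\<close> is closed before \<open>z\<close>.\<close>

lemma cross_facts:
  assumes sim: "similar u v" and z: "z \<in> set u" and s: "s \<in> set u"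
    and b: "before u x s = 1" "1 \<le> before u s z" "before u x z \<noteq> before v x z"
    and dgs: "depth_ge m u s" "\<not> depth_ge (Suc m) u s"
    and st: "\<And>d. d \<in> set u \<Longrightarrow> \<not> depth_ge (Suc m) u d \<Longrightarrow> stable u v d"
    and hd: "\<And>d. d \<in> set u \<Longrightarrow> \<not> depth_ge m u d \<Longrightarrow> 1 \<le> before u s d \<Longrightarrow> 1 \<le> before u z d"
  shows "before u s z = 1" "before v s z = 1" "before v x s = 1"
    "before u x z = 1 \<and> before v x z = 2 \<or> before u x z = 2 \<and> before v x z = 1"
      "distinct [x, s, z]"
proof -
  have ss: "stable u v s" using st s dgs by blast
  then show vxs: "before v x s = 1" using b(1) by (simp add: stable_def)
  have "before v z s = 0" using ss before_asym[OF b(2)] by (simp add: stable_def)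
  moreover have "z \<in> set v" using z similar_set[OF sim] by simp
  moreover have sz: "s \<noteq> z" using b(2) by auto
  ultimately have vsz: "1 \<le> before v s z" using before_total by blast
  have le: "before u s z \<le> 1 \<and> before v s z \<le> 1"
  proof (cases m)
    case 0
    then have "count_list u s = 1" using ex_path[of 0 u s] dgs s by auto
    moreover from this have "count_list v s = 1" using similar_count[OF sim] by simp
    ultimately show ?thesis using before_le_count by metis
  next
    case (Suc m')
    then have "2 \<le> count_list u s" using dgs by simp
    then obtain p where p: "p \<in> set u" "before u s p = 1" "\<not> depth_ge m u p"
      using dgs(2) by (auto simp only: depth_ge.simps)
    then have "1 \<le> before u z p" using hd by simp
    moreover have "stable u v p" using st p depth_ge_SucD by blast
    ultimately show ?thesis
      using before_mono[of u z p s] before_mono[of v z p s] p(2) by (simp add: stable_def)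
  qed
  show uv: "before u s z = 1" "before v s z = 1" using le b(2) vsz by simp_all
  have "1 \<le> before u x z" using before_mono[of u s z x] b(1) uv by simp
  moreover have "1 \<le> before v x z" using before_mono[of v s z x] vxs uv by simp
  ultimately show
    "before u x z = 1 \<and> before v x z = 2 \<or> before u x z = 2 \<and> before v x z = 1"
    using before_le2[of u x z] before_le2[of v x z] b(3) by linarith
  show "distinct [x, s, z]" using b sz
    by (metis before_self distinct_length_2_or_more distinct_singleton zero_neq_one)
qed

section \<open>From unstable letters to laws\<close>

context P_theory
begin

lemma agree_eq:
  assumes "u \<approx> v" "agree u C" "agree v C'" "set C = set C'"
  shows "C \<approx> C'"
proof -
  have "filter (\<lambda>a. a \<in> set C) u \<approx> filter (\<lambda>a. a \<in> set C) v"
    by (rule restrict) fact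
  moreover have "same (filter (\<lambda>a. a \<in> set C) u) C"
    "same (filter (\<lambda>a. a \<in> set C) v) C'"
    using agree_filter assms(2-4) by metis+
  ultimately show ?thesis using same_eq_trans eq_same_trans same_sym by blast
qed

lemma R_extract:
  assumes "u \<approx> v" "path u b bs" "path v b bs" "distinct (x # b # bs)"
    "before u x b = 2" "before v x b = 1"
      "\<And>d. d \<in> set bs \<Longrightarrow> before u x d = 2 \<and> before v x d = 2"
    "2 \<le> count_list u x" "2 \<le> count_list v x"
  shows "R_law (\<approx>) (length bs)"
proof (rule R_lawI[OF assms(4)])
  have a: "before u b x = 0" "before v b x = 0" using assms before_asym by simp_all
  have "agree u ([x,x,b] @ tail [b] (letters bs))"
    by (rule agree_tail) (use assms a in \<open>auto simp: before_Cons\<close>)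
  moreover have "agree v ([x,b,x] @ tail [b] (letters bs))"
    by (rule agree_tail) (use assms a in \<open>auto simp: before_Cons\<close>)
  ultimately show "[x,x,b] @ tail [b] (letters bs) \<approx> [x,b,x] @ tail [b] (letters bs)"
    using agree_eq assms(1) by fastforce
qed

lemma unstable_R_aux:
  assumes "u \<approx> v" "similar u v" "path u b bs" "path v b bs" "distinct (x # b # bs)"
    "\<And>d. d \<in> set bs \<Longrightarrow> stable u v d \<and> 1 \<le> before u b d"
      "before v x b < before u x b"
  shows "R_law (\<approx>) (length bs)"
proof -
  have ge: "before u x b \<le> before u x d" "before v x d = before u x d" if "d \<in> set bs" for d
    using assms(6)[OF that] before_mono[of u b d x] stableD by auto
  show ?thesis
  proof (cases "before v x b = 0")
    case False
    then have 2: "before u x b = 2" "before v x b = 1" using assms(7) before_le2[of u x b]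
      by linarith+
    have d: "before u x d = 2 \<and> before v x d = 2" if "d \<in> set bs" for d
      using ge[OF that] 2 before_le2[of u x d] by linarith
    have "2 \<le> count_list u x" using 2 before_le_count[of u x b] by simp
    moreover from this have "2 \<le> count_list v x" using similar_count[OF assms(2)] by blast
    ultimately show ?thesis using R_extract[OF assms(1,3-5) 2 d] by simp
  next
    case True
    have c: "1 \<le> count_list u x" using assms(7) before_le_count[of u x b] by linarith
    have c': "1 \<le> count_list v x" using similar_pos[OF assms(2) c] .
    have xb: "x \<noteq> b" "x \<notin> set bs" using assms(5) by auto
    show ?thesis
    proof (rule R_extract)
      \<comment> \<open>Multiplication by \<open>x\<close> on the left raises the values 0 and at
        least 1 at \<open>b\<close> to 1 and 2, the pattern of \<open>R_extract\<close>.\<close>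
      show "x # u \<approx> x # v" using cong[OF refl[of "[x]"] assms(1)] by simp
      show "path (x # u) b bs" "path (x # v) b bs"
        using path_Cons assms(3-5) by auto
      show "distinct (x # b # bs)" by fact
      show "before (x # u) x b = 2" "before (x # v) x b = 1"
        using True assms(7) xb by (auto simp: before_Cons)
      show "before (x # u) x d = 2 \<and> before (x # v) x d = 2" if "d \<in> set bs" for d
        using ge[OF that] assms(7) that xb by (auto simp: before_Cons)
      show "2 \<le> count_list (x # u) x" "2 \<le> count_list (x # v) x" using c c' by auto
    qed
  qed
qed

text \<open>The path from \<open>b\<close> runs through stable letters, so it is a path in both
  words. The witness \<open>x\<close> of instability is not on it, because \<open>b\<close> precedes
  each of its letters in both words.\<close>

lemma unstable_R:
  assumes "u \<approx> v" "similar u v" "depth_ge n u b" "\<not> depth_ge (Suc n) u b"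
    "\<And>d. d \<in> set u \<Longrightarrow> \<not> depth_ge n u d \<Longrightarrow> stable u v d"
      "\<not> stable u v b"
  shows "R_law (\<approx>) n"
proof -
  obtain x where x: "before u x b \<noteq> before v x b" "x \<noteq> b" "b \<in> set u"
    using not_stableE[OF assms(6,2)] by blast
  obtain bs where bs: "length bs = n" "distinct (b # bs)" "path u b bs"
    "\<And>d. d \<in> set bs \<Longrightarrow> d \<in> set u \<and> \<not> depth_ge n u d \<and> 1 \<le> before u b d"
    using ex_path[OF assms(3,4) x(3)] by blast
  have st: "stable u v d" if "d \<in> set bs" for d using bs(4)[OF that] assms(5) by blast
  have pv: "path v b bs" using path_stable[OF assms(2)] bs(3) st by blast
  have "x \<notin> set bs"
  proof
    assume d: "x \<in> set bs"
    then have "1 \<le> before u b x" "1 \<le> before v b x" using bs(4)[OF d] stableD[OF st[OF d]]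
      by auto
    then show False using x(1) before_asym by metis
  qed
  then have dist: "distinct (x # b # bs)" using bs(2) x(2) by auto
  consider "before v x b < before u x b" | "before u x b < before v x b" using x(1) by linarith
  then show ?thesis
  proof cases
    case 1
    then show ?thesis using unstable_R_aux[OF assms(1,2) bs(3) pv dist] st bs(1,4) by auto
  next
    case 2
    have "similar v u" using assms(2) by (simp add: similar_def)
    moreover have "stable v u d \<and> 1 \<le> before v b d" if "d \<in> set bs" for d
      using st[OF that] bs(4)[OF that] by (simp add: stable_def)
    ultimately show ?thesis using unstable_R_aux[OF sym[OF assms(1)] _ pv bs(3) dist _ 2] bs(1)
      by auto
  qed
qed

lemma unstable_R_inf_aux:
  assumes "u \<approx> v" "similar u v" "2 \<le> count_list u b" "before v x b < before u x b"
    "x \<noteq> b"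
  shows "R_inf (\<approx>)"
proof (rule R_infI[OF assms(5)])
  have cb: "2 \<le> count_list v b" using assms(2,3) similar_count by blast
  have key: "[x,x,b,b] \<approx> [x,b,x,b]"
    if "u \<approx> v" "2 \<le> count_list u b" "2 \<le> count_list v b" "2 \<le> count_list u x"
      "2 \<le> count_list v x"
      "before u x b = 2" "before v x b = 1" for u v
  proof -
    have "before u b x = 0" "before v b x = 0" using that before_asym by simp_all
    then have "agree u [x,x,b,b]" "agree v [x,b,x,b]"
      using that assms(5) by (auto simp: agree_def before_Cons)
    then show ?thesis using agree_eq[OF that(1)] by fastforce
  qed
  show "[x,x,b,b] \<approx> [x,b,x,b]"
  proof (cases "before v x b = 0")
    case False
    then have 2: "before u x b = 2" "before v x b = 1" using assms(4) before_le2[of u x b]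
      by linarith+
    have "2 \<le> count_list u x" using 2 before_le_count[of u x b] by simp
    moreover from this have "2 \<le> count_list v x" using similar_count[OF assms(2)] by blast
    ultimately show ?thesis using key[OF assms(1,3) cb _ _ 2] by simp
  next
    case True
    have c: "1 \<le> count_list u x" using assms(4) before_le_count[of u x b] by linarith
    have c': "1 \<le> count_list v x" using similar_pos[OF assms(2) c] .
    have "x # u \<approx> x # v" using cong[OF refl[of "[x]"] assms(1)] by simp
    moreover have "before (x # u) x b = 2" "before (x # v) x b = 1"
      using True assms(4,5) by (auto simp: before_Cons)
    ultimately show ?thesis using key[of "x # u" "x # v"] c c' cb assms(3,5) by auto
  qed
qed

lemma unstable_R_inf:
  assumes "u \<approx> v" "similar u v" "\<not> stable u v b"
  shows "R_inf (\<approx>)"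
proof -
  obtain x where x: "before u x b \<noteq> before v x b" "x \<noteq> b" "b \<in> set u"
    using not_stableE[OF assms(3,2)] by blast
  show ?thesis
  proof (cases "2 \<le> count_list u b")
    case True
    have vu: "similar v u" using assms(2) by (simp add: similar_def)
    have vb: "2 \<le> count_list v b" using True similar_count[OF assms(2)] by blast
    consider "before v x b < before u x b" | "before u x b < before v x b" using x(1) by linarith
    then show ?thesis
      by cases (rule unstable_R_inf_aux[OF assms(1,2) True _ x(2)] unstable_R_inf_aux[OF sym[OF assms(1)] vu vb _ x(2)], assumption)+
  next
    case False
    \<comment> \<open>A letter that occurs once has depth 0, and \<open>R_law\<close> with empty
      tail, XXA = XAX, gives \<open>R_inf\<close> after multiplication by A.\<close>
    then have "R_law (\<approx>) 0" using unstable_R[OF assms(1,2), of 0 b] assms(3) by simp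
    then have *: "X @ X @ A \<approx> X @ A @ X" for X A
      unfolding R_law_def by force
    show ?thesis unfolding R_inf_def using cong[OF * refl] by simp
  qed
qed

text \<open>An unstable letter of least depth \<open>n\<close> yields \<open>R_law n\<close>.\<close>

lemma stable_below:
  assumes "u \<approx> v" "similar u v"
    "\<And>n. R_law (\<approx>) n \<Longrightarrow> l \<le> enat n" "\<not> depth_at_least l u b"
  shows "stable u v b"
proof -
  have "stable u v b" if "depth_ge n u b" "\<not> depth_ge (Suc n) u b" "enat n < l" for n b
    using that
  proof (induction n arbitrary: b rule: less_induct)
    case (less n)
    have "stable u v d" if "\<not> depth_ge n u d" for d
    proof -
      obtain k where "k < n" "depth_ge k u d" "\<not> depth_ge (Suc k) u d"
        using not_depth_ge_cases[OF \<open>\<not> depth_ge n u d\<close>] by blast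
      then show ?thesis using less.IH[of k d] less.prems(3)
        by (meson enat_ord_simps(2) order_less_trans)
    qed
    then show ?case using unstable_R[OF assms(1,2) less.prems(1,2)] assms(3)[of n] less.prems(3)
      by (meson leD)
  qed
  moreover obtain n where "enat n \<le> l" "\<not> depth_ge n u b" using assms(4)
    by (auto simp: depth_at_least_def)
  moreover from this obtain k where "k < n" "depth_ge k u b" "\<not> depth_ge (Suc k) u b"
    using not_depth_ge_cases by metis
  ultimately show ?thesis by (meson enat_ord_simps(2) order_less_le_trans)
qed

text \<open>Successors of \<open>z\<close> have depth at least \<open>m\<close> and the letters of
  \<open>bs\<close> have smaller depth, so \<open>z\<close> is closed before any of them. After
  deletion at most \<open>x\<close> separates the two occurrences of \<open>z\<close>.\<close>

lemma extract_K:
  assumes e: "u \<approx> v" and sim: "similar u v" and z: "z \<in> set u" and s: "s \<in> set u"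
    and b: "before u x s = 1" "1 \<le> before u s z" "before u x z \<noteq> before v x z"
    and dgs: "depth_ge m u s" "\<not> depth_ge (Suc m) u s"
    and st: "\<And>d. d \<in> set u \<Longrightarrow> \<not> depth_ge (Suc m) u d \<Longrightarrow> stable u v d"
    and hd: "\<And>d. d \<in> set u \<Longrightarrow> \<not> depth_ge m u d \<Longrightarrow> 1 \<le> before u s d \<Longrightarrow> 1 \<le> before u z d"
    and xd: "\<And>d. 1 \<le> before u z d \<Longrightarrow> before u x d = 2"
    and c: "2 \<le> count_list u x" "2 \<le> count_list u z"
    and zd: "\<And>d. d \<in> set u \<Longrightarrow> before u z d = 1 \<Longrightarrow> depth_ge m u d"
  shows "K_law (\<approx>) m"
proof -
  obtain bs where bs: "length bs = m" "distinct (s # bs)" "path u s bs"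
    "\<And>d. d \<in> set bs \<Longrightarrow> d \<in> set u \<and> \<not> depth_ge m u d \<and> 1 \<le> before u s d"
    using ex_path[OF dgs s] by blast
  note f = cross_facts[OF sim z s b dgs st hd]
  have bst: "stable u v d" if "d \<in> set bs" for d using bs(4)[OF that] st depth_ge_SucD by blast
  have d: "before u x d = 2 \<and> before u z d = 2" if "d \<in> set bs" for d
  proof -
    have "1 \<le> before u z d" "before u z d \<noteq> 1" using bs(4)[OF that] hd zd by blast+
    then show ?thesis using xd before_le2[of u z d]
      by (metis One_nat_def Suc_1 le_antisym not_less_eq_eq)
  qed
  then have d': "before v x d = 2 \<and> before v z d = 2" if "d \<in> set bs" for d
    using stableD[OF bst[OF that]] that by simp
  have pv: "path v s bs" using path_stable[OF sim _ bs(3)] bst by blast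
  have dist: "distinct (x # s # z # bs)"
  proof -
    have "x \<notin> set bs" "z \<notin> set bs" using d by (metis before_self zero_neq_numeral)+
    then show ?thesis using f(5) bs(2) by auto
  qed
  have c': "2 \<le> count_list v x" "2 \<le> count_list v z" using c similar_count[OF sim] by blast+
  have "[x,s,x,z,z] @ tail [s] (letters bs) \<approx> [x,s,z,x,z] @ tail [s] (letters bs)"
    using f(4)
  proof
    assume a: "before u x z = 1 \<and> before v x z = 2"
    have "agree u ([x,s,z,x,z] @ tail [s] (letters bs))"
      "agree v ([x,s,x,z,z] @ tail [s] (letters bs))"
      using a agree_K1[OF bs(3) dist b(1) f(1) _ d c] agree_K2[OF pv dist f(3,2) _ d' c'] by blast+
    then show ?thesis using agree_eq[OF sym[OF e]] by fastforce
  next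
    assume a: "before u x z = 2 \<and> before v x z = 1"
    have "agree v ([x,s,z,x,z] @ tail [s] (letters bs))"
      "agree u ([x,s,x,z,z] @ tail [s] (letters bs))"
      using a agree_K2[OF bs(3) dist b(1) f(1) _ d c] agree_K1[OF pv dist f(3,2) _ d' c'] by blast+
    then show ?thesis using agree_eq[OF e] by fastforce
  qed
  then show ?thesis using K_lawI[OF dist] bs(1) by simp
qed

text \<open>Now \<open>z\<close> has depth exactly \<open>j + m\<close>, so its own shortest path is
  kept as well; \<open>ex_cpath\<close> merges it with that of \<open>s\<close>.\<close>

lemma extract_L:
  assumes e: "u \<approx> v" and sim: "similar u v" and z: "z \<in> set u" and s: "s \<in> set u"
    and b: "before u x s = 1" "1 \<le> before u s z" "before u x z \<noteq> before v x z"
    and dgs: "depth_ge m u s" "\<not> depth_ge (Suc m) u s"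
    and st: "\<And>d. d \<in> set u \<Longrightarrow> \<not> depth_ge (Suc m) u d \<Longrightarrow> stable u v d"
    and hd: "\<And>d. d \<in> set u \<Longrightarrow> \<not> depth_ge m u d \<Longrightarrow> 1 \<le> before u s d \<Longrightarrow> 1 \<le> before u z d"
    and xd: "\<And>d. 1 \<le> before u z d \<Longrightarrow> before u x d = 2"
    and c: "2 \<le> count_list u x"
    and dgz: "depth_ge (j + m) u z" "\<not> depth_ge (Suc (j + m)) u z"
    and st': "\<And>d. d \<in> set u \<Longrightarrow> \<not> depth_ge (j + m) u d \<Longrightarrow> stable u v d"
  shows "L_law (\<approx>) m j"
proof -
  note f = cross_facts[OF sim z s b dgs st hd]
  obtain cs bs where bs: "length cs = j" "length bs = m" "cpath u s z cs bs"
    "distinct (z # cs @ bs)"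
    "\<And>d. d \<in> set (cs @ bs) \<Longrightarrow> d \<in> set u \<and> \<not> depth_ge (j + m) u d \<and> 1 \<le> before u z d"
    using ex_cpath[OF dgz z dgs s f(1) hd] by blast
  have bst: "stable u v d" if "d \<in> set (cs @ bs)" for d using bs(5)[OF that] st' by blast
  have d: "before u x d = 2" if "d \<in> set (cs @ bs)" for d using bs(5)[OF that] xd by blast
  then have d': "before v x d = 2" if "d \<in> set (cs @ bs)" for d
    using stableD[OF bst[OF that]] that by simp
  have pv: "cpath v s z cs bs" using cpath_stable[OF sim _ bs(3)] bst by blast
  have "s \<notin> set (cs @ bs)"
  proof
    assume "s \<in> set (cs @ bs)"
    then have "1 \<le> before u z s" using bs(5) by blast
    then show False using before_asym[of u z s] b(2) by simp
  qed
  moreover have "x \<notin> set (cs @ bs)" using d by (metis before_self zero_neq_numeral)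
  ultimately have dist: "distinct (x # s # z # cs @ bs)" using f(5) bs(4) by auto
  have c': "2 \<le> count_list v x" using c similar_count[OF sim] by blast
  have "[x,s,x,z] @ chain [s] [z] (letters cs) (letters bs) \<approx> [x,s,z,x] @ chain [s] [z] (letters cs) (letters bs)"
    using f(4)
  proof
    assume a: "before u x z = 1 \<and> before v x z = 2"
    have "agree u ([x,s,z,x] @ chain [s] [z] (letters cs) (letters bs))"
      "agree v ([x,s,x,z] @ chain [s] [z] (letters cs) (letters bs))"
      using a agree_L1[OF bs(3) dist b(1) f(1) _ d c] agree_L2[OF pv dist f(3,2) _ d' c'] by blast+
    then show ?thesis using agree_eq[OF sym[OF e]] by fastforce
  next
    assume a: "before u x z = 2 \<and> before v x z = 1"
    have "agree v ([x,s,z,x] @ chain [s] [z] (letters cs) (letters bs))"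
      "agree u ([x,s,x,z] @ chain [s] [z] (letters cs) (letters bs))"
      using a agree_L2[OF bs(3) dist b(1) f(1) _ d c] agree_L1[OF pv dist f(3,2) _ d' c'] by blast+
    then show ?thesis using agree_eq[OF e] by fastforce
  qed
  then show ?thesis using L_lawI[OF dist] bs(1,2) by simp
qed

text \<open>Deletion in \<open>u\<close> may leave \<open>x y x\<close> instead of
  \<open>x x y\<close> at the front; \<open>R_law\<close> identifies the two, so one law covers
  both.\<close>

lemma extract_M:
  assumes e: "u \<approx> v" and R: "R_law (\<approx>) (length bs)" and p: "path u y bs"
    "path v y bs"
    and dist: "distinct (x # y # bs)"
    and d: "\<And>d. d \<in> set bs \<Longrightarrow> before u x d = 2 \<and> before v x d = 2"
    and c: "2 \<le> count_list u x" "2 \<le> count_list v x" and b: "1 \<le> before u x y"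
      "1 \<le> before v y x"
  shows "M_law (\<approx>) (length bs)"
proof -
  have a: "before u y x = 0" "before v x y = 0" using b before_asym by blast+
  have vyx: "before v y x = 1"
  proof (cases bs)
    case Nil
    then have "count_list v y = 1" using p by simp
    then show ?thesis using before_le_count[of v y x] b(2) by linarith
  next
    case (Cons k ks)
    then have "before v y k = 1" "1 \<le> before v x k" using p(2) d by auto
    then show ?thesis using before_mono[of v x k y] b(2) by linarith
  qed
  have v: "agree v ([y,x,x] @ tail [y] (letters bs))"
    by (rule agree_tail) (use p dist d c a vyx in \<open>auto simp: before_Cons\<close>)
  have R': "[x] @ [x] @ [y] @ tail [y] (letters bs) \<approx> [x] @ [y] @ [x] @ tail [y] (letters bs)"
    by (rule R[unfolded R_law_def, rule_format]) simp
  have "[x,x,y] @ tail [y] (letters bs) \<approx> [y,x,x] @ tail [y] (letters bs)"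
  proof (cases "before u x y = 2")
    case True
    have "agree u ([x,x,y] @ tail [y] (letters bs))"
      by (rule agree_tail) (use p dist d c a True in \<open>auto simp: before_Cons\<close>)
    then show ?thesis using agree_eq[OF e _ v] by fastforce
  next
    case False
    then have "before u x y = 1" using b before_le2[of u x y] by linarith
    then have "agree u ([x,y,x] @ tail [y] (letters bs))"
      by (intro agree_tail) (use p dist d c a in \<open>auto simp: before_Cons\<close>)
    then have "[x,y,x] @ tail [y] (letters bs) \<approx> [y,x,x] @ tail [y] (letters bs)"
      using agree_eq[OF e _ v] by fastforce
    with R' show ?thesis using trans by simp
  qed
  then show ?thesis by (rule M_lawI[OF dist])
qed

lemma extract_M_inf:
  assumes e: "u \<approx> v" and R: "R_inf (\<approx>)"
    and c: "2 \<le> count_list u x" "2 \<le> count_list v x" "2 \<le> count_list u y"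
      "2 \<le> count_list v y"
    and b: "1 \<le> before u x y" "1 \<le> before v y x"
  shows "M_inf (\<approx>)"
proof (rule M_infI)
  show xy: "x \<noteq> y" using b by auto
  have a: "before u y x = 0" "before v x y = 0" using b before_asym by blast+
  have R': "[x,x,y,y] \<approx> [x,y,x,y]" "[y,y,x,x] \<approx> [y,x,y,x]"
    using R[unfolded R_inf_def, rule_format, of "[x]" "[y]"] R[unfolded R_inf_def, rule_format, of
      "[y]" "[x]"]
    by simp_all
  define C where "C = (if before u x y = 2 then [x,x,y,y] else [x,y,x,y])"
  define C' where "C' = (if before v y x = 2 then [y,y,x,x] else [y,x,y,x])"
  have 1: "before u x y = 2 \<or> before u x y = 1" "before v y x = 2 \<or> before v y x = 1"
    using b before_le2[of u x y] before_le2[of v y x] by linarith+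
  have "agree u C" "agree v C'"
    using 1 a c xy unfolding C_def C'_def by (auto simp: agree_def before_Cons)
  moreover have "set C = set C'" by (auto simp: C_def C'_def)
  ultimately have "C \<approx> C'" using agree_eq[OF e] by blast
  moreover have "[x,x,y,y] \<approx> C" "[y,y,x,x] \<approx> C'" using R'
    by (auto simp: C_def C'_def)
  ultimately show "[x,x,y,y] \<approx> [y,y,x,x]" using trans sym by blast
qed

text \<open>The first occurrences are adjacent, so what follows \<open>x\<close> also follows
  \<open>y\<close> (\<open>adj\<close>); this lets \<open>common_edge\<close> find a successor
  \<open>s\<close> shared by both.\<close>

lemma extract_N:
  assumes e: "u \<approx> v" and sim: "similar u v" and x: "depth_ge (Suc n) u x"
    "\<not> depth_ge (Suc (Suc n)) u x"
    and y: "depth_ge (Suc n) u y" "\<not> depth_ge (Suc (Suc n)) u y"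
    and st: "\<And>d. d \<in> set u \<Longrightarrow> \<not> depth_ge (Suc n) u d \<Longrightarrow> stable u v d"
    and b: "1 \<le> before u x y" "1 \<le> before v y x"
    and adj: "\<And>d. 1 \<le> before u x d \<Longrightarrow> d \<noteq> y \<Longrightarrow> 1 \<le> before u y d"
  shows "N_law (\<approx>) n"
proof -
  have c: "2 \<le> count_list u x" "2 \<le> count_list u y" using x(1) y(1) by simp_all
  have ex: "\<And>d. d \<in> set u \<Longrightarrow> before u x d = 1 \<Longrightarrow> depth_ge n u d" and ey: "\<And>d. d \<in> set u \<Longrightarrow> before u y d = 1 \<Longrightarrow> depth_ge n u d"
    using x(1) y(1) by auto
  obtain p1 where p1: "p1 \<in> set u" "before u x p1 = 1" "\<not> depth_ge (Suc n) u p1"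
    using x(2) c by (auto simp only: depth_ge.simps)
  obtain p2 where p2: "p2 \<in> set u" "before u y p2 = 1" "\<not> depth_ge (Suc n) u p2"
    using y(2) c by (auto simp only: depth_ge.simps)
  have "p1 \<noteq> y" using p1(3) y(1) by blast
  then have "1 \<le> before u y p1" using adj p1(2) by simp
  then obtain s where s: "s \<in> set u" "before u x s = 1" "before u y s = 1"
    "\<not> depth_ge (Suc n) u s"
    using common_edge[of u x y p1 p2] b(1) p1 p2 by auto
  obtain bs where bs: "length bs = n" "distinct (s # bs)" "path u s bs"
    "\<And>d. d \<in> set bs \<Longrightarrow> d \<in> set u \<and> \<not> depth_ge n u d \<and> 1 \<le> before u s d"
    using ex_path[OF ex[OF s(1,2)] s(4,1)] by blast
  have bst: "stable u v d" if "d \<in> set bs" for d using bs(4)[OF that] st depth_ge_SucD by blast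
  have d: "before u x d = 2 \<and> before u y d = 2" if "d \<in> set bs" for d
  proof -
    have "1 \<le> before u x d" "1 \<le> before u y d"
      using before_mono[of u s d] bs(4)[OF that] s(2,3) by metis+
    moreover have "before u x d \<noteq> 1" "before u y d \<noteq> 1" using ex ey bs(4)[OF that]
      by blast+
    ultimately show ?thesis using before_le2[of u x d] before_le2[of u y d] by linarith
  qed
  then have d': "before v x d = 2 \<and> before v y d = 2" if "d \<in> set bs" for d
    using stableD[OF bst[OF that]] that by simp
  have ss: "stable u v s" using st s by blast
  then have s': "before v x s = 1" "before v y s = 1" using s by (simp_all add: stable_def)
  have pv: "path v s bs" using path_stable[OF sim _ bs(3)] bst by blast
  have c': "2 \<le> count_list v x" "2 \<le> count_list v y" using c similar_count[OF sim] by blast+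
  have xy: "x \<noteq> y" using b by auto
  have "x \<notin> set (s # bs)" "y \<notin> set (s # bs)" using d s
    by (metis before_self set_ConsD zero_neq_numeral zero_neq_one)+
  then have dist: "distinct (x # y # s # bs)" using bs(2) xy by auto
  have u1: "before u x y = 1" using before_mono[of u y s x] s(2,3) b(1) by linarith
  have v1: "before v y x = 1" using before_mono[of v x s y] s' b(2) by linarith
  have 1: "agree u ([x,y,s,x,y] @ tail [s] (letters bs))"
    by (rule agree_N[OF bs(3) dist s(2,3) u1 d c])
  have "agree v ([y,x,s,y,x] @ tail [s] (letters bs))"
    by (rule agree_N) (use pv dist s' v1 d' c' in simp_all)
  then have "[x,y,s,x,y] @ tail [s] (letters bs) \<approx> [y,x,s,y,x] @ tail [s] (letters bs)"
    using agree_eq[OF e 1] by fastforce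
  moreover have "[y,x,s,y,x] @ tail [s] (letters bs) \<approx> [y,x,s,x,y] @ tail [s] (letters bs)"
    using swap_seconds[of y "[y,x,s]" x] by simp
  ultimately have
    "[x,y,s,x,y] @ tail [s] (letters bs) \<approx> [y,x,s,x,y] @ tail [s] (letters bs)"
    by (rule trans)
  then show ?thesis using N_lawI[OF dist] bs(1) by simp
qed

lemma extract_commutative:
  assumes "u \<approx> v" "count_list u x = 1" "count_list u y = 1" "count_list v x = 1"
    "count_list v y = 1"
    "1 \<le> before u x y" "1 \<le> before v y x"
  shows "commutative_law (\<approx>)"
proof (rule commutative_lawI)
  show xy: "x \<noteq> y" using assms(6) by auto
  have "before u x y = 1" "before v y x = 1" using assms before_le_count by (metis le_antisym)+
  moreover have "before u y x = 0" "before v x y = 0" using assms before_asym by blast+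
  ultimately have "agree u [x,y]" "agree v [y,x]"
    using assms xy by (auto simp: agree_def before_Cons)
  then show "[x,y] \<approx> [y,x]" using agree_eq[OF assms(1)] by fastforce
qed

end

lemma R_any_inf [simp]: "R_any T \<infinity> = R_inf T"
  and R_any_enat [simp]: "R_any T (enat n) = R_law T n"
  by (simp_all add: R_any_def)

section \<open>Deriving all identities from the laws\<close>

text \<open>\<open>E\<close> stands for any theory inside \<open>T\<close> that contains the
  candidate basis; the goal is the converse of \<open>sub\<close>. Parameters are tied to
  \<open>l\<close>, except in \<open>K_transfer\<close>, which accepts a smaller one.\<close>

locale theory_pair = T: P_theory T + E: P_theory E
  for T E :: "nat list \<Rightarrow> nat list \<Rightarrow> bool" +
  fixes l :: enat
  assumes sub: "E u v \<Longrightarrow> T u v"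
    and R_least: "R_law T n \<Longrightarrow> l \<le> enat n"
    and R_transfer: "l = enat n \<Longrightarrow> R_law T n \<and> R_law E n"
    and R_inf_transfer: "R_inf T \<Longrightarrow> R_inf E"
    and K_transfer: "K_law T m \<Longrightarrow> \<exists>k\<le>m. K_law E k"
    and L_transfer: "l = enat (j + m) \<Longrightarrow> L_law T m j \<Longrightarrow> L_law E m j"
    and M_transfer: "l = enat n \<Longrightarrow> M_law T n \<Longrightarrow> M_law E n"
    and M_inf_transfer: "M_inf T \<Longrightarrow> M_inf E"
    and N_transfer: "l = enat (Suc n) \<Longrightarrow> N_law T n \<Longrightarrow> N_law E n"
    and commutative_transfer: "commutative_law T \<Longrightarrow> commutative_law E"
begin

lemma stable_l:
  "T u v \<Longrightarrow> similar u v \<Longrightarrow> \<not> depth_at_least l u b \<Longrightarrow> stable u v b"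
  using T.stable_below R_least by blast

lemma R_any_l:
  assumes "T u v" "similar u v" "\<not> stable u v b"
  shows "R_any E l"
proof (cases l)
  case (enat n)
  then show ?thesis using R_transfer by simp
next
  case infinity
  then show ?thesis using R_inf_transfer T.unstable_R_inf[OF assms] by simp
qed

text \<open>\<open>z\<close> is unstable, hence of depth at least \<open>l\<close>. If some new
  letter of \<open>q\<close> has depth less than \<open>l\<close>, take \<open>s\<close> of least
  depth \<open>m\<close>; letters of depth at most \<open>m\<close> are stable. Then depth of
  \<open>z\<close> above \<open>l\<close> leads to \<open>K_law\<close>, depth exactly
  \<open>l\<close> to \<open>L_law\<close>. The disjunction covers both directions of the
  interchange.\<close>

lemma cross_step:
  assumes u: "u = g @ x # q @ x # z # w \<or> u = g @ x # q @ z # x # w"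
    and e: "T u v" and sim: "similar u v"
    and x: "x \<notin> set g" "x \<notin> set q" and z: "z \<notin> set (g @ x # q)"
    and d: "before u x z \<noteq> before v x z"
  shows "E (g @ x # q @ x # z # w) (g @ x # q @ z # x # w)"
proof -
  let ?U = "g @ x # q @ x # z # w"
  define h where "h = g @ x # q"
  have uh: "u = h @ x # z # w \<or> u = h @ z # x # w" using u by (simp add: h_def)
  have su: "set u = set ?U" and zu: "z \<in> set u" using u by auto
  have tr: "depth_at_least k u c \<longleftrightarrow> depth_at_least k ?U c"
    if "c \<notin> set (g @ [x])" for c k
    using u depth_at_least_cross[of x "g @ [x]" c k q z w] that by auto
  have dtr: "depth_ge k u c \<longleftrightarrow> depth_ge k ?U c"
    if "c \<notin> set (g @ [x])" for c k
    using tr[OF that, of "enat k"] by simp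
  have zgx: "z \<notin> set (g @ [x])" using z by auto
  have nst: "\<not> stable u v z" using d by (auto simp: stable_def)
  then have zl: "depth_at_least l u z" using stable_l[OF e sim] by blast
  have R: "R_any E l" by (rule R_any_l[OF e sim nst])
  have twice: "2 \<le> count_list (g @ x # q) a" if "a \<in> set q" "a \<in> set g" for a
  proof -
    have "count_list g a \<noteq> 0" "count_list q a \<noteq> 0" using that
      by (simp_all add: count_list_0_iff)
    then show ?thesis by simp
  qed
  show ?thesis
  proof (cases "\<forall>a\<in>set q. a \<notin> set g \<longrightarrow> depth_at_least l ?U a")
    case True
    show ?thesis
      by (rule E.cross_free[OF R]) (use True twice tr[OF zgx] zl zgx in blast)+
  next
    case False
    then obtain a n where a: "a \<in> set q" "a \<notin> set g" "enat n \<le> l"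
      "\<not> depth_ge n ?U a"
      by (auto simp: depth_at_least_def)
    then obtain k where k: "n = Suc k" by (cases n) auto
    define P where
      "P m \<longleftrightarrow> (\<exists>a\<in>set q. a \<notin> set g \<and> \<not> depth_ge (Suc m) ?U a)" for m
    have "P k" using a k by (auto simp: P_def)
    define m where "m = (LEAST m. P m)"
    have m: "P m" "m \<le> k" "\<And>i. i < m \<Longrightarrow> \<not> P i"
      unfolding m_def
        using LeastI[of P k] Least_le[of P k] not_less_Least[of _ P] \<open>P k\<close> by blast+
    have ml: "enat (Suc m) \<le> l" using m(2) a(3) k
      by (meson Suc_le_mono enat_ord_simps(1) order_trans)
    obtain s where s: "s \<in> set q" "s \<notin> set g" "\<not> depth_ge (Suc m) ?U s" using m(1)
      by (auto simp: P_def)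
    have qm: "depth_ge m ?U b" if "b \<in> set q" "b \<notin> set g" for b
    proof (cases m)
      case (Suc i)
      then show ?thesis using m(3)[of i] that unfolding P_def by blast
    qed simp
    have low: "depth_ge m u c" if "depth_at_least l u c" for c
      using that ml by (metis Suc_ile_eq depth_at_least_def order_less_imp_le)
    have sgx: "s \<notin> set (g @ [x])" using s x by auto
    have dgs: "depth_ge m u s" "\<not> depth_ge (Suc m) u s" using qm[OF s(1,2)] s(3) dtr[OF sgx]
      by blast+
    have "before q x s = 0" using before_le_count[of q x s] x(2) by (simp add: count_notin)
    then have xs: "before u x s = 1" using u s x
      by (auto simp: before_append before_Cons count_notin)
    have "count_list h s \<noteq> 0" using s(1) by (auto simp: h_def count_list_0_iff)
    then have sz: "1 \<le> before u s z" using uh z by (auto simp: before_append before_Cons h_def)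
    have "count_list h x \<noteq> 0" by (simp add: h_def)
    then have xd: "before u x d = 2" if "1 \<le> before u z d" for d
    proof -
      have "d \<notin> set h" using that before_prefix_zero[of d h z] uh z by (auto simp: h_def)
      moreover from this have "d \<noteq> x" by (auto simp: h_def)
      moreover have "d \<noteq> z" using that by auto
      ultimately show ?thesis using uh \<open>count_list h x \<noteq> 0\<close>
        by (auto simp: before_append before_Cons)
    qed
    \<comment> \<open>A letter of depth less than \<open>m\<close> that follows \<open>s\<close> is
      not in \<open>q\<close>, by minimality of \<open>m\<close>, and is not \<open>z\<close>; so it
      comes after \<open>z\<close>.\<close>
    have hd: "1 \<le> before u z d"
      if d: "d \<in> set u" "\<not> depth_ge m u d" "1 \<le> before u s d" for d
    proof -
      have dgx: "d \<notin> set (g @ [x])"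
        using d(3) before_prefix_zero[of d "g @ [x]" s] sgx u by auto
      then have "d \<notin> set q" using qm[of d] dtr[OF dgx, of m] d(2) by auto
      then have "d \<notin> set h" using dgx by (auto simp: h_def)
      moreover have "d \<noteq> z" using low[OF zl] d(2) by blast
      ultimately show ?thesis using uh dgx by (auto simp: before_append before_Cons)
    qed
    have st: "stable u v d" if "\<not> depth_ge (Suc m) u d" for d
      using stable_l[OF e sim] that ml by (auto simp del: depth_ge.simps simp: depth_at_least_def)
    have su': "s \<in> set u" using su s(1) by auto
    have cx: "2 \<le> count_list u x" using u by auto
    have U1: "depth_ge i ?U b" if "b \<in> set q" "b \<notin> set g" "i \<le> m" for b i
      using qm[OF that(1,2)] depth_ge_le that(3) by blast
    show ?thesis
    proof (cases "depth_at_least (eSuc l) u z")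
      case True
      then have "2 \<le> count_list u z"
        "\<And>d. d \<in> set u \<Longrightarrow> before u z d = 1 \<Longrightarrow> depth_ge m u d"
        using low depth_at_least_eSuc by blast+
      then have "K_law T m"
        using T.extract_K[OF e sim zu su' xs sz d dgs st hd xd cx] by blast
      then obtain k where k: "k \<le> m" "K_law E k" using K_transfer by blast
      show ?thesis
        by (rule E.cross_K[OF R k(2)]) (use twice U1[OF _ _ k(1)] True tr[OF zgx] z in blast)+
    next
      case False
      then obtain n where n: "l = enat n" using zl by (cases l) auto
      then have "m \<le> n" using ml by simp
      define j where "j = n - m"
      have j: "n = j + m" using \<open>m \<le> n\<close> by (simp add: j_def)
      have dgz: "depth_ge (j + m) u z" "\<not> depth_ge (Suc (j + m)) u z"
        using zl False unfolding n j by (simp_all add: eSuc_enat del: depth_ge.simps)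
      have st': "stable u v d" if "\<not> depth_ge (j + m) u d" for d
        using stable_l[OF e sim] that unfolding n j by simp
      have "L_law T m j"
        using T.extract_L[OF e sim zu su' xs sz d dgs st hd xd cx dgz st'] by blast
      then have "L_law E m j" using L_transfer n j by blast
      then show ?thesis
        by (rule E.cross_L) (use twice U1[OF _ _ order_refl] dgz(1) dtr[OF zgx] in blast)+
    qed
  qed
qed

text \<open>Both letters are unstable, hence of depth at least \<open>l\<close>. If both are deeper
  than \<open>l\<close>, \<open>M_inf\<close> applies; if one is, \<open>M_law\<close>; if none is,
  \<open>N_law\<close>, or commutativity when \<open>l\<close> is 0.\<close>

lemma exchange_step:
  assumes e: "T (g @ x # y # w) v" and sim: "similar (g @ x # y # w) v"
    and g: "x \<notin> set g" "y \<notin> set g" "x \<noteq> y"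
    and d: "before v x y < before (g @ x # y # w) x y"
  shows "E (g @ x # y # w) (g @ y # x # w)"
proof -
  define u where "u = g @ x # y # w"
  note e = e[folded u_def] and sim = sim[folded u_def] and d = d[folded u_def]
  have uxy: "before u x y = 1" using g by (simp add: u_def before_append before_Cons count_notin)
  then have vxy: "before v x y = 0" using d by simp
  have uyx: "before u y x = 0" using uxy before_asym by simp
  have "x \<in> set v" using similar_set[OF sim] by (auto simp: u_def)
  then have vyx: "1 \<le> before v y x" using before_total vxy g(3) by blast
  have ny: "\<not> stable u v y" using uxy vxy stableD[of u v y x] by auto
  have nx: "\<not> stable u v x" using uyx vyx stableD[of u v x y] by auto
  have xl: "depth_at_least l u x" and yl: "depth_at_least l u y" using stable_l[OF e sim] nx ny
    by blast+
  have R: "R_any E l" by (rule R_any_l[OF e sim nx])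
  have adj: "1 \<le> before u y d" if "1 \<le> before u x d" "d \<noteq> y" for d
  proof -
    have "d \<notin> set g" using that before_prefix_zero[of d g x] g by (auto simp: u_def)
    moreover have "d \<noteq> x" using that(1) by auto
    ultimately show ?thesis using that(2) by (simp add: u_def before_append before_Cons)
  qed
  have xu: "x \<in> set u" and yu: "y \<in> set u" by (simp_all add: u_def)
  consider "depth_at_least (eSuc l) u x" "depth_at_least (eSuc l) u y" |
    "depth_at_least (eSuc l) u x" "\<not> depth_at_least (eSuc l) u y"
    | "\<not> depth_at_least (eSuc l) u x" "depth_at_least (eSuc l) u y" |
      "\<not> depth_at_least (eSuc l) u x" "\<not> depth_at_least (eSuc l) u y" by blast
  then show ?thesis
  proof cases
    case 1
    then have c: "2 \<le> count_list u x" "2 \<le> count_list u y" using depth_at_least_eSuc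
      by blast+
    then have c': "2 \<le> count_list v x" "2 \<le> count_list v y" using similar_count[OF sim]
      by blast+
    have "M_inf T"
      using T.extract_M_inf[OF e T.unstable_R_inf[OF e sim nx] c(1) c'(1) c(2) c'(2)] uxy vyx
        by simp
    then show ?thesis
      using E.exchange_inf[OF R M_inf_transfer g] 1 by (simp add: u_def)
  next
    case 2
    then obtain n where n: "l = enat n" using yl by (cases l) auto
    have yn: "depth_ge n u y" "\<not> depth_ge (Suc n) u y" using yl 2 n
      by (simp_all add: eSuc_enat del: depth_ge.simps)
    obtain bs where bs: "length bs = n" "distinct (y # bs)" "path u y bs"
      "\<And>d. d \<in> set bs \<Longrightarrow> d \<in> set u \<and> \<not> depth_ge n u d \<and> 1 \<le> before u y d"
      using ex_path[OF yn yu] by blast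
    have st: "stable u v d" if "d \<in> set bs" for d using stable_l[OF e sim] bs(4)[OF that] n
      by simp
    have d2: "before u x d = 2" if "d \<in> set bs" for d
    proof -
      have "1 \<le> before u x d" using before_mono[of u y d x] bs(4)[OF that] uxy by simp
      moreover have "before u x d \<noteq> 1"
        using 2(1) bs(4)[OF that] n unfolding depth_at_least_eSuc by auto
      ultimately show ?thesis using before_le2[of u x d] by linarith
    qed
    have d3: "before u x d = 2 \<and> before v x d = 2" if "d \<in> set bs" for d
      using d2[OF that] stableD[OF st[OF that]] by simp
    have "x \<notin> set bs" using d2 by (metis before_self zero_neq_numeral)
    then have dist: "distinct (x # y # bs)" using bs(2) g(3) by auto
    have c: "2 \<le> count_list u x" using 2(1) depth_at_least_eSuc by blast
    then have c': "2 \<le> count_list v x" using similar_count[OF sim] by blast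
    have pv: "path v y bs" using path_stable[OF sim _ bs(3)] st by blast
    have R': "R_law T (length bs)" using R_transfer n bs(1) by blast
    have "M_law T n"
      using T.extract_M[OF e R' bs(3) pv dist d3 c c' _ vyx] uxy bs(1) by simp
    then show ?thesis
      using E.exchange_M[OF _ M_transfer[OF n] g] 2(1) yn(1) R n by (simp add: u_def)
  next
    case 3
    then obtain n where n: "l = enat n" using xl by (cases l) auto
    have xn: "depth_ge n u x" "\<not> depth_ge (Suc n) u x" using xl 3 n
      by (simp_all add: eSuc_enat del: depth_ge.simps)
    obtain bs where bs: "length bs = n" "distinct (x # bs)" "path u x bs"
      "\<And>d. d \<in> set bs \<Longrightarrow> d \<in> set u \<and> \<not> depth_ge n u d \<and> 1 \<le> before u x d"
      using ex_path[OF xn xu] by blast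
    have st: "stable u v d" if "d \<in> set bs" for d using stable_l[OF e sim] bs(4)[OF that] n
      by simp
    have ybs: "y \<notin> set bs" using bs(4) yl n by auto
    have d2: "before u y d = 2" if "d \<in> set bs" for d
    proof -
      have "1 \<le> before u y d" using adj[of d] bs(4)[OF that] ybs that by auto
      moreover have "before u y d \<noteq> 1"
        using 3(2) bs(4)[OF that] n unfolding depth_at_least_eSuc by auto
      ultimately show ?thesis using before_le2[of u y d] by linarith
    qed
    have d3: "before v y d = 2 \<and> before u y d = 2" if "d \<in> set bs" for d
      using d2[OF that] stableD[OF st[OF that]] by simp
    have dist: "distinct (y # x # bs)" using bs(2) g(3) ybs by auto
    have c: "2 \<le> count_list u y" using 3(2) depth_at_least_eSuc by blast
    then have c': "2 \<le> count_list v y" using similar_count[OF sim] by blast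
    have pv: "path v x bs" using path_stable[OF sim _ bs(3)] st by blast
    have R': "R_law T (length bs)" using R_transfer n bs(1) by blast
    have "M_law T n"
      using T.extract_M[OF T.sym[OF e] R' pv bs(3) dist d3 c' c vyx] uxy bs(1) by simp
    then have M: "M_law E n" by (rule M_transfer[OF n])
    \<comment> \<open>Here \<open>y\<close> is the letter to be doubled, so
      \<open>exchange_M\<close> is applied to the interchanged word with the roles of
      \<open>x\<close> and \<open>y\<close> swapped.\<close>
    have "depth_at_least (eSuc (enat n)) (g @ y # x # w) y"
      "depth_at_least (enat n) (g @ y # x # w) x"
      using depth_at_least_exchange3[OF g, of "enat n" w] depth_at_least_exchange1[OF g, of
        "enat n" w] 3(2) xl n
      by (simp_all only: u_def)
    then have "E (g @ y # x # w) (g @ x # y # w)"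
      using E.exchange_M[OF _ M g(2,1) g(3)[symmetric]] R n by simp
    then show ?thesis by (rule E.sym)
  next
    case 4
    then obtain n where n: "l = enat n" using xl by (cases l) auto
    have xn: "depth_ge n u x" "\<not> depth_ge (Suc n) u x" and yn: "depth_ge n u y"
      "\<not> depth_ge (Suc n) u y"
      using xl yl 4 n by (simp_all add: eSuc_enat del: depth_ge.simps)
    show ?thesis
    proof (cases n)
      case 0
      have c: "count_list u x = 1" "count_list u y = 1"
        using ex_path[of 0 u x] ex_path[of 0 u y] xn yn xu yu 0 by auto
      then have c': "count_list v x = 1" "count_list v y = 1" using similar_count[OF sim] by blast+
      have "commutative_law T"
        using T.extract_commutative[OF e c c'] uxy vyx by simp
      then have "E ([x] @ [y]) ([y] @ [x])" using commutative_transfer unfolding commutative_law_def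
        by blast
      from E.ctx[OF this, of g w] show ?thesis by simp
    next
      case (Suc k)
      have st: "stable u v d" if "\<not> depth_ge (Suc k) u d" for d
        using stable_l[OF e sim] that n Suc by (simp del: depth_ge.simps)
      have "N_law T k"
        using T.extract_N[OF e sim xn[unfolded Suc] yn[unfolded Suc] st _ vyx adj] uxy by simp
      then show ?thesis
        using E.exchange_N[OF N_transfer g] n Suc xn(1) yn(1)
          by (simp add: u_def del: depth_ge.simps)
    qed
  qed
qed

lemma short_imp_E:
  assumes "T u v" "mset u = mset v" "short v"
  shows "E u v"
proof (rule E.bubble_sort[where Q = "\<lambda>u. T u v"])
  fix h d c w
  assume a: "T (h @ d # c # w) v" "mset (h @ d # c # w) = mset v" "d \<noteq> c"
    "c \<notin> set h \<and> before v d c < before (h @ d # c # w) d c \<or>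
     count_list h c = 1 \<and> d \<notin> set h \<and> before (h @ d # c # w) c d < before v c d \<or>
     c \<in> set h \<and> d \<in> set h"
  let ?u = "h @ d # c # w"
  have cnt: "count_list ?u x = count_list v x" for x using a(2) by (metis count_mset)
  then have sim: "similar ?u v" unfolding similar_def by metis
  have split1: "\<exists>g q. h = g @ x # q \<and> x \<notin> set g \<and> x \<notin> set q"
    if xh: "x \<in> set h" "count_list h x \<le> 1" for x
  proof -
    obtain g q where h: "h = g @ x # q" "x \<notin> set g" using split_list_first[OF xh(1)] by blast
    then have "count_list q x = 0" using xh(2) by simp
    then show ?thesis using h count_list_0_iff by metis
  qed
  have "E ?u (h @ c # d # w)"
    using a(4)
  proof (elim disjE conjE)
    assume c: "c \<notin> set h" "before v d c < before ?u d c"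
    show ?thesis
    proof (cases "d \<in> set h")
      case True
      have "count_list h d + 1 \<le> count_list ?u d" by simp
      also have "\<dots> \<le> 2" unfolding cnt using assms(3) by (simp add: short_def)
      finally obtain g q where h: "h = g @ d # q" "d \<notin> set g" "d \<notin> set q"
        using split1[OF True] by auto
      show ?thesis
        using cross_step[of ?u g d q c w v] a(1) sim h c by simp
    next
      case False
      then show ?thesis using exchange_step[OF a(1) sim False c(1) a(3) c(2)] by simp
    qed
  next
    assume c: "count_list h c = 1" "d \<notin> set h" "before ?u c d < before v c d"
    then have "c \<in> set h" by (metis count_list_0_iff zero_neq_one)
    then obtain g q where h: "h = g @ c # q" "c \<notin> set g" "c \<notin> set q"
      using split1[of c] c(1) by (metis order_refl)
    have "E (g @ c # q @ c # d # w) (g @ c # q @ d # c # w)"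
      using cross_step[of ?u g c q d w v] a(1) sim h c(2,3) by simp
    then show ?thesis using E.sym h(1) by simp
  next
    assume "c \<in> set h" "d \<in> set h"
    then show ?thesis by (rule E.swap_seconds[rotated])
  qed
  \<comment> \<open>\<open>E\<close> lies inside \<open>T\<close>, so the new word is still
    \<open>T\<close>-equal to \<open>v\<close> and the next step can again read off a law.\<close>
  then show "E ?u (h @ c # d # w) \<and> T (h @ c # d # w) v"
    using sub T.sym T.trans a(1) by blast
qed fact+

lemma similar_imp_E:
  assumes "T u v" "similar u v"
  shows "E u v"
proof -
  obtain u' v' where u': "E u u'" "same u u'" "short u'" and v': "E v v'" "same v v'" "short v'"
    using E.shorten by meson
  have "T u' v'" using assms(1) u'(1) v'(1) sub T.sym T.trans by blast
  moreover have "mset u' = mset v'"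
    by (rule E.short_same_mset[OF u'(3) v'(3)])
      (use assms(2) same_count[OF u'(2)] same_count[OF v'(2)] in \<open>simp add: similar_def\<close>)
  ultimately have "E u' v'" using short_imp_E v'(3) by blast
  then show ?thesis using u'(1) v'(1) E.sym E.trans by blast
qed

end

section \<open>Identities that change the multiplicity of a letter\<close>

lemma filter_single: "filter (\<lambda>y. y \<in> {x}) u = replicate (count_list u x) x"
  by (induction u) auto

lemma same_replicate:
  assumes "2 \<le> k"
  shows "same (replicate k x) [x,x]"
proof -
  have "replicate k x = [x,x] @ replicate (k - 2) x"
    using assms by (metis add_2_eq_Suc le_add_diff_inverse replicate_Suc append_Cons append_Nil)
  moreover have "same ([x,x] @ replicate (k - 2) x @ []) ([x,x] @ [])"
    by (rule same_insert) auto
  ultimately show ?thesis by simp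
qed

lemma (in P_theory) trivialI:
  assumes "u \<approx> v" "x \<in> set u" "x \<notin> set v"
  shows "[0] \<approx> []"
proof -
  have 1: "replicate (count_list u x) x \<approx> []"
    using restrict[OF assms(1), of "{x}"] assms(3) unfolding filter_single
      by (simp add: count_notin)
  have 0: "count_list u x \<noteq> 0" using assms(2) by (simp add: count_list_0_iff)
  have "[x] \<approx> []"
  proof (cases "count_list u x = 1")
    case False
    then have "same (replicate (count_list u x) x) [x,x]"
      using 0 by (intro same_replicate) simp
    then have 2: "[x,x] \<approx> []" using 1 same_eq_trans same_sym by blast
    \<comment> \<open>Since third occurrences are free, xx = 1 gives x = xxx = xx = 1.\<close>
    have "same [x,x] [x,x,x]" by (auto simp: same_def before_Cons)
    then have 3: "[x,x] \<approx> [x,x,x]" by (rule same_imp_eq)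
    have "[x,x,x] \<approx> [x]" using cong[OF refl[of "[x]"] 2] by simp
    then show ?thesis using 2 3 sym trans by blast
  qed (use 1 in simp)
  from subst[OF this, of "\<lambda>y. [0]"] show ?thesis by simp
qed

lemma (in P_theory) idempotentI:
  assumes "u \<approx> v" "count_list u x = 1" "2 \<le> count_list v x"
  shows "[0] \<approx> [0,0]"
proof -
  have "[x] \<approx> replicate (count_list v x) x"
    using restrict[OF assms(1), of "{x}"] assms(2) unfolding filter_single by simp
  moreover have "same (replicate (count_list v x) x) [x,x]"
    using assms(3) by (rule same_replicate)
  ultimately have "[x] \<approx> [x,x]" using eq_same_trans by blast
  from subst[OF this, of "\<lambda>y. [0]"] show ?thesis by simp
qed

lemma (in theory_pair) T_imp_E:
  assumes "T [0] [] \<Longrightarrow> E [0] []" "T [0] [0,0] \<Longrightarrow> E [0] [0,0]" "T u v"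
  shows "E u v"
proof (cases "set u = set v")
  case False
  then have "T [0] []" using T.trivialI assms(3) T.sym by blast
  then have 0: "E [y] []" for y using E.subst[OF assms(1), of "\<lambda>_. [y]"] by simp
  have "E w []" for w
  proof (induction w)
    case (Cons y w)
    then show ?case using E.cong[OF 0[of y]] by fastforce
  qed simp
  then show ?thesis using E.sym E.trans by blast
next
  case set: True
  show ?thesis
  proof (cases "similar u v")
    case False
    then obtain x where x: "min 2 (count_list u x) \<noteq> min 2 (count_list v x)"
      by (auto simp: similar_def)
    have "count_list u x = 0 \<longleftrightarrow> count_list v x = 0" using set
      by (simp add: count_list_0_iff)
    then have "count_list u x = 1 \<and> 2 \<le> count_list v x \<or> count_list v x = 1 \<and> 2 \<le> count_list u x"
      using x by auto
    then have "T [0] [0,0]" using T.idempotentI assms(3) T.sym by blast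
    then have 0: "E [y] [y,y]" for y using E.subst[OF assms(2), of "\<lambda>_. [y]"] by simp
    \<comment> \<open>Under x = xx every word equals its doubled form, in which a letter occurs
      never or at least twice; this makes the two sides \<open>similar\<close>.\<close>
    define D where "D = substitute (\<lambda>y. [y,y])"
    have D: "E w (D w)" for w
    proof (induction w)
      case (Cons y w)
      then show ?case using E.cong[OF 0[of y]] by (fastforce simp: D_def)
    qed (simp add: D_def)
    have c: "count_list (D w) x = 2 * count_list w x" for w x
      by (induction w) (auto simp: D_def)
    have "T (D u) (D v)" unfolding D_def by (rule T.subst) fact
    moreover have "similar (D u) (D v)"
      unfolding similar_def c
    proof
      fix x
      have "count_list u x = 0 \<longleftrightarrow> count_list v x = 0" using set
        by (simp add: count_list_0_iff)
      then show "min 2 (2 * count_list u x) = min 2 (2 * count_list v x)" by auto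
    qed
    ultimately have "E (D u) (D v)" by (rule similar_imp_E)
    then show ?thesis using D E.sym E.trans by blast
  qed (use similar_imp_E assms(3) in blast)
qed

section \<open>Size of the laws and the finite basis\<close>

lemma length_tail: "length (tail [b] (letters bs)) = 2 * length bs"
  by (induction bs arbitrary: b) auto

lemma set_tail: "set (tail A Bs) \<subseteq> set A \<union> \<Union>(set ` set Bs)"
  by (induction A Bs rule: tail.induct) auto

lemma length_chain:
  "length (chain [s] [z] (letters cs) (letters bs)) \<le> 2 * length cs + 2 * length bs + 1"
proof (induction cs arbitrary: z)
  case Nil
  then show ?case by (cases bs) (auto simp: length_tail)
qed simp

lemma set_chain:
  "set (chain S A Cs Bs) \<subseteq> set S \<union> set A \<union> \<Union>(set ` set Cs) \<union> \<Union>(set ` set Bs)"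
proof (induction S A Cs Bs rule: chain.induct)
  case (1 S A Bs)
  then show ?case using set_tail[of "A @ S" Bs] by auto
next
  case (2 S A C Cs Bs)
  then show ?case by auto
qed

text \<open>Only theories \<open>E\<close> inside \<open>T\<close> are compared with
  \<open>T\<close>, because the bubble sort reads laws off in \<open>T\<close> and applies them in
  \<open>E\<close>.\<close>

theorem P_theory_finitely_generated:
  assumes "P_theory T"
  shows "\<exists>\<Sigma>. finite \<Sigma> \<and> (\<forall>(u, v)\<in>\<Sigma>. T u v) \<and>
    (\<forall>E. equational_theory E \<longrightarrow> (\<forall>u v. E u v \<longrightarrow> T u v) \<longrightarrow> (\<forall>(u, v)\<in>\<Sigma>. E u v) \<longrightarrow>
       (\<forall>u v. T u v \<longrightarrow> E u v))"
proof -
  interpret T: P_theory T by fact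
  \<comment> \<open>Infinite if \<open>T\<close> contains no \<open>R_law\<close>; then every letter
    of finite depth is stable.\<close>
  define l where "l = (if \<exists>n. R_law T n then enat (LEAST n. R_law T n) else \<infinity>)"
  \<comment> \<open>If no \<open>K_law\<close> holds in \<open>T\<close>, this is an unspecified
    number that merely enlarges \<open>N\<close>.\<close>
  define k where "k = (LEAST m. K_law T m)"
  \<comment> \<open>A law has at most \<open>l\<close> or \<open>k\<close> path letters, at most 3
    others, and length at most 5 plus twice the number of path letters; the axioms have 4 letters
    and length at most 6. Adding 6 is generous. For infinite \<open>l\<close> only
    \<open>K_law\<close> has a parameter, hence the 0.\<close>
  define N where "N = (case l of enat n \<Rightarrow> n | \<infinity> \<Rightarrow> 0) + k + 6"
  define B where "B = {w. set w \<subseteq> {..<N} \<and> length w \<le> 2 * N}"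
  define \<Sigma> where "\<Sigma> = {(u, v) \<in> B \<times> B. T u v}"
  have "finite B" unfolding B_def by (rule finite_lists_length_le) simp
  then have fin: "finite \<Sigma>"
    by (intro finite_subset[of \<Sigma> "B \<times> B"]) (auto simp: \<Sigma>_def)
  have lN: "n + 6 \<le> N" if "l = enat n" for n using that by (simp add: N_def)
  have kN: "k + 6 \<le> N" by (simp add: N_def)
  have least: "l \<le> enat n" if "R_law T n" for n
    using that Least_le[of "R_law T" n] by (auto simp: l_def)
  have law_l: "R_law T n" if "l = enat n" for n
    using that LeastI_ex[of "R_law T"] by (auto simp: l_def split: if_splits)
  have "E u v"
    if "equational_theory E" and sub: "\<And>u v. E u v \<Longrightarrow> T u v" and gen:
      "\<forall>(u, v)\<in>\<Sigma>. E u v"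
    and "T u v" for E u v
  proof -
    interpret E: equational_theory E by fact
    have bd: "E u v" if "T u v" "u \<in> B" "v \<in> B" for u v
      using gen that by (auto simp: \<Sigma>_def)
    have E1: "E [0,1,0,2,0] [0,1,0,2]" by (rule bd[OF T.P1]) (auto simp: B_def N_def)
    have E2: "E [0,2,1,3,0,1] [0,2,1,3,1,0]" by (rule bd[OF T.P2]) (auto simp: B_def N_def)
    interpret E: P_theory E using E1 E2 by unfold_locales
    have RE: "R_law E n" if "R_law T n" "n + 6 \<le> N" for n
    proof -
      define bs where "bs = [2..<n+2]"
      have len: "length bs = n" unfolding bs_def length_upt by simp
      have "T ([0,0,1] @ tail [1] (letters bs)) ([0,1,0] @ tail [1] (letters bs))"
        using that(1)[unfolded R_law_def, rule_format, of "letters bs" "[0]" "[1]"] len by simp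
      then have "E ([0,0,1] @ tail [1] (letters bs)) ([0,1,0] @ tail [1] (letters bs))"
        by (rule bd) (use set_tail[of "[1]"
          "letters bs"] that(2) in \<open>auto simp: B_def length_tail bs_def\<close>)
      moreover have "distinct (0 # 1 # bs)" by (simp add: bs_def)
      ultimately show ?thesis using E.R_lawI len by blast
    qed
    interpret theory_pair T E l
    proof unfold_locales
      show "T u v" if "E u v" for u v by (rule sub) fact
      show "l \<le> enat n" if "R_law T n" for n by (rule least) fact
      show "R_law T n \<and> R_law E n" if "l = enat n" for n
        using law_l[OF that] RE lN[OF that] by blast
      show "R_inf E" if "R_inf T"
      proof (rule E.R_infI[of 0 1])
        have "T [0,0,1,1] [0,1,0,1]"
          using that[unfolded R_inf_def, rule_format, of "[0]" "[1]"] by simp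
        then show "E [0,0,1,1] [0,1,0,1]" by (rule bd) (auto simp: B_def N_def)
      qed simp
      show "M_inf E" if "M_inf T"
      proof (rule E.M_infI[of 0 1])
        have "T [0,0,1,1] [1,1,0,0]"
          using that[unfolded M_inf_def, rule_format, of "[0]" "[1]"] by simp
        then show "E [0,0,1,1] [1,1,0,0]" by (rule bd) (auto simp: B_def N_def)
      qed simp
      show "commutative_law E" if "commutative_law T"
      proof (rule E.commutative_lawI[of 0 1])
        have "T [0,1] [1,0]"
          using that[unfolded commutative_law_def, rule_format, of "[0]" "[1]"] by simp
        then show "E [0,1] [1,0]" by (rule bd) (auto simp: B_def N_def)
      qed simp
      show "\<exists>k\<le>m. K_law E k" if "K_law T m" for m
      proof -
        have K: "K_law T k" "k \<le> m" unfolding k_def using that by (rule LeastI, rule Least_le)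
        define bs where "bs = [3..<k+3]"
        have len: "length bs = k" by (simp add: bs_def)
        have "T ([0,1,0,2,2] @ tail [1] (letters bs)) ([0,1,2,0,2] @ tail [1] (letters bs))"
          using K(1)[unfolded K_law_def, rule_format, of "letters bs" "[0]" "[1]" "[2]"] len by simp
        then have "E ([0,1,0,2,2] @ tail [1] (letters bs)) ([0,1,2,0,2] @ tail [1] (letters bs))"
          by (rule bd) (use set_tail[of "[1]"
            "letters bs"] kN in \<open>auto simp: B_def length_tail bs_def\<close>)
        moreover have "distinct (0 # 1 # 2 # bs)" by (simp add: bs_def)
        ultimately have "K_law E k" using E.K_lawI len by blast
        with K(2) show ?thesis by blast
      qed
      show "L_law E m j" if "l = enat (j + m)" "L_law T m j" for j m
      proof -
        define cs where "cs = [3..<j+3]"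
        define bs where "bs = [j+3..<j+m+3]"
        have len: "length cs = j" "length bs = m" by (simp_all add: bs_def cs_def)
        let ?c = "chain [1] [2] (letters cs) (letters bs)"
        have "T ([0,1,0,2] @ ?c) ([0,1,2,0] @ ?c)"
          using that(2)[unfolded L_law_def, rule_format, of "letters cs" "letters bs" "[0]" "[1]"
            "[2]"] len by simp
        moreover have "set ?c \<subseteq> {..<N}" "length ?c + 4 \<le> 2 * N"
          using set_chain[of "[1]" "[2]" "letters cs"
            "letters bs"] length_chain[of 1 2 cs bs] lN[OF that(1)] len
          by (auto simp: cs_def bs_def)
        ultimately have "E ([0,1,0,2] @ ?c) ([0,1,2,0] @ ?c)"
          using lN[OF that(1)] by (intro bd) (auto simp: B_def)
        moreover have "distinct (0 # 1 # 2 # cs @ bs)" by (auto simp: bs_def cs_def)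
        ultimately show ?thesis using E.L_lawI len by blast
      qed
      show "M_law E n" if "l = enat n" "M_law T n" for n
      proof -
        define bs where "bs = [2..<n+2]"
        have len: "length bs = n" unfolding bs_def length_upt by simp
        have "T ([0,0,1] @ tail [1] (letters bs)) ([1,0,0] @ tail [1] (letters bs))"
          using that(2)[unfolded M_law_def, rule_format, of "letters bs" "[0]" "[1]"] len by simp
        then have "E ([0,0,1] @ tail [1] (letters bs)) ([1,0,0] @ tail [1] (letters bs))"
          by (rule bd) (use set_tail[of "[1]"
            "letters bs"] lN[OF that(1)] in \<open>auto simp: B_def length_tail bs_def\<close>)
        moreover have "distinct (0 # 1 # bs)" by (simp add: bs_def)
        ultimately show ?thesis using E.M_lawI len by blast
      qed
      show "N_law E n" if "l = enat (Suc n)" "N_law T n" for n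
      proof -
        define bs where "bs = [3..<n+3]"
        have len: "length bs = n" unfolding bs_def length_upt by simp
        have "T ([0,1,2,0,1] @ tail [2] (letters bs)) ([1,0,2,0,1] @ tail [2] (letters bs))"
          using that(2)[unfolded N_law_def, rule_format, of "letters bs" "[0]" "[1]" "[2]"] len
            by simp
        then have "E ([0,1,2,0,1] @ tail [2] (letters bs)) ([1,0,2,0,1] @ tail [2] (letters bs))"
          by (rule bd) (use set_tail[of "[2]"
            "letters bs"] lN[OF that(1)] in \<open>auto simp: B_def length_tail bs_def\<close>)
        moreover have "distinct (0 # 1 # 2 # bs)" by (simp add: bs_def)
        ultimately show ?thesis using E.N_lawI len by blast
      qed
    qed
    show "E u v"
    proof (rule T_imp_E)
      show "E [0] []" if "T [0] []" by (rule bd[OF that]) (auto simp: B_def N_def)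
      show "E [0] [0,0]" if "T [0] [0,0]" by (rule bd[OF that]) (auto simp: B_def N_def)
    qed fact
  qed
  then show ?thesis
    using fin by (intro exI[of _ \<Sigma>]) (auto simp: \<Sigma>_def)
qed

section \<open>Varieties\<close>

lemma word_value_Nil [simp]: "word_value G \<phi> [] = \<one>\<^bsub>G\<^esub>"
  and word_value_Cons [simp]:
    "word_value G \<phi> (x # w) = \<phi> x \<otimes>\<^bsub>G\<^esub> word_value G \<phi> w"
  by (simp_all add: word_value_def)

lemma word_value_closed:
  "monoid G \<Longrightarrow> range \<phi> \<subseteq> carrier G \<Longrightarrow> word_value G \<phi> w \<in> carrier G"
  by (induction w) (auto simp: monoid.one_closed intro!: monoid.m_closed)

lemma word_value_append:
  assumes "monoid G" "range \<phi> \<subseteq> carrier G"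
  shows "word_value G \<phi> (u @ v) = word_value G \<phi> u \<otimes>\<^bsub>G\<^esub> word_value G \<phi> v"
  using word_value_closed[OF assms] assms
  by (induction u) (auto simp: monoid.l_one monoid.m_assoc range_subsetD)

lemma word_value_substitute:
  assumes "monoid G" "range \<phi> \<subseteq> carrier G"
  shows "word_value G \<phi> (substitute \<sigma> w) = word_value G (\<lambda>x. word_value G \<phi> (\<sigma> x)) w"
  by (induction w) (simp_all add: word_value_append[OF assms])

lemma equational_theory_satisfies:
  assumes "\<And>G. G \<in> W \<Longrightarrow> monoid G"
  shows "equational_theory (\<lambda>u v. \<forall>G\<in>W. satisfies G (u, v))"
proof
  fix u v \<sigma> assume a: "\<forall>G\<in>W. satisfies G (u, v)"
  show "\<forall>G\<in>W. satisfies G (substitute \<sigma> u, substitute \<sigma> v)"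
    unfolding satisfies_def
  proof (intro ballI allI impI)
    fix G and \<phi> :: "nat \<Rightarrow> 'a" assume G: "G \<in> W"
      "range \<phi> \<subseteq> carrier G"
    then have "range (\<lambda>x. word_value G \<phi> (\<sigma> x)) \<subseteq> carrier G"
      using word_value_closed assms by blast
    then show "word_value G \<phi> (fst (substitute \<sigma> u, substitute \<sigma> v)) = word_value G \<phi> (snd (substitute \<sigma> u, substitute \<sigma> v))"
      using a G by (simp add: word_value_substitute[OF assms[OF G(1)] G(2)] satisfies_def)
  qed
next
  fix u u' v v' assume "\<forall>G\<in>W. satisfies G (u, u')"
    "\<forall>G\<in>W. satisfies G (v, v')"
  then show "\<forall>G\<in>W. satisfies G (u @ v, u' @ v')"
    using assms by (simp add: satisfies_def word_value_append)
qed (simp_all add: satisfies_def)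

section \<open>The axioms in \<open>P21\<close> and the passage to varieties\<close>

text \<open>The elements \<open>a\<close>, \<open>ba\<close> and \<open>b^2\<close> are left zeros,
  so a right factor matters only behind 1 and \<open>b\<close>.\<close>

lemma P21_nf_append:
  "P21_nf (u @ v) =
     (if P21_nf u = [] then P21_nf v else
       if P21_nf u = [gen_b] then P21_nf (gen_b # v) else P21_nf u)"
  by (induction u rule: P21_nf.induct) auto

lemma word_value_P21:
  "word_value P21 (\<lambda>x. pres_class P21_relations (\<rho> x)) w = pres_class P21_relations (concat (map \<rho> w))"
proof (induction w)
  case Nil
  then show ?case by (simp add: P21_def presented_monoid_def)
next
  case (Cons x w)
  then show ?case using presented_monoid_mult[of P21_relations] by (simp add: P21_def)
qed

lemma satisfies_P21:
  assumes "\<And>\<rho>. P21_nf (concat (map \<rho> u)) = P21_nf (concat (map \<rho> v))"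
  shows "satisfies P21 (u, v)"
  unfolding satisfies_def
proof (intro allI impI)
  fix \<phi> :: "nat \<Rightarrow> gen list set" assume "range \<phi> \<subseteq> carrier P21"
  then have "\<exists>r. \<phi> x = pres_class P21_relations r" for x
    by (auto simp: P21_def presented_monoid_def)
  then obtain \<rho> where "\<And>x. \<phi> x = pres_class P21_relations (\<rho> x)" by metis
  then have "\<phi> = (\<lambda>x. pres_class P21_relations (\<rho> x))" by blast
  then show "word_value P21 \<phi> (fst (u, v)) = word_value P21 \<phi> (snd (u, v))"
    using assms by (simp add: word_value_P21 pres_class_eq_iff P21_eq_iff)
qed

lemma P21_satisfies_P1: "satisfies P21 ([0,1,0,2,0], [0,1,0,2])"
  by (rule satisfies_P21) (simp add: P21_nf_append)

lemma P21_satisfies_P2: "satisfies P21 ([0,2,1,3,0,1], [0,2,1,3,1,0])"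
  by (rule satisfies_P21) (simp add: P21_nf_append)

text \<open>\<open>variety_generated_by\<close> speaks of monoids carried by \<open>'a\<close>; an
  infinite type has room for a copy of the finite monoid \<open>P21\<close>.\<close>

lemma ex_isomorphic_copy:
  assumes "infinite (UNIV :: 'a set)" "finite (carrier M)" "monoid M"
  shows "\<exists>N :: 'a monoid. monoid N \<and> M \<cong> N \<and> (\<forall>e. satisfies M e \<longrightarrow> satisfies N e)"
proof -
  interpret M: monoid M by fact
  obtain A :: "'a set" where A: "finite A" "card A = card (carrier M)"
    using infinite_arbitrarily_large[OF assms(1)] by blast
  then obtain f where f: "bij_betw f (carrier M) A"
    using finite_same_card_bij[OF assms(2)] by metis
  define g where "g = inv_into (carrier M) f"
  have gf: "g (f x) = x" if "x \<in> carrier M" for x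
    using that f by (simp add: g_def bij_betw_inv_into_left)
  have fg: "f (g y) = y" and gA: "g y \<in> carrier M" if "y \<in> A" for y
    using that f by (auto simp: g_def bij_betw_inv_into_right bij_betw_def inv_into_into)
  have fA: "f x \<in> A" if "x \<in> carrier M" for x using that f bij_betwE by blast
  define N :: "'a monoid" where
    "N = \<lparr>carrier = A, monoid.mult = (\<lambda>x y. f (g x \<otimes>\<^bsub>M\<^esub> g y)), one = f \<one>\<^bsub>M\<^esub>\<rparr>"
  have N: "carrier N = A" "\<one>\<^bsub>N\<^esub> = f \<one>\<^bsub>M\<^esub>"
    "\<And>x y. x \<otimes>\<^bsub>N\<^esub> y = f (g x \<otimes>\<^bsub>M\<^esub> g y)"
    by (simp_all add: N_def)
  have "monoid N"
    by (rule monoidI) (simp_all add: N gf fg gA fA M.m_assoc)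
  moreover have "M \<cong> N"
    by (rule is_isoI[of f]) (use f in \<open>auto simp: iso_def hom_def N gf fA\<close>)
  moreover have "satisfies N e" if e: "satisfies M e" for e
    unfolding satisfies_def
  proof (intro allI impI)
    fix \<phi> :: "nat \<Rightarrow> 'a" assume "range \<phi> \<subseteq> carrier N"
    then have \<phi>: "\<phi> x \<in> A" for x using N(1) by blast
    then have r: "range (g \<circ> \<phi>) \<subseteq> carrier M" using gA by auto
    have "word_value N \<phi> w = f (word_value M (g \<circ> \<phi>) w)" for w
      by (induction w) (use word_value_closed[OF assms(3) r] in \<open>simp_all add: N gf comp_def\<close>)
    then show "word_value N \<phi> (fst e) = word_value N \<phi> (snd e)"
      using e r by (simp add: satisfies_def)
  qed
  ultimately show ?thesis by blast
qed

theorem proposition6p1: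
  assumes "infinite (UNIV :: 'a set)"
  shows "hereditary_finitely_based (variety_generated_by P21 :: 'a monoid set)"
  unfolding hereditary_finitely_based_def
proof (intro allI impI)
  fix W :: "'a monoid set"
  assume W: "variety W \<and> W \<subseteq> variety_generated_by P21"
  let ?\<Delta> = "{([0,1,0,2,0], [0,1,0,2]), ([0,2,1,3,0,1], [0,2,1,3,1,0])} :: identity set"
  obtain \<Sigma>0 where \<Sigma>0: "W = models \<Sigma>0" using W by (auto simp: variety_def)
  have "finite (carrier P21)" using P21_elements(2) card.infinite by fastforce
  then obtain N :: "'a monoid" where "monoid N" "P21 \<cong> N"
    "\<And>e. satisfies P21 e \<Longrightarrow> satisfies N e"
    using ex_isomorphic_copy[OF assms _ monoid_P21] by blast
  then have "P21 \<cong> N" "N \<in> models ?\<Delta>"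
    using P21_satisfies_P1 P21_satisfies_P2 by (auto simp: models_def)
  moreover have "variety (models ?\<Delta> :: 'a monoid set)"
    unfolding variety_def by (rule exI) (rule HOL.refl)
  ultimately have
    "models ?\<Delta> \<in> {V :: 'a monoid set. variety V \<and> (\<exists>N\<in>V. P21 \<cong> N)}"
    unfolding mem_Collect_eq by (intro conjI bexI[of _ N])
  then have "(variety_generated_by P21 :: 'a monoid set) \<subseteq> models ?\<Delta>"
    unfolding variety_generated_by_def by (rule Inter_lower)
  with W have W\<Delta>: "W \<subseteq> models ?\<Delta>" by blast
  have mon: "monoid G" if "G \<in> W" for G using that \<Sigma>0 by (simp add: models_def)
  define T where "T u v \<longleftrightarrow> (\<forall>G\<in>W. satisfies G (u, v))" for u v
  interpret T: equational_theory T
    unfolding T_def by (rule equational_theory_satisfies) (rule mon)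
  have \<Delta>: "T a b" if "(a, b) \<in> ?\<Delta>" for a b
    unfolding T_def
  proof
    fix G assume "G \<in> W"
    with W\<Delta> have "G \<in> models ?\<Delta>" by (rule subsetD)
    then have "\<forall>e\<in>?\<Delta>. satisfies G e" unfolding models_def mem_Collect_eq
      by (rule conjunct2)
    then show "satisfies G (a, b)" using that by (rule bspec)
  qed
  have "P_theory T"
    by unfold_locales (rule \<Delta>, simp)+
  from P_theory_finitely_generated[OF this] obtain \<Sigma> where \<Sigma>: "finite \<Sigma>"
    "\<forall>(u, v)\<in>\<Sigma>. T u v"
    "\<forall>E. equational_theory E \<longrightarrow> (\<forall>u v. E u v \<longrightarrow> T u v) \<longrightarrow> (\<forall>(u, v)\<in>\<Sigma>. E u v) \<longrightarrow>
       (\<forall>u v. T u v \<longrightarrow> E u v)"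
    by (elim exE conjE)
  have "W = models \<Sigma>"
  proof
    show "W \<subseteq> models \<Sigma>" using \<Sigma>(2) mon by (auto simp: models_def T_def)
    show "models \<Sigma> \<subseteq> W"
    proof
      fix G :: "'a monoid" assume G: "G \<in> models \<Sigma>"
      \<comment> \<open>Joining \<open>G\<close> to \<open>W\<close> puts \<open>E\<close> inside
        \<open>T\<close>; that \<open>E\<close> is all of \<open>T\<close> then says that
        \<open>G\<close> satisfies every identity of \<open>W\<close>.\<close>
      define E where "E u v \<longleftrightarrow> (\<forall>G\<in>insert G W. satisfies G (u, v))"
        for u v
      have monG: "monoid G" and sG: "\<forall>e\<in>\<Sigma>. satisfies G e" using G
        by (simp_all add: models_def)
      have "equational_theory E"
        unfolding E_def by (rule equational_theory_satisfies) (use monG mon in blast)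
      moreover have "\<forall>u v. E u v \<longrightarrow> T u v" by (simp add: E_def T_def)
      moreover have "\<forall>(u, v)\<in>\<Sigma>. E u v" using sG \<Sigma>(2)
        by (auto simp: E_def T_def)
      ultimately have "\<forall>u v. T u v \<longrightarrow> E u v" using \<Sigma>(3) by blast
      then have "satisfies G (u, v)" if "T u v" for u v
        using that by (simp add: E_def)
      moreover have "T u v" if "(u, v) \<in> \<Sigma>0" for u v
        using that \<Sigma>0 by (auto simp: T_def models_def)
      ultimately show "G \<in> W" using monG unfolding \<Sigma>0 models_def by auto
    qed
  qed
  with \<Sigma>(1) show "finitely_based W" by (auto simp: finitely_based_def)
qed

end
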